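(* Let $\mathbf{F}\colon\mathcal{DS}(q,t)\to\mathcal{B}(q,t)$ be the unique strict morphism of right $\mathcal{OS}(q,t)$-modules with $\mathbf{F}(\mathbf 1)=\mathsf{B}_0$ and $\mathbf{F}(\tau)=1_{\mathsf{B}_1}=\mathbf{F}(\bar\tau)$. Then $\mathbf{F}$ is a strict equivalence of $\mathcal{OS}(q,t)$-modules (i.e. it is a strict morphism of $\mathcal{OS}(q,t)$-modules that is also an equivalence of categories).
   Context: Let $k$ be a commutative ring and $q,t\in k^\times$ with $t-t^{-1}$ divisible by $z:=q-q^{-1}$; write $\delta=(t-t^{-1})/(q-q^{-1})$. $\mathbb{N}$ is the set of nonnegative integers. Composition is written right to left. **Oriented skein category.** $\mathcal{OS}(q,t)$ is the strict $k$-linear monoidal category generated by objects $\uparrow,\downarrow$ and morphisms $X_+,X_-\colon\uparrow\uparrow\to\uparrow\uparrow$, $c\colon\mathbf 1\to\downarrow\uparrow$, $d\colon\uparrow\downarrow\to\mathbf 1$, $c'\colon\mathbf 1\to\uparrow\downarrow$, $d'\colon\downarrow\uparrow\to\mathbf 1$ (tensor product of objects written as juxtaposition), subject to: $X_+X_-=1=X_-X_+$; $(X_+\otimes1_\uparrow)(1_\uparrow\otimes X_+)(X_+\otimes1_\uparrow)=(1_\uparrow\otimes X_+)(X_+\otimes1_\uparrow)(1_\uparrow\otimes X_+)$; $L_-R_+=1_{\uparrow\downarrow}$; $R_+L_-=1_{\downarrow\uparrow}$; $X_+-X_-=z\,1_{\uparrow\uparrow}$; $(d'\otimes1_\uparrow)(1_\downarrow\otimes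 X_+)(c\otimes1_\uparrow)=t1_\uparrow=(1_\uparrow\otimes d)(X_+\otimes1_\downarrow)(1_\uparrow\otimes c')$; $d\,c'=\delta1_{\mathbf 1}$; $(d\otimes1_\uparrow)(1_\uparrow\otimes c)=1_\uparrow$; $(1_\downarrow\otimes d)(c\otimes1_\downarrow)=1_\downarrow$. Here $R_\pm=(1_{\downarrow\uparrow}\otimes d)(1_\downarrow\otimes X_\pm\otimes1_\downarrow)(c\otimes1_{\uparrow\downarrow})\colon\uparrow\downarrow\to\downarrow\uparrow$, $L_\pm=(d'\otimes1_{\uparrow\downarrow})(1_\downarrow\otimes X_\pm\otimes1_\downarrow)(1_{\downarrow\uparrow}\otimes c')\colon\downarrow\uparrow\to\uparrow\downarrow$; also put $D_\pm=(1_{\downarrow\downarrow}\otimes d)(1_\downarrow\otimes R_\pm\otimes1_\downarrow)(c\otimes1_{\downarrow\downarrow})\colon\downarrow\downarrow\to\downarrow\downarrow$. **Module categories.** A strict right module category ($\mathcal{C}$-module) over a strict $k$-linear monoidal category $\mathcal{C}$ is a $k$-linear category $\mathcal{M}$ with a strict monoidal functor $\mathbf A\colon\mathcal{C}\to\mathcal{E}nd(\mathcal{M})^{\mathrm{rev}}$ ($k$-linear endofunctors under composition, with reversed tensor product); write $M\otimes C=\mathbf A(C)(M)$. A morphism of $\mathcal{C}$-modules $\mathcal{M}\to\mathcal{N}$ is a $k$-linear functor $\mathbf H$ with natural isomorphisms $\omega_{M,C}\colon\mathbf H(M\otimes C)\to\mathbf H(M)\otimes C$ such that $(\omega_{M,C}\otimes1_D)\circ\omega_{M\otimes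 C,D}=\omega_{M,C\otimes D}$; it is strict if all $\omega_{M,C}$ are identities. An equivalence of $\mathcal{C}$-modules is a morphism of $\mathcal{C}$-modules that is an equivalence of categories. **Disoriented skein category.** $\mathcal{DS}(q,t)$ is the strict right $\mathcal{OS}(q,t)$-module generated by morphisms (toggles) $\tau\colon\downarrow\to\uparrow$, $\bar\tau\colon\uparrow\to\downarrow$. That is: its objects are the objects of $\mathcal{OS}(q,t)$ (words in $\uparrow,\downarrow$); its morphisms are generated, as a $k$-linear category, by the morphisms of $\mathcal{OS}(q,t)$ and morphisms $f\otimes g$ with $f\in\{\tau,\bar\tau\}$, $g$ a morphism of $\mathcal{OS}(q,t)$, subject to linearity in $g$, to $(1_Y\otimes g)\circ(f\otimes h)=f\otimes(g\circ h)=(f\otimes g)\circ(1_X\otimes h)$ for $f\colon X\to Y$, and to the following relations and everything obtained from them by composition and the right $\mathcal{OS}(q,t)$-action: $\tau\bar\tau=1_\uparrow$; $\bar\tau\tau=1_\downarrow$; $(\tau\otimes1_\uparrow)R_-(\tau\otimes1_\downarrow)D_+=X_+(\tau\otimes1_\uparrow)R_-(\tau\otimes1_\downarrow)$; $d'(\bar\tau\otimes1_\uparrow)X_+=q\,d'(\bar\tau\otimes1_\uparrow)$; $X_+(\tau\otimes1_\uparrow)c=q\,(\tau\otimes1_\uparrow)c$. **iquantum Brauer category.** $\mathcal{B}(q,t)$ is the $k$-linear category with objects $\mathsf{B}_r$, $r\in\mathbb{N}$, generating morphisms $\mathrm{cup}_r\colon\mathsf{B}_r\to\mathsf{B}_{r+2}$,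 $\mathrm{cap}_r\colon\mathsf{B}_{r+2}\to\mathsf{B}_r$ ($r\in\mathbb{N}$) and $\sigma_i,\sigma_i^{-1}\colon\mathsf{B}_n\to\mathsf{B}_n$ for $1\le i\le n-1$ ($n$ suppressed), with relations, whenever both sides make sense: $\sigma_i\sigma_i^{-1}=1=\sigma_i^{-1}\sigma_i$; $\sigma_i\sigma_{i+1}\sigma_i=\sigma_{i+1}\sigma_i\sigma_{i+1}$; $\sigma_i\sigma_j=\sigma_j\sigma_i$ for $|i-j|>1$; $\sigma_i-\sigma_i^{-1}=z$; $\mathrm{cup}_n\sigma_i=\sigma_{i+2}\mathrm{cup}_n$; $\mathrm{cap}_n\sigma_{i+2}=\sigma_i\mathrm{cap}_n$; $\mathrm{cap}_n\mathrm{cup}_n=\delta1_{\mathsf{B}_n}$; $\mathrm{cap}_n\sigma_1=q\,\mathrm{cap}_n$; $\sigma_1\mathrm{cup}_n=q\,\mathrm{cup}_n$; $\mathrm{cap}_n\sigma_2\mathrm{cup}_n=t1_{\mathsf{B}_n}$ ($n\ge1$); $\mathrm{cap}_n\sigma_2\sigma_3\sigma_1^{-1}\sigma_2^{-1}\mathrm{cup}_n=\mathrm{cup}_{n-2}\mathrm{cap}_{n-2}$ ($n\ge2$); $\mathrm{cap}_n\mathrm{cap}_{n+2}\sigma_2^{-1}\sigma_3^{-1}\sigma_1\sigma_2=\mathrm{cap}_n\mathrm{cap}_{n+2}$; $\sigma_2^{-1}\sigma_1^{-1}\sigma_3\sigma_2\mathrm{cup}_{n+2}\mathrm{cup}_n=\mathrm{cup}_{n+2}\mathrm{cup}_n$.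 **Action of $\mathcal{OS}(q,t)$ on $\mathcal{B}(q,t)$.** For $k\in\mathbb{N}$ let $\mathbf{A}_k$ be the endofunctor of $\mathcal{B}(q,t)$ with $\mathsf{B}_r\mapsto\mathsf{B}_{r+k}$, $\mathrm{cup}_r\mapsto\mathrm{cup}_{r+k}$, $\mathrm{cap}_r\mapsto\mathrm{cap}_{r+k}$, $\sigma_i^{\pm1}\mapsto\sigma_i^{\pm1}$. $\mathcal{B}(q,t)$ is a strict right $\mathcal{OS}(q,t)$-module via the strict monoidal functor $\mathbf{A}$ with $\uparrow,\downarrow\mapsto\mathbf{A}_1$ and with components at $\mathsf{B}_r$: $X_\pm\mapsto\sigma_{r+1}^{\pm1}$; $c\mapsto(\sigma_r^{-1}\cdots\sigma_1^{-1})(\sigma_{r+1}\cdots\sigma_2)\mathrm{cup}_r$; $c'\mapsto q^{-1}t(\sigma_r\cdots\sigma_1)(\sigma_{r+1}^{-1}\cdots\sigma_2^{-1})\mathrm{cup}_r$; $d'\mapsto\mathrm{cap}_r(\sigma_2^{-1}\cdots\sigma_{r+1}^{-1})(\sigma_1\cdots\sigma_r)$; $d\mapsto qt^{-1}\mathrm{cap}_r(\sigma_2\cdots\sigma_{r+1})(\sigma_1^{-1}\cdots\sigma_r^{-1})$. *)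

theory Defs
  imports Main
begin

(* The sort {comm_ring, comm_monoid_mult} is that of commutative unital rings without the
   axiom 0 \<noteq> 1 of comm_ring_1: the zero ring is allowed. *)

definition uinv :: "'k::{comm_ring,comm_monoid_mult} \<Rightarrow> 'k"  \<comment> \<open>meant for units only\<close>
  where "uinv x = (THE y. x * y = 1)"


section \<open>Linear categories, strict monoidal categories and their strict right modules\<close>

text \<open>The objects of a category are all elements of its object type.  Composition is written right
  to left: \<open>Cmp C g f\<close> is g after f.\<close>

record ('o, 'm, 'k) lincat =
  Hom :: "'o \<Rightarrow> 'o \<Rightarrow> 'm set"
  Idn :: "'o \<Rightarrow> 'm"
  Cmp :: "'m \<Rightarrow> 'm \<Rightarrow> 'm"
  Zer :: "'o \<Rightarrow> 'o \<Rightarrow> 'm"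
  Pls :: "'m \<Rightarrow> 'm \<Rightarrow> 'm"
  Scl :: "'k \<Rightarrow> 'm \<Rightarrow> 'm"

text \<open>The equations of a k-linear category, as a relation: they hold as equalities in a linear
  category, and they are imposed as relations on formal terms in the presentations below.\<close>

inductive lin_ax ::
  "('o, 'm, 'k::{comm_ring,comm_monoid_mult}, 'z) lincat_scheme \<Rightarrow> 'm \<Rightarrow> 'm \<Rightarrow> bool" for C where
  id_left: "f \<in> Hom C X Y \<Longrightarrow> lin_ax C (Cmp C (Idn C Y) f) f"
| id_right: "f \<in> Hom C X Y \<Longrightarrow> lin_ax C (Cmp C f (Idn C X)) f"
| cmp_assoc: "h \<in> Hom C W X \<Longrightarrow> g \<in> Hom C X Y \<Longrightarrow> f \<in> Hom C Y Z \<Longrightarrow>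
    lin_ax C (Cmp C (Cmp C f g) h) (Cmp C f (Cmp C g h))"
| pls_assoc: "f \<in> Hom C X Y \<Longrightarrow> g \<in> Hom C X Y \<Longrightarrow> h \<in> Hom C X Y \<Longrightarrow>
    lin_ax C (Pls C (Pls C f g) h) (Pls C f (Pls C g h))"
| pls_commute: "f \<in> Hom C X Y \<Longrightarrow> g \<in> Hom C X Y \<Longrightarrow> lin_ax C (Pls C f g) (Pls C g f)"
| pls_zero: "f \<in> Hom C X Y \<Longrightarrow> lin_ax C (Pls C f (Zer C X Y)) f"
| pls_neg: "f \<in> Hom C X Y \<Longrightarrow> lin_ax C (Pls C f (Scl C (- 1) f)) (Zer C X Y)"
| scl_pls: "f \<in> Hom C X Y \<Longrightarrow> g \<in> Hom C X Y \<Longrightarrow>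
    lin_ax C (Scl C a (Pls C f g)) (Pls C (Scl C a f) (Scl C a g))"
| add_scl: "f \<in> Hom C X Y \<Longrightarrow> lin_ax C (Scl C (a + b) f) (Pls C (Scl C a f) (Scl C b f))"
| mult_scl: "f \<in> Hom C X Y \<Longrightarrow> lin_ax C (Scl C (a * b) f) (Scl C a (Scl C b f))"
| one_scl: "f \<in> Hom C X Y \<Longrightarrow> lin_ax C (Scl C 1 f) f"
| pls_cmp: "f \<in> Hom C Y Z \<Longrightarrow> f' \<in> Hom C Y Z \<Longrightarrow> g \<in> Hom C X Y \<Longrightarrow>
    lin_ax C (Cmp C (Pls C f f') g) (Pls C (Cmp C f g) (Cmp C f' g))"
| cmp_pls: "f \<in> Hom C Y Z \<Longrightarrow> g \<in> Hom C X Y \<Longrightarrow> g' \<in> Hom C X Y \<Longrightarrow>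
    lin_ax C (Cmp C f (Pls C g g')) (Pls C (Cmp C f g) (Cmp C f g'))"
| scl_cmp: "f \<in> Hom C Y Z \<Longrightarrow> g \<in> Hom C X Y \<Longrightarrow>
    lin_ax C (Cmp C (Scl C a f) g) (Scl C a (Cmp C f g))"
| cmp_scl: "f \<in> Hom C Y Z \<Longrightarrow> g \<in> Hom C X Y \<Longrightarrow>
    lin_ax C (Cmp C f (Scl C a g)) (Scl C a (Cmp C f g))"

locale linear_category =
  fixes C :: "('o, 'm, 'k::{comm_ring,comm_monoid_mult}, 'z) lincat_scheme"
  assumes Idn_hom: "Idn C X \<in> Hom C X X"
    and Cmp_hom: "g \<in> Hom C Y Z \<Longrightarrow> f \<in> Hom C X Y \<Longrightarrow> Cmp C g f \<in> Hom C X Z"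
    and Zer_hom: "Zer C X Y \<in> Hom C X Y"
    and Pls_hom: "f \<in> Hom C X Y \<Longrightarrow> g \<in> Hom C X Y \<Longrightarrow> Pls C f g \<in> Hom C X Y"
    and Scl_hom: "f \<in> Hom C X Y \<Longrightarrow> Scl C a f \<in> Hom C X Y"
    and linear_axioms: "lin_ax C f g \<Longrightarrow> f = g"

record ('o, 'm, 'k) moncat = "('o, 'm, 'k) lincat" +
  One :: 'o
  TenO :: "'o \<Rightarrow> 'o \<Rightarrow> 'o"
  Ten :: "'m \<Rightarrow> 'm \<Rightarrow> 'm"

text \<open>The equations between morphisms of a strict k-linear monoidal category, beyond those of a
  k-linear category.\<close>

inductive mon_ax ::
  "('o, 'm, 'k::{comm_ring,comm_monoid_mult}, 'z) moncat_scheme \<Rightarrow> 'm \<Rightarrow> 'm \<Rightarrow> bool" for C where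
  ten_id: "mon_ax C (Ten C (Idn C X) (Idn C Y)) (Idn C (TenO C X Y))"
| ten_cmp: "f \<in> Hom C X Y \<Longrightarrow> f' \<in> Hom C Y Z \<Longrightarrow> g \<in> Hom C X' Y' \<Longrightarrow> g' \<in> Hom C Y' Z' \<Longrightarrow>
    mon_ax C (Ten C (Cmp C f' f) (Cmp C g' g)) (Cmp C (Ten C f' g') (Ten C f g))"
| ten_assoc: "f \<in> Hom C X Y \<Longrightarrow> g \<in> Hom C X' Y' \<Longrightarrow> h \<in> Hom C X'' Y'' \<Longrightarrow>
    mon_ax C (Ten C (Ten C f g) h) (Ten C f (Ten C g h))"
| ten_unit_left: "f \<in> Hom C X Y \<Longrightarrow> mon_ax C (Ten C (Idn C (One C)) f) f"
| ten_unit_right: "f \<in> Hom C X Y \<Longrightarrow> mon_ax C (Ten C f (Idn C (One C))) f"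
| pls_ten: "f \<in> Hom C X Y \<Longrightarrow> f' \<in> Hom C X Y \<Longrightarrow> g \<in> Hom C X' Y' \<Longrightarrow>
    mon_ax C (Ten C (Pls C f f') g) (Pls C (Ten C f g) (Ten C f' g))"
| ten_pls: "f \<in> Hom C X Y \<Longrightarrow> g \<in> Hom C X' Y' \<Longrightarrow> g' \<in> Hom C X' Y' \<Longrightarrow>
    mon_ax C (Ten C f (Pls C g g')) (Pls C (Ten C f g) (Ten C f g'))"
| scl_ten: "f \<in> Hom C X Y \<Longrightarrow> g \<in> Hom C X' Y' \<Longrightarrow>
    mon_ax C (Ten C (Scl C a f) g) (Scl C a (Ten C f g))"
| ten_scl: "f \<in> Hom C X Y \<Longrightarrow> g \<in> Hom C X' Y' \<Longrightarrow>
    mon_ax C (Ten C f (Scl C a g)) (Scl C a (Ten C f g))"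

locale strict_monoidal = linear_category C
  for C :: "('o, 'm, 'k::{comm_ring,comm_monoid_mult}, 'z) moncat_scheme" +
  assumes TenO_assoc: "TenO C (TenO C X Y) Z = TenO C X (TenO C Y Z)"
    and TenO_unit_left: "TenO C (One C) X = X"
    and TenO_unit_right: "TenO C X (One C) = X"
    and Ten_hom: "f \<in> Hom C X Y \<Longrightarrow> g \<in> Hom C X' Y' \<Longrightarrow> Ten C f g \<in> Hom C (TenO C X X') (TenO C Y Y')"
    and monoidal_axioms: "mon_ax C f g \<Longrightarrow> f = g"

text \<open>A strict right module over C is a k-linear category M with a strict monoidal functor A from C
  to the reverse of End(M).  Its data: \<open>ActO M A X\<close> and \<open>ActF M m X\<close> are the values of the
  endofunctor A(X) on the object A and on the morphism m (that is, \<open>A \<otimes> X\<close> and \<open>m \<otimes> 1\<^sub>X\<close>), and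
  \<open>ActN M A g\<close> is the component at A of the natural transformation A(g) (that is, \<open>1\<^sub>A \<otimes> g\<close>).\<close>

record ('o, 'm, 'k, 'c, 'd) modcat = "('o, 'm, 'k) lincat" +
  ActO :: "'o \<Rightarrow> 'c \<Rightarrow> 'o"
  ActF :: "'m \<Rightarrow> 'c \<Rightarrow> 'm"
  ActN :: "'o \<Rightarrow> 'd \<Rightarrow> 'm"

locale right_module = C: strict_monoidal C + M: linear_category M
  for C :: "('c, 'd, 'k::{comm_ring,comm_monoid_mult}, 'y) moncat_scheme"
    and M :: "('o, 'm, 'k, 'c, 'd, 'z) modcat_scheme" +
  assumes \<comment> \<open>every A(X) is a k-linear endofunctor of M\<close>
        ActF_hom: "m \<in> Hom M A B \<Longrightarrow> ActF M m X \<in> Hom M (ActO M A X) (ActO M B X)"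
    and ActF_id: "ActF M (Idn M A) X = Idn M (ActO M A X)"
    and ActF_cmp: "m \<in> Hom M A B \<Longrightarrow> n \<in> Hom M B D \<Longrightarrow>
          ActF M (Cmp M n m) X = Cmp M (ActF M n X) (ActF M m X)"
    and ActF_pls: "m \<in> Hom M A B \<Longrightarrow> n \<in> Hom M A B \<Longrightarrow>
          ActF M (Pls M m n) X = Pls M (ActF M m X) (ActF M n X)"
    and ActF_scl: "m \<in> Hom M A B \<Longrightarrow> ActF M (Scl M a m) X = Scl M a (ActF M m X)"
    \<comment> \<open>every A(g), for \<open>g : X \<rightarrow> Y\<close>, is a natural transformation from A(X) to A(Y)\<close>
    and ActN_hom: "g \<in> Hom C X Y \<Longrightarrow> ActN M A g \<in> Hom M (ActO M A X) (ActO M A Y)"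
    and ActN_natural: "m \<in> Hom M A B \<Longrightarrow> g \<in> Hom C X Y \<Longrightarrow>
          Cmp M (ActN M B g) (ActF M m X) = Cmp M (ActF M m Y) (ActN M A g)"
    \<comment> \<open>A is a k-linear functor from C to the category of endofunctors\<close>
    and ActN_id: "ActN M A (Idn C X) = Idn M (ActO M A X)"
    and ActN_cmp: "f \<in> Hom C X Y \<Longrightarrow> g \<in> Hom C Y Z \<Longrightarrow>
          ActN M A (Cmp C g f) = Cmp M (ActN M A g) (ActN M A f)"
    and ActN_pls: "f \<in> Hom C X Y \<Longrightarrow> g \<in> Hom C X Y \<Longrightarrow>
          ActN M A (Pls C f g) = Pls M (ActN M A f) (ActN M A g)"
    and ActN_scl: "f \<in> Hom C X Y \<Longrightarrow> ActN M A (Scl C a f) = Scl M a (ActN M A f)"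
    \<comment> \<open>A is strict monoidal for the reversed tensor product of endofunctors\<close>
    and ActO_unit: "ActO M A (One C) = A"
    and ActO_ten: "ActO M A (TenO C X Y) = ActO M (ActO M A X) Y"
    and ActF_unit: "m \<in> Hom M A B \<Longrightarrow> ActF M m (One C) = m"
    and ActF_ten: "m \<in> Hom M A B \<Longrightarrow> ActF M m (TenO C X Y) = ActF M (ActF M m X) Y"
    and ActN_ten: "g \<in> Hom C X X' \<Longrightarrow> h \<in> Hom C Y Y' \<Longrightarrow>
          ActN M A (Ten C g h) = Cmp M (ActN M (ActO M A X') h) (ActF M (ActN M A g) Y)"


section \<open>Functors, equivalences and morphisms of modules\<close>

locale cat_functor =
  fixes C :: "('o, 'm, 'k::{comm_ring,comm_monoid_mult}, 'z) lincat_scheme"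
    and D :: "('o', 'm', 'k, 'z') lincat_scheme"
    and FO :: "'o \<Rightarrow> 'o'" and FM :: "'m \<Rightarrow> 'm'"
  assumes functor_hom: "f \<in> Hom C X Y \<Longrightarrow> FM f \<in> Hom D (FO X) (FO Y)"
    and functor_id: "FM (Idn C X) = Idn D (FO X)"
    and functor_cmp: "f \<in> Hom C X Y \<Longrightarrow> g \<in> Hom C Y Z \<Longrightarrow> FM (Cmp C g f) = Cmp D (FM g) (FM f)"

locale linear_functor = cat_functor +
  assumes functor_pls: "f \<in> Hom C X Y \<Longrightarrow> g \<in> Hom C X Y \<Longrightarrow> FM (Pls C f g) = Pls D (FM f) (FM g)"
    and functor_scl: "f \<in> Hom C X Y \<Longrightarrow> FM (Scl C a f) = Scl D a (FM f)"

definition is_iso ::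
  "('o, 'm, 'k::{comm_ring,comm_monoid_mult}, 'z) lincat_scheme \<Rightarrow> 'o \<Rightarrow> 'o \<Rightarrow> 'm \<Rightarrow> bool"
  where "is_iso C X Y f \<longleftrightarrow> f \<in> Hom C X Y \<and>
    (\<exists>g \<in> Hom C Y X. Cmp C g f = Idn C X \<and> Cmp C f g = Idn C Y)"

definition natural_iso ::
  "('o, 'm, 'k::{comm_ring,comm_monoid_mult}, 'z) lincat_scheme \<Rightarrow> ('o', 'm', 'k, 'z') lincat_scheme \<Rightarrow>
   ('o \<Rightarrow> 'o') \<Rightarrow> ('m \<Rightarrow> 'm') \<Rightarrow> ('o \<Rightarrow> 'o') \<Rightarrow> ('m \<Rightarrow> 'm') \<Rightarrow> ('o \<Rightarrow> 'm') \<Rightarrow> bool"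
  where "natural_iso C D FO FM GO GM \<eta> \<longleftrightarrow>
    (\<forall>X. is_iso D (FO X) (GO X) (\<eta> X)) \<and>
    (\<forall>X Y. \<forall>f \<in> Hom C X Y. Cmp D (\<eta> Y) (FM f) = Cmp D (GM f) (\<eta> X))"

definition equivalence_of_categories ::
  "('o, 'm, 'k::{comm_ring,comm_monoid_mult}, 'z) lincat_scheme \<Rightarrow> ('o', 'm', 'k, 'z') lincat_scheme \<Rightarrow>
   ('o \<Rightarrow> 'o') \<Rightarrow> ('m \<Rightarrow> 'm') \<Rightarrow> bool"
  where "equivalence_of_categories C D FO FM \<longleftrightarrow> cat_functor C D FO FM \<and>
    (\<exists>GO GM \<eta> \<epsilon>. cat_functor D C GO GM \<and>
      natural_iso C C id id (GO \<circ> FO) (GM \<circ> FM) \<eta> \<and>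
      natural_iso D D (FO \<circ> GO) (FM \<circ> GM) id id \<epsilon>)"

text \<open>\<open>\<omega> A X\<close> is the structure isomorphism from \<open>F(A \<otimes> X)\<close> to \<open>F(A) \<otimes> X\<close>.\<close>

locale module_morphism = M: right_module C M + N: right_module C N + F: linear_functor M N FO FM
  for C :: "('c, 'd, 'k::{comm_ring,comm_monoid_mult}, 'y) moncat_scheme"
    and M :: "('o, 'm, 'k, 'c, 'd, 'z) modcat_scheme"
    and N :: "('o', 'm', 'k, 'c, 'd, 'z') modcat_scheme"
    and FO FM and \<omega> :: "'o \<Rightarrow> 'c \<Rightarrow> 'm'" +
  assumes omega_iso: "is_iso N (FO (ActO M A X)) (ActO N (FO A) X) (\<omega> A X)"
    and omega_natural_left: "m \<in> Hom M A B \<Longrightarrow>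
          Cmp N (\<omega> B X) (FM (ActF M m X)) = Cmp N (ActF N (FM m) X) (\<omega> A X)"
    and omega_natural_right: "g \<in> Hom C X Y \<Longrightarrow>
          Cmp N (\<omega> A Y) (FM (ActN M A g)) = Cmp N (ActN N (FO A) g) (\<omega> A X)"
    and omega_coherent:
      "Cmp N (ActF N (\<omega> A X) Y) (\<omega> (ActO M A X) Y) = \<omega> A (TenO C X Y)"

definition strict_module_morphism ::
  "('c, 'd, 'k::{comm_ring,comm_monoid_mult}, 'y) moncat_scheme \<Rightarrow>
   ('o, 'm, 'k, 'c, 'd, 'z) modcat_scheme \<Rightarrow> ('o', 'm', 'k, 'c, 'd, 'z') modcat_scheme \<Rightarrow>
   ('o \<Rightarrow> 'o') \<Rightarrow> ('m \<Rightarrow> 'm') \<Rightarrow> bool"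
  where "strict_module_morphism C M N FO FM \<longleftrightarrow>
    (\<forall>A X. FO (ActO M A X) = ActO N (FO A) X) \<and>
    module_morphism C M N FO FM (\<lambda>A X. Idn N (ActO N (FO A) X))"

definition strict_module_equivalence ::
  "('c, 'd, 'k::{comm_ring,comm_monoid_mult}, 'y) moncat_scheme \<Rightarrow>
   ('o, 'm, 'k, 'c, 'd, 'z) modcat_scheme \<Rightarrow> ('o', 'm', 'k, 'c, 'd, 'z') modcat_scheme \<Rightarrow>
   ('o \<Rightarrow> 'o') \<Rightarrow> ('m \<Rightarrow> 'm') \<Rightarrow> bool"
  where "strict_module_equivalence C M N FO FM \<longleftrightarrow>
    strict_module_morphism C M N FO FM \<and> equivalence_of_categories M N FO FM"


section \<open>Quotients of term structures\<close>

text \<open>The presented categories below are quotients of structures of formal terms by the least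
  congruence that contains the defining relations.  \<open>lift1\<close> and \<open>lift2\<close> pass an operation on terms to
  congruence classes: if the operation respects the congruences, the union has a single member.\<close>

definition cls :: "('a \<Rightarrow> 'a \<Rightarrow> bool) \<Rightarrow> 'a \<Rightarrow> 'a set"
  where "cls E f = {g. E f g}"

definition lift1 :: "('b \<Rightarrow> 'b \<Rightarrow> bool) \<Rightarrow> ('a \<Rightarrow> 'b) \<Rightarrow> 'a set \<Rightarrow> 'b set"
  where "lift1 E h F = (\<Union>f\<in>F. cls E (h f))"

definition lift2 :: "('c \<Rightarrow> 'c \<Rightarrow> bool) \<Rightarrow> ('a \<Rightarrow> 'b \<Rightarrow> 'c) \<Rightarrow> 'a set \<Rightarrow> 'b set \<Rightarrow> 'c set"
  where "lift2 E h F G = (\<Union>f\<in>F. \<Union>g\<in>G. cls E (h f g))"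

definition quotient_lincat ::
  "('o, 'm, 'k::{comm_ring,comm_monoid_mult}, 'z) lincat_scheme \<Rightarrow> ('m \<Rightarrow> 'm \<Rightarrow> bool) \<Rightarrow> ('o, 'm set, 'k) lincat"
  where "quotient_lincat C E =
    \<lparr>Hom = \<lambda>X Y. cls E ` Hom C X Y,
     Idn = \<lambda>X. cls E (Idn C X),
     Cmp = lift2 E (Cmp C),
     Zer = \<lambda>X Y. cls E (Zer C X Y),
     Pls = lift2 E (Pls C),
     Scl = \<lambda>a. lift1 E (Scl C a)\<rparr>"


section \<open>The oriented skein category\<close>

datatype ori = Up | Dn

text \<open>Terms: \<open>OXp\<close>, \<open>OXm\<close> are the crossings, \<open>Oc\<close>, \<open>Od\<close>, \<open>Oc'\<close>, \<open>Od'\<close> the cups and caps.\<close>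

datatype 'k os =
    OId "ori list"
  | OXp | OXm | Oc | Od | Oc' | Od'
  | OCmp "'k os" "'k os"  (infixr "\<cdot>\<^sub>O" 70)
  | OTen "'k os" "'k os"  (infixr "\<otimes>\<^sub>O" 75)
  | OZer "ori list" "ori list"
  | OPls "'k os" "'k os"
  | OScl 'k "'k os"

primrec os_dom :: "'k os \<Rightarrow> ori list" where
  "os_dom (OId X) = X"
| "os_dom OXp = [Up, Up]"
| "os_dom OXm = [Up, Up]"
| "os_dom Oc = []"
| "os_dom Od = [Up, Dn]"
| "os_dom Oc' = []"
| "os_dom Od' = [Dn, Up]"
| "os_dom (f \<cdot>\<^sub>O g) = os_dom g"
| "os_dom (f \<otimes>\<^sub>O g) = os_dom f @ os_dom g"
| "os_dom (OZer X Y) = X"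
| "os_dom (OPls f g) = os_dom f"
| "os_dom (OScl a f) = os_dom f"

primrec os_cod :: "'k os \<Rightarrow> ori list" where
  "os_cod (OId X) = X"
| "os_cod OXp = [Up, Up]"
| "os_cod OXm = [Up, Up]"
| "os_cod Oc = [Dn, Up]"
| "os_cod Od = []"
| "os_cod Oc' = [Up, Dn]"
| "os_cod Od' = []"
| "os_cod (f \<cdot>\<^sub>O g) = os_cod f"
| "os_cod (f \<otimes>\<^sub>O g) = os_cod f @ os_cod g"
| "os_cod (OZer X Y) = Y"
| "os_cod (OPls f g) = os_cod f"
| "os_cod (OScl a f) = os_cod f"

primrec os_wf :: "'k os \<Rightarrow> bool" where
  "os_wf (OId X) = True"
| "os_wf OXp = True"
| "os_wf OXm = True"
| "os_wf Oc = True"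
| "os_wf Od = True"
| "os_wf Oc' = True"
| "os_wf Od' = True"
| "os_wf (f \<cdot>\<^sub>O g) = (os_wf f \<and> os_wf g \<and> os_dom f = os_cod g)"
| "os_wf (f \<otimes>\<^sub>O g) = (os_wf f \<and> os_wf g)"
| "os_wf (OZer X Y) = True"
| "os_wf (OPls f g) = (os_wf f \<and> os_wf g \<and> os_dom f = os_dom g \<and> os_cod f = os_cod g)"
| "os_wf (OScl a f) = os_wf f"

definition OS_terms :: "(ori list, 'k os, 'k::{comm_ring,comm_monoid_mult}) moncat"
  where "OS_terms =
    \<lparr>Hom = \<lambda>X Y. {f. os_wf f \<and> os_dom f = X \<and> os_cod f = Y},
     Idn = OId, Cmp = OCmp, Zer = OZer, Pls = OPls, Scl = OScl,
     One = [], TenO = (@), Ten = OTen\<rparr>"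

text \<open>\<open>R_of X\<close> and \<open>L_of X\<close> are \<open>R\<^sub>\<plusminus>\<close> and \<open>L\<^sub>\<plusminus>\<close> for X the crossing \<open>X\<^sub>\<plusminus>\<close>; similarly for \<open>D_of\<close>.\<close>

definition R_of :: "'k os \<Rightarrow> 'k os"
  where "R_of X = (OId [Dn, Up] \<otimes>\<^sub>O Od) \<cdot>\<^sub>O (OId [Dn] \<otimes>\<^sub>O X \<otimes>\<^sub>O OId [Dn]) \<cdot>\<^sub>O (Oc \<otimes>\<^sub>O OId [Up, Dn])"

definition L_of :: "'k os \<Rightarrow> 'k os"
  where "L_of X = (Od' \<otimes>\<^sub>O OId [Up, Dn]) \<cdot>\<^sub>O (OId [Dn] \<otimes>\<^sub>O X \<otimes>\<^sub>O OId [Dn]) \<cdot>\<^sub>O (OId [Dn, Up] \<otimes>\<^sub>O Oc')"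

definition D_of :: "'k os \<Rightarrow> 'k os"
  where "D_of X = (OId [Dn, Dn] \<otimes>\<^sub>O Od) \<cdot>\<^sub>O (OId [Dn] \<otimes>\<^sub>O R_of X \<otimes>\<^sub>O OId [Dn]) \<cdot>\<^sub>O (Oc \<otimes>\<^sub>O OId [Dn, Dn])"

inductive os_rel :: "'k::{comm_ring,comm_monoid_mult} \<Rightarrow> 'k \<Rightarrow> 'k \<Rightarrow> 'k os \<Rightarrow> 'k os \<Rightarrow> bool"
  for q t \<delta> where
  "os_rel q t \<delta> (OXp \<cdot>\<^sub>O OXm) (OId [Up, Up])"
| "os_rel q t \<delta> (OXm \<cdot>\<^sub>O OXp) (OId [Up, Up])"
| "os_rel q t \<delta>
    ((OXp \<otimes>\<^sub>O OId [Up]) \<cdot>\<^sub>O (OId [Up] \<otimes>\<^sub>O OXp) \<cdot>\<^sub>O (OXp \<otimes>\<^sub>O OId [Up]))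
    ((OId [Up] \<otimes>\<^sub>O OXp) \<cdot>\<^sub>O (OXp \<otimes>\<^sub>O OId [Up]) \<cdot>\<^sub>O (OId [Up] \<otimes>\<^sub>O OXp))"
| "os_rel q t \<delta> (L_of OXm \<cdot>\<^sub>O R_of OXp) (OId [Up, Dn])"
| "os_rel q t \<delta> (R_of OXp \<cdot>\<^sub>O L_of OXm) (OId [Dn, Up])"
| "os_rel q t \<delta> (OPls OXp (OScl (- 1) OXm)) (OScl (q - uinv q) (OId [Up, Up]))"
| "os_rel q t \<delta>
    ((Od' \<otimes>\<^sub>O OId [Up]) \<cdot>\<^sub>O (OId [Dn] \<otimes>\<^sub>O OXp) \<cdot>\<^sub>O (Oc \<otimes>\<^sub>O OId [Up])) (OScl t (OId [Up]))"
| "os_rel q t \<delta>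
    ((OId [Up] \<otimes>\<^sub>O Od) \<cdot>\<^sub>O (OXp \<otimes>\<^sub>O OId [Dn]) \<cdot>\<^sub>O (OId [Up] \<otimes>\<^sub>O Oc')) (OScl t (OId [Up]))"
| "os_rel q t \<delta> (Od \<cdot>\<^sub>O Oc') (OScl \<delta> (OId []))"
| "os_rel q t \<delta> ((Od \<otimes>\<^sub>O OId [Up]) \<cdot>\<^sub>O (OId [Up] \<otimes>\<^sub>O Oc)) (OId [Up])"
| "os_rel q t \<delta> ((OId [Dn] \<otimes>\<^sub>O Od) \<cdot>\<^sub>O (Oc \<otimes>\<^sub>O OId [Dn])) (OId [Dn])"

inductive os_eq :: "'k::{comm_ring,comm_monoid_mult} \<Rightarrow> 'k \<Rightarrow> 'k \<Rightarrow> 'k os \<Rightarrow> 'k os \<Rightarrow> bool"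
  for q t \<delta> where
  os_refl: "f \<in> Hom OS_terms X Y \<Longrightarrow> os_eq q t \<delta> f f"
| os_sym: "os_eq q t \<delta> f g \<Longrightarrow> os_eq q t \<delta> g f"
| os_trans: "os_eq q t \<delta> f g \<Longrightarrow> os_eq q t \<delta> g h \<Longrightarrow> os_eq q t \<delta> f h"
| os_cmp: "os_eq q t \<delta> f f' \<Longrightarrow> os_eq q t \<delta> g g' \<Longrightarrow> os_dom f = os_cod g \<Longrightarrow>
    os_eq q t \<delta> (f \<cdot>\<^sub>O g) (f' \<cdot>\<^sub>O g')"
| os_pls: "os_eq q t \<delta> f f' \<Longrightarrow> os_eq q t \<delta> g g' \<Longrightarrow> os_dom f = os_dom g \<Longrightarrow> os_cod f = os_cod g \<Longrightarrow>
    os_eq q t \<delta> (OPls f g) (OPls f' g')"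
| os_scl: "os_eq q t \<delta> f f' \<Longrightarrow> os_eq q t \<delta> (OScl a f) (OScl a f')"
| os_ten: "os_eq q t \<delta> f f' \<Longrightarrow> os_eq q t \<delta> g g' \<Longrightarrow> os_eq q t \<delta> (f \<otimes>\<^sub>O g) (f' \<otimes>\<^sub>O g')"
| os_lin: "lin_ax OS_terms f g \<Longrightarrow> os_eq q t \<delta> f g"
| os_mon: "mon_ax OS_terms f g \<Longrightarrow> os_eq q t \<delta> f g"
| os_rel: "os_rel q t \<delta> f g \<Longrightarrow> os_eq q t \<delta> f g"

definition OS ::
  "'k::{comm_ring,comm_monoid_mult} \<Rightarrow> 'k \<Rightarrow> 'k \<Rightarrow> (ori list, 'k os set, 'k) moncat"
  where "OS q t \<delta> = lincat.extend (quotient_lincat OS_terms (os_eq q t \<delta>))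
    (moncat.fields [] (@) (lift2 (os_eq q t \<delta>) OTen))"


section \<open>The disoriented skein category\<close>

text \<open>\<open>DOs g\<close> is a morphism g of the oriented skein category viewed as a morphism of the module (that
  is, \<open>1 \<otimes> g\<close> for the identity 1 of the empty word), \<open>DTau\<close> and \<open>DTau'\<close> are the toggles, and
  \<open>DAct f g\<close> is \<open>f \<otimes> g\<close>.\<close>

datatype 'k ds =
    DOs "'k os"
  | DTau | DTau'
  | DAct "'k ds" "'k os"  (infixl "\<otimes>\<^sub>D" 75)
  | DCmp "'k ds" "'k ds"  (infixr "\<cdot>\<^sub>D" 70)
  | DZer "ori list" "ori list"
  | DPls "'k ds" "'k ds"
  | DScl 'k "'k ds"

primrec ds_dom :: "'k ds \<Rightarrow> ori list" where
  "ds_dom (DOs g) = os_dom g"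
| "ds_dom DTau = [Dn]"
| "ds_dom DTau' = [Up]"
| "ds_dom (f \<otimes>\<^sub>D g) = ds_dom f @ os_dom g"
| "ds_dom (f \<cdot>\<^sub>D g) = ds_dom g"
| "ds_dom (DZer X Y) = X"
| "ds_dom (DPls f g) = ds_dom f"
| "ds_dom (DScl a f) = ds_dom f"

primrec ds_cod :: "'k ds \<Rightarrow> ori list" where
  "ds_cod (DOs g) = os_cod g"
| "ds_cod DTau = [Up]"
| "ds_cod DTau' = [Dn]"
| "ds_cod (f \<otimes>\<^sub>D g) = ds_cod f @ os_cod g"
| "ds_cod (f \<cdot>\<^sub>D g) = ds_cod f"
| "ds_cod (DZer X Y) = Y"
| "ds_cod (DPls f g) = ds_cod f"
| "ds_cod (DScl a f) = ds_cod f"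

primrec ds_wf :: "'k ds \<Rightarrow> bool" where
  "ds_wf (DOs g) = os_wf g"
| "ds_wf DTau = True"
| "ds_wf DTau' = True"
| "ds_wf (f \<otimes>\<^sub>D g) = (ds_wf f \<and> os_wf g)"
| "ds_wf (f \<cdot>\<^sub>D g) = (ds_wf f \<and> ds_wf g \<and> ds_dom f = ds_cod g)"
| "ds_wf (DZer X Y) = True"
| "ds_wf (DPls f g) = (ds_wf f \<and> ds_wf g \<and> ds_dom f = ds_dom g \<and> ds_cod f = ds_cod g)"
| "ds_wf (DScl a f) = ds_wf f"

definition DS_terms :: "(ori list, 'k ds, 'k::{comm_ring,comm_monoid_mult}) lincat"
  where "DS_terms =
    \<lparr>Hom = \<lambda>X Y. {f. ds_wf f \<and> ds_dom f = X \<and> ds_cod f = Y},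
     Idn = \<lambda>X. DOs (OId X), Cmp = DCmp, Zer = DZer, Pls = DPls, Scl = DScl\<rparr>"

text \<open>The equations making the terms a strict right module, together with a linear functor \<open>DOs\<close> that is
  compatible with the action.\<close>

inductive act_ax :: "'k::{comm_ring,comm_monoid_mult} ds \<Rightarrow> 'k ds \<Rightarrow> bool" where
  DOs_cmp: "f \<in> Hom OS_terms X Y \<Longrightarrow> g \<in> Hom OS_terms Y Z \<Longrightarrow> act_ax (DOs (g \<cdot>\<^sub>O f)) (DOs g \<cdot>\<^sub>D DOs f)"
| DOs_pls: "f \<in> Hom OS_terms X Y \<Longrightarrow> g \<in> Hom OS_terms X Y \<Longrightarrow>
    act_ax (DOs (OPls f g)) (DPls (DOs f) (DOs g))"
| DOs_scl: "f \<in> Hom OS_terms X Y \<Longrightarrow> act_ax (DOs (OScl a f)) (DScl a (DOs f))"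
| DOs_act: "f \<in> Hom OS_terms X Y \<Longrightarrow> g \<in> Hom OS_terms X' Y' \<Longrightarrow> act_ax (DOs f \<otimes>\<^sub>D g) (DOs (f \<otimes>\<^sub>O g))"
| act_cmp: "f \<in> Hom DS_terms X Y \<Longrightarrow> f' \<in> Hom DS_terms Y Z \<Longrightarrow>
    g \<in> Hom OS_terms X' Y' \<Longrightarrow> g' \<in> Hom OS_terms Y' Z' \<Longrightarrow>
    act_ax ((f' \<cdot>\<^sub>D f) \<otimes>\<^sub>D (g' \<cdot>\<^sub>O g)) ((f' \<otimes>\<^sub>D g') \<cdot>\<^sub>D (f \<otimes>\<^sub>D g))"
| act_act: "f \<in> Hom DS_terms X Y \<Longrightarrow> g \<in> Hom OS_terms X' Y' \<Longrightarrow> h \<in> Hom OS_terms X'' Y'' \<Longrightarrow>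
    act_ax ((f \<otimes>\<^sub>D g) \<otimes>\<^sub>D h) (f \<otimes>\<^sub>D (g \<otimes>\<^sub>O h))"
| act_unit: "f \<in> Hom DS_terms X Y \<Longrightarrow> act_ax (f \<otimes>\<^sub>D OId []) f"
| pls_act: "f \<in> Hom DS_terms X Y \<Longrightarrow> f' \<in> Hom DS_terms X Y \<Longrightarrow> g \<in> Hom OS_terms X' Y' \<Longrightarrow>
    act_ax (DPls f f' \<otimes>\<^sub>D g) (DPls (f \<otimes>\<^sub>D g) (f' \<otimes>\<^sub>D g))"
| act_pls: "f \<in> Hom DS_terms X Y \<Longrightarrow> g \<in> Hom OS_terms X' Y' \<Longrightarrow> g' \<in> Hom OS_terms X' Y' \<Longrightarrow>
    act_ax (f \<otimes>\<^sub>D OPls g g') (DPls (f \<otimes>\<^sub>D g) (f \<otimes>\<^sub>D g'))"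
| scl_act: "f \<in> Hom DS_terms X Y \<Longrightarrow> g \<in> Hom OS_terms X' Y' \<Longrightarrow>
    act_ax (DScl a f \<otimes>\<^sub>D g) (DScl a (f \<otimes>\<^sub>D g))"
| act_scl: "f \<in> Hom DS_terms X Y \<Longrightarrow> g \<in> Hom OS_terms X' Y' \<Longrightarrow>
    act_ax (f \<otimes>\<^sub>D OScl a g) (DScl a (f \<otimes>\<^sub>D g))"

inductive ds_rel :: "'k::{comm_ring,comm_monoid_mult} \<Rightarrow> 'k ds \<Rightarrow> 'k ds \<Rightarrow> bool" for q where
  "ds_rel q (DTau \<cdot>\<^sub>D DTau') (DOs (OId [Up]))"
| "ds_rel q (DTau' \<cdot>\<^sub>D DTau) (DOs (OId [Dn]))"
| "ds_rel q
    ((DTau \<otimes>\<^sub>D OId [Up]) \<cdot>\<^sub>D DOs (R_of OXm) \<cdot>\<^sub>D (DTau \<otimes>\<^sub>D OId [Dn]) \<cdot>\<^sub>D DOs (D_of OXp))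
    (DOs OXp \<cdot>\<^sub>D (DTau \<otimes>\<^sub>D OId [Up]) \<cdot>\<^sub>D DOs (R_of OXm) \<cdot>\<^sub>D (DTau \<otimes>\<^sub>D OId [Dn]))"
| "ds_rel q
    (DOs Od' \<cdot>\<^sub>D (DTau' \<otimes>\<^sub>D OId [Up]) \<cdot>\<^sub>D DOs OXp)
    (DScl q (DOs Od' \<cdot>\<^sub>D (DTau' \<otimes>\<^sub>D OId [Up])))"
| "ds_rel q
    (DOs OXp \<cdot>\<^sub>D (DTau \<otimes>\<^sub>D OId [Up]) \<cdot>\<^sub>D DOs Oc)
    (DScl q ((DTau \<otimes>\<^sub>D OId [Up]) \<cdot>\<^sub>D DOs Oc))"

inductive ds_eq :: "'k::{comm_ring,comm_monoid_mult} \<Rightarrow> 'k \<Rightarrow> 'k \<Rightarrow> 'k ds \<Rightarrow> 'k ds \<Rightarrow> bool"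
  for q t \<delta> where
  ds_refl: "f \<in> Hom DS_terms X Y \<Longrightarrow> ds_eq q t \<delta> f f"
| ds_sym: "ds_eq q t \<delta> f g \<Longrightarrow> ds_eq q t \<delta> g f"
| ds_trans: "ds_eq q t \<delta> f g \<Longrightarrow> ds_eq q t \<delta> g h \<Longrightarrow> ds_eq q t \<delta> f h"
| ds_cmp: "ds_eq q t \<delta> f f' \<Longrightarrow> ds_eq q t \<delta> g g' \<Longrightarrow> ds_dom f = ds_cod g \<Longrightarrow>
    ds_eq q t \<delta> (f \<cdot>\<^sub>D g) (f' \<cdot>\<^sub>D g')"
| ds_pls: "ds_eq q t \<delta> f f' \<Longrightarrow> ds_eq q t \<delta> g g' \<Longrightarrow> ds_dom f = ds_dom g \<Longrightarrow> ds_cod f = ds_cod g \<Longrightarrow>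
    ds_eq q t \<delta> (DPls f g) (DPls f' g')"
| ds_scl: "ds_eq q t \<delta> f f' \<Longrightarrow> ds_eq q t \<delta> (DScl a f) (DScl a f')"
| ds_os: "os_eq q t \<delta> g g' \<Longrightarrow> ds_eq q t \<delta> (DOs g) (DOs g')"
| ds_act: "ds_eq q t \<delta> f f' \<Longrightarrow> os_eq q t \<delta> g g' \<Longrightarrow> ds_eq q t \<delta> (f \<otimes>\<^sub>D g) (f' \<otimes>\<^sub>D g')"
| ds_lin: "lin_ax DS_terms f g \<Longrightarrow> ds_eq q t \<delta> f g"
| ds_act_ax: "act_ax f g \<Longrightarrow> ds_eq q t \<delta> f g"
| ds_rel: "ds_rel q f g \<Longrightarrow> ds_eq q t \<delta> f g"

definition DS ::
  "'k::{comm_ring,comm_monoid_mult} \<Rightarrow> 'k \<Rightarrow> 'k \<Rightarrow> (ori list, 'k ds set, 'k, ori list, 'k os set) modcat"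
  where "DS q t \<delta> = lincat.extend (quotient_lincat DS_terms (ds_eq q t \<delta>))
    (modcat.fields (@)
      (\<lambda>F X. lift1 (ds_eq q t \<delta>) (\<lambda>f. f \<otimes>\<^sub>D OId X) F)
      (\<lambda>X. lift1 (ds_eq q t \<delta>) (\<lambda>g. DOs (OId X) \<otimes>\<^sub>D g)))"

definition toggle :: "'k::{comm_ring,comm_monoid_mult} \<Rightarrow> 'k \<Rightarrow> 'k \<Rightarrow> 'k ds set"
  where "toggle q t \<delta> = cls (ds_eq q t \<delta>) DTau"

definition toggle' :: "'k::{comm_ring,comm_monoid_mult} \<Rightarrow> 'k \<Rightarrow> 'k \<Rightarrow> 'k ds set"
  where "toggle' q t \<delta> = cls (ds_eq q t \<delta>) DTau'"


section \<open>The iquantum Brauer category\<close>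

text \<open>The object \<open>B\<^sub>n\<close> is represented by n.  \<open>BSig n i\<close> and \<open>BInv n i\<close> are \<open>\<sigma>\<^sub>i\<close> and its inverse as
  endomorphisms of \<open>B\<^sub>n\<close>; they are well-formed for \<open>1 \<le> i < n\<close>.\<close>

datatype 'k br =
    BId nat
  | BCup nat | BCap nat
  | BSig nat nat | BInv nat nat
  | BCmp "'k br" "'k br"  (infixr "\<cdot>\<^sub>B" 70)
  | BZer nat nat
  | BPls "'k br" "'k br"
  | BScl 'k "'k br"

primrec br_dom :: "'k br \<Rightarrow> nat" where
  "br_dom (BId n) = n"
| "br_dom (BCup n) = n"
| "br_dom (BCap n) = n + 2"
| "br_dom (BSig n i) = n"
| "br_dom (BInv n i) = n"
| "br_dom (f \<cdot>\<^sub>B g) = br_dom g"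
| "br_dom (BZer m n) = m"
| "br_dom (BPls f g) = br_dom f"
| "br_dom (BScl a f) = br_dom f"

primrec br_cod :: "'k br \<Rightarrow> nat" where
  "br_cod (BId n) = n"
| "br_cod (BCup n) = n + 2"
| "br_cod (BCap n) = n"
| "br_cod (BSig n i) = n"
| "br_cod (BInv n i) = n"
| "br_cod (f \<cdot>\<^sub>B g) = br_cod f"
| "br_cod (BZer m n) = n"
| "br_cod (BPls f g) = br_cod f"
| "br_cod (BScl a f) = br_cod f"

primrec br_wf :: "'k br \<Rightarrow> bool" where
  "br_wf (BId n) = True"
| "br_wf (BCup n) = True"
| "br_wf (BCap n) = True"
| "br_wf (BSig n i) = (1 \<le> i \<and> i < n)"
| "br_wf (BInv n i) = (1 \<le> i \<and> i < n)"
| "br_wf (f \<cdot>\<^sub>B g) = (br_wf f \<and> br_wf g \<and> br_dom f = br_cod g)"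
| "br_wf (BZer m n) = True"
| "br_wf (BPls f g) = (br_wf f \<and> br_wf g \<and> br_dom f = br_dom g \<and> br_cod f = br_cod g)"
| "br_wf (BScl a f) = br_wf f"

definition B_terms :: "(nat, 'k br, 'k::{comm_ring,comm_monoid_mult}) lincat"
  where "B_terms =
    \<lparr>Hom = \<lambda>m n. {f. br_wf f \<and> br_dom f = m \<and> br_cod f = n},
     Idn = BId, Cmp = BCmp, Zer = BZer, Pls = BPls, Scl = BScl\<rparr>"

text \<open>These relations are only imposed when both sides are well-formed; see \<open>br_eq\<close>.\<close>

inductive br_rel :: "'k::{comm_ring,comm_monoid_mult} \<Rightarrow> 'k \<Rightarrow> 'k \<Rightarrow> 'k br \<Rightarrow> 'k br \<Rightarrow> bool"
  for q t \<delta> where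
  "br_rel q t \<delta> (BSig n i \<cdot>\<^sub>B BInv n i) (BId n)"
| "br_rel q t \<delta> (BInv n i \<cdot>\<^sub>B BSig n i) (BId n)"
| "br_rel q t \<delta> (BSig n i \<cdot>\<^sub>B BSig n (i+1) \<cdot>\<^sub>B BSig n i) (BSig n (i+1) \<cdot>\<^sub>B BSig n i \<cdot>\<^sub>B BSig n (i+1))"
| "i + 1 < j \<or> j + 1 < i \<Longrightarrow> br_rel q t \<delta> (BSig n i \<cdot>\<^sub>B BSig n j) (BSig n j \<cdot>\<^sub>B BSig n i)"
| "br_rel q t \<delta> (BPls (BSig n i) (BScl (- 1) (BInv n i))) (BScl (q - uinv q) (BId n))"
| "br_rel q t \<delta> (BCup n \<cdot>\<^sub>B BSig n i) (BSig (n+2) (i+2) \<cdot>\<^sub>B BCup n)"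
| "br_rel q t \<delta> (BCap n \<cdot>\<^sub>B BSig (n+2) (i+2)) (BSig n i \<cdot>\<^sub>B BCap n)"
| "br_rel q t \<delta> (BCap n \<cdot>\<^sub>B BCup n) (BScl \<delta> (BId n))"
| "br_rel q t \<delta> (BCap n \<cdot>\<^sub>B BSig (n+2) 1) (BScl q (BCap n))"
| "br_rel q t \<delta> (BSig (n+2) 1 \<cdot>\<^sub>B BCup n) (BScl q (BCup n))"
| "n \<ge> 1 \<Longrightarrow> br_rel q t \<delta> (BCap n \<cdot>\<^sub>B BSig (n+2) 2 \<cdot>\<^sub>B BCup n) (BScl t (BId n))"
| "n \<ge> 2 \<Longrightarrow> br_rel q t \<delta>
    (BCap n \<cdot>\<^sub>B BSig (n+2) 2 \<cdot>\<^sub>B BSig (n+2) 3 \<cdot>\<^sub>B BInv (n+2) 1 \<cdot>\<^sub>B BInv (n+2) 2 \<cdot>\<^sub>B BCup n)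
    (BCup (n-2) \<cdot>\<^sub>B BCap (n-2))"
| "br_rel q t \<delta>
    (BCap n \<cdot>\<^sub>B BCap (n+2) \<cdot>\<^sub>B BInv (n+4) 2 \<cdot>\<^sub>B BInv (n+4) 3 \<cdot>\<^sub>B BSig (n+4) 1 \<cdot>\<^sub>B BSig (n+4) 2)
    (BCap n \<cdot>\<^sub>B BCap (n+2))"
| "br_rel q t \<delta>
    (BInv (n+4) 2 \<cdot>\<^sub>B BInv (n+4) 1 \<cdot>\<^sub>B BSig (n+4) 3 \<cdot>\<^sub>B BSig (n+4) 2 \<cdot>\<^sub>B BCup (n+2) \<cdot>\<^sub>B BCup n)
    (BCup (n+2) \<cdot>\<^sub>B BCup n)"

inductive br_eq :: "'k::{comm_ring,comm_monoid_mult} \<Rightarrow> 'k \<Rightarrow> 'k \<Rightarrow> 'k br \<Rightarrow> 'k br \<Rightarrow> bool"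
  for q t \<delta> where
  br_refl: "f \<in> Hom B_terms m n \<Longrightarrow> br_eq q t \<delta> f f"
| br_sym: "br_eq q t \<delta> f g \<Longrightarrow> br_eq q t \<delta> g f"
| br_trans: "br_eq q t \<delta> f g \<Longrightarrow> br_eq q t \<delta> g h \<Longrightarrow> br_eq q t \<delta> f h"
| br_cmp: "br_eq q t \<delta> f f' \<Longrightarrow> br_eq q t \<delta> g g' \<Longrightarrow> br_dom f = br_cod g \<Longrightarrow>
    br_eq q t \<delta> (f \<cdot>\<^sub>B g) (f' \<cdot>\<^sub>B g')"
| br_pls: "br_eq q t \<delta> f f' \<Longrightarrow> br_eq q t \<delta> g g' \<Longrightarrow> br_dom f = br_dom g \<Longrightarrow> br_cod f = br_cod g \<Longrightarrow>
    br_eq q t \<delta> (BPls f g) (BPls f' g')"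
| br_scl: "br_eq q t \<delta> f f' \<Longrightarrow> br_eq q t \<delta> (BScl a f) (BScl a f')"
| br_lin: "lin_ax B_terms f g \<Longrightarrow> br_eq q t \<delta> f g"
| br_rel: "br_rel q t \<delta> f g \<Longrightarrow> f \<in> Hom B_terms m n \<Longrightarrow> g \<in> Hom B_terms m n \<Longrightarrow> br_eq q t \<delta> f g"


section \<open>The action on the iquantum Brauer category\<close>

text \<open>The endofunctor \<open>A\<^sub>k\<close> on terms.\<close>

primrec br_shift :: "nat \<Rightarrow> 'k br \<Rightarrow> 'k br" where
  "br_shift k (BId n) = BId (n + k)"
| "br_shift k (BCup n) = BCup (n + k)"
| "br_shift k (BCap n) = BCap (n + k)"
| "br_shift k (BSig n i) = BSig (n + k) i"
| "br_shift k (BInv n i) = BInv (n + k) i"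
| "br_shift k (f \<cdot>\<^sub>B g) = br_shift k f \<cdot>\<^sub>B br_shift k g"
| "br_shift k (BZer m n) = BZer (m + k) (n + k)"
| "br_shift k (BPls f g) = BPls (br_shift k f) (br_shift k g)"
| "br_shift k (BScl a f) = BScl a (br_shift k f)"

text \<open>The products of \<open>\<sigma>\<^sub>i\<close> (\<open>sigs\<close>) and of their inverses (\<open>invs\<close>) on \<open>B\<^sub>n\<close>, in the order in which
  the list of indices is written.\<close>

definition sigs :: "nat \<Rightarrow> nat list \<Rightarrow> 'k br"
  where "sigs n is = foldr (\<lambda>i f. BSig n i \<cdot>\<^sub>B f) is (BId n)"

definition invs :: "nat \<Rightarrow> nat list \<Rightarrow> 'k br"
  where "invs n is = foldr (\<lambda>i f. BInv n i \<cdot>\<^sub>B f) is (BId n)"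

text \<open>\<open>br_act q t r g\<close> is the component at \<open>B\<^sub>r\<close> of the natural transformation A(g): prescribed on the
  generators, and extended to all terms in the only way compatible with a k-linear strict monoidal
  functor to the reverse of End(B).\<close>

primrec br_act :: "'k::{comm_ring,comm_monoid_mult} \<Rightarrow> 'k \<Rightarrow> nat \<Rightarrow> 'k os \<Rightarrow> 'k br" where
  "br_act q t r (OId X) = BId (r + length X)"
| "br_act q t r OXp = BSig (r+2) (r+1)"
| "br_act q t r OXm = BInv (r+2) (r+1)"
| "br_act q t r Oc = invs (r+2) (rev [1..<r+1]) \<cdot>\<^sub>B sigs (r+2) (rev [2..<r+2]) \<cdot>\<^sub>B BCup r"
| "br_act q t r Oc' =
    BScl (uinv q * t) (sigs (r+2) (rev [1..<r+1]) \<cdot>\<^sub>B invs (r+2) (rev [2..<r+2]) \<cdot>\<^sub>B BCup r)"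
| "br_act q t r Od' = BCap r \<cdot>\<^sub>B invs (r+2) [2..<r+2] \<cdot>\<^sub>B sigs (r+2) [1..<r+1]"
| "br_act q t r Od =
    BScl (q * uinv t) (BCap r \<cdot>\<^sub>B sigs (r+2) [2..<r+2] \<cdot>\<^sub>B invs (r+2) [1..<r+1])"
| "br_act q t r (f \<cdot>\<^sub>O g) = br_act q t r f \<cdot>\<^sub>B br_act q t r g"
| "br_act q t r (f \<otimes>\<^sub>O g) =
    br_act q t (r + length (os_cod f)) g \<cdot>\<^sub>B br_shift (length (os_dom g)) (br_act q t r f)"
| "br_act q t r (OZer X Y) = BZer (r + length X) (r + length Y)"
| "br_act q t r (OPls f g) = BPls (br_act q t r f) (br_act q t r g)"
| "br_act q t r (OScl a f) = BScl a (br_act q t r f)"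

definition Brauer ::
  "'k::{comm_ring,comm_monoid_mult} \<Rightarrow> 'k \<Rightarrow> 'k \<Rightarrow> (nat, 'k br set, 'k, ori list, 'k os set) modcat"
  where "Brauer q t \<delta> = lincat.extend (quotient_lincat B_terms (br_eq q t \<delta>))
    (modcat.fields (\<lambda>r X. r + length X)
      (\<lambda>F X. lift1 (br_eq q t \<delta>) (br_shift (length X)) F)
      (\<lambda>r. lift1 (br_eq q t \<delta>) (br_act q t r)))"


section \<open>The functor F\<close>

definition is_F ::
  "'k::{comm_ring,comm_monoid_mult} \<Rightarrow> 'k \<Rightarrow> 'k \<Rightarrow> (ori list \<Rightarrow> nat) \<Rightarrow> ('k ds set \<Rightarrow> 'k br set) \<Rightarrow> bool"
  where "is_F q t \<delta> FO FM \<longleftrightarrow>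
    strict_module_morphism (OS q t \<delta>) (DS q t \<delta>) (Brauer q t \<delta>) FO FM \<and>
    FO [] = 0 \<and>
    FM (toggle q t \<delta>) = Idn (Brauer q t \<delta>) 1 \<and>
    FM (toggle' q t \<delta>) = Idn (Brauer q t \<delta>) 1"

end

theory Submission
  imports Defs
begin

text \<open>
  A strand pulled across all the strands on its left gives a half braiding in both categories, and with
  it the action of a generator of the oriented skein category at \<open>B\<^sub>r\<^sub>+\<^sub>1\<close> is conjugate to the one at \<open>B\<^sub>r\<close>.
  Hence the relations making \<open>B(q,t)\<close> a module need only be verified at \<open>B\<^sub>0\<close>, where c and d' act
  by the cup and the cap.

  In the other direction \<open>B\<^sub>n\<close> is sent to the word of n upward arrows, \<open>\<sigma>\<^sub>i\<close> to a crossing, the cup to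
  \<open>(\<tau> \<otimes> 1)c\<close> and the cap to \<open>d'(\<tau>' \<otimes> 1)\<close>.  A downward arrow in any position can be toggled by pulling
  it to the far left with \<open>R\<^sub>+\<close>, applying \<open>\<tau>\<close>, and pulling it back with \<open>X\<^sub>-\<close>; F maps this isomorphism
  to an identity.  The relations for two cups or caps follow from the interchange law, because
  such a toggle slides past the images of the generators.  Composing these toggles gives a natural
  isomorphism from the identity of \<open>DS(q,t)\<close> to the composite with F, while the composite on \<open>B(q,t)\<close> is
  the identity.
\<close>

section \<open>Quotients of term structures\<close>

text \<open>\<open>DS\<close> carries only a right action, so a toggle can be placed directly only
  on the leftmost arrow. A toggle elsewhere is a constructed morphism, and its compatibility with
  cups and caps is a theorem, not an instance of the interchange law. That theorem rests on the
  third toggle relation, which is imposed with \<open>R_-\<close>, whereas strands are pulled with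
  \<open>R_+\<close>. The two differ by a multiple of \<open>c d\<close>, and this correction is
  scaled by q on both sides of the relation, so it cancels.

  On the Brauer side, naturality of the action in the morphisms of B has to precede the skein
  relations: the half braiding is compatible with tensor products only because of it. The four
  oriented cups and caps against a cup or a cap of B give eight naturality conditions. Four of them
  unwind to relations with four crossings: three are defining relations of B, the fourth is a
  variant with two exponents exchanged. The other four follow since in B the maps c and c' (and
  likewise d and d') differ by one crossing and the scalar t.\<close>

locale typed_terms =
  fixes C :: "('o, 'm, 'k::{comm_ring,comm_monoid_mult}, 'z) lincat_scheme"
    and wf :: "'m \<Rightarrow> bool" and dom cod :: "'m \<Rightarrow> 'o"
  assumes Hom_eq: "Hom C X Y = {f. wf f \<and> dom f = X \<and> cod f = Y}"
    and typing [simp]: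
      "wf (Idn C X)" "dom (Idn C X) = X" "cod (Idn C X) = X"
      "wf (Cmp C f g) \<longleftrightarrow> wf f \<and> wf g \<and> dom f = cod g" "dom (Cmp C f g) = dom g" "cod (Cmp C f g) = cod f"
      "wf (Zer C X Y)" "dom (Zer C X Y) = X" "cod (Zer C X Y) = Y"
      "wf (Pls C f g) \<longleftrightarrow> wf f \<and> wf g \<and> dom f = dom g \<and> cod f = cod g"
      "dom (Pls C f g) = dom f" "cod (Pls C f g) = cod f"
      "wf (Scl C a f) \<longleftrightarrow> wf f" "dom (Scl C a f) = dom f" "cod (Scl C a f) = cod f"
begin

definition parallel :: "'m \<Rightarrow> 'm \<Rightarrow> bool"
  where "parallel f g \<longleftrightarrow> wf f \<and> wf g \<and> dom f = dom g \<and> cod f = cod g"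

lemma lin_ax_parallel: "lin_ax C f g \<Longrightarrow> parallel f g"
  by (induction rule: lin_ax.induct) (auto simp: Hom_eq parallel_def)

end

locale term_category = typed_terms +
  fixes E :: "'b \<Rightarrow> 'b \<Rightarrow> bool"
  assumes E_parallel: "E f g \<Longrightarrow> parallel f g"
    and E_refl: "wf f \<Longrightarrow> E f f"
    and E_sym: "E f g \<Longrightarrow> E g f"
    and E_trans: "E f g \<Longrightarrow> E g h \<Longrightarrow> E f h"
    and E_Cmp: "E f f' \<Longrightarrow> E g g' \<Longrightarrow> dom f = cod g \<Longrightarrow> E (Cmp C f g) (Cmp C f' g')"
    and E_Pls: "E f f' \<Longrightarrow> E g g' \<Longrightarrow> dom f = dom g \<Longrightarrow> cod f = cod g \<Longrightarrow> E (Pls C f g) (Pls C f' g')"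
    and E_Scl: "E f f' \<Longrightarrow> E (Scl C a f) (Scl C a f')"
    and E_lin: "lin_ax C f g \<Longrightarrow> E f g"
begin

lemma cls_ill: "\<not> wf f \<Longrightarrow> cls E f = {}"
  using E_parallel by (auto simp: cls_def parallel_def)

lemma cls_eq: "E f g \<Longrightarrow> cls E f = cls E g"
  unfolding cls_def by (blast intro: E_sym E_trans)

lemma cls_eqD: "cls E f = cls E g \<Longrightarrow> wf f \<Longrightarrow> E f g"
  using E_refl[of f] E_sym by (auto simp: cls_def)

lemma cls_self: "wf f \<Longrightarrow> f \<in> cls E f"
  using E_refl by (auto simp: cls_def)

text \<open>Classes of ill-formed terms are all empty, so it is enough to relate the terms when one
  of them is well-formed. This supplies the typing hypotheses of whatever axiom is used to prove
  \<open>E\<close>.\<close>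

lemma cls_eqI: "(wf f \<or> wf g \<Longrightarrow> E f g) \<Longrightarrow> cls E f = cls E g"
  by (metis cls_eq cls_ill)

text \<open>For an ill-formed \<open>f\<close> the union is over the empty class; the second
  hypothesis makes the right-hand side agree with it.\<close>

lemma lift1_gen:
  assumes "\<And>f g. E f g \<Longrightarrow> K (h f) = K (h g)" and "\<And>f. \<not> wf f \<Longrightarrow> K (h f) = {}"
  shows "(\<Union>g\<in>cls E f. K (h g)) = K (h f)"
proof (cases "wf f")
  case True
  have "K (h g) = K (h f)" if "g \<in> cls E f" for g
    using assms(1)[of f g] that by (simp add: cls_def)
  then show ?thesis using cls_self[OF True] by blast
qed (use assms(2) in \<open>simp add: cls_ill\<close>)

lemma lift1_cls:
  assumes "\<And>f g. E f g \<Longrightarrow> cls E' (h f) = cls E' (h g)" and "\<And>f. \<not> wf f \<Longrightarrow> cls E' (h f) = {}"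
  shows "lift1 E' h (cls E f) = cls E' (h f)"
  unfolding lift1_def by (rule lift1_gen) (use assms in auto)

lemma Cmp_cong: "E f f' \<Longrightarrow> E g g' \<Longrightarrow> cls E (Cmp C f g) = cls E (Cmp C f' g')"
proof (rule cls_eqI)
  assume "E f f'" "E g g'" and "wf (Cmp C f g) \<or> wf (Cmp C f' g')"
  moreover from this have "parallel f f'" "parallel g g'"
    using E_parallel by blast+
  ultimately show "E (Cmp C f g) (Cmp C f' g')"
    by (intro E_Cmp) (auto simp: parallel_def)
qed

lemma Pls_cong: "E f f' \<Longrightarrow> E g g' \<Longrightarrow> cls E (Pls C f g) = cls E (Pls C f' g')"
proof (rule cls_eqI)
  assume "E f f'" "E g g'" and "wf (Pls C f g) \<or> wf (Pls C f' g')"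
  moreover from this have "parallel f f'" "parallel g g'"
    using E_parallel by blast+
  ultimately show "E (Pls C f g) (Pls C f' g')"
    by (intro E_Pls) (auto simp: parallel_def)
qed

lemma lift2_cls:
  assumes "\<And>f f' g g'. E f f' \<Longrightarrow> E g g' \<Longrightarrow> cls E (h f g) = cls E (h f' g')"
    and "\<And>f g. \<not> wf f \<or> \<not> wf g \<Longrightarrow> cls E (h f g) = {}"
  shows "lift2 E h (cls E f) (cls E g) = cls E (h f g)"
proof -
  have "(\<Union>g'\<in>cls E g. cls E (h f' g')) = cls E (h f' g)" if "f' \<in> cls E f" for f'
  proof (rule lift1_gen[of "cls E" "h f'"])
    have "wf f'" using that E_parallel by (auto simp: cls_def parallel_def)
    then show "cls E (h f' g) = cls E (h f' g')" if "E g g'" for g g' using that assms(1) E_refl by blast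
  qed (simp add: assms(2))
  then have "lift2 E h (cls E f) (cls E g) = (\<Union>f'\<in>cls E f. cls E (h f' g))"
    unfolding lift2_def by simp
  also have "\<dots> = cls E (h f g)"
  proof (cases "wf g")
    case True
    then show ?thesis
      by (intro lift1_gen[of "cls E" "\<lambda>f. h f g"]) (simp_all add: assms E_refl)
  qed (simp add: assms(2))
  finally show ?thesis .
qed

lemma Cmp_cls: "lift2 E (Cmp C) (cls E f) (cls E g) = cls E (Cmp C f g)"
  by (rule lift2_cls) (erule (1) Cmp_cong, rule cls_ill, simp, blast)

lemma Pls_cls: "lift2 E (Pls C) (cls E f) (cls E g) = cls E (Pls C f g)"
  by (rule lift2_cls) (erule (1) Pls_cong, rule cls_ill, simp, blast)

lemma Scl_cls: "lift1 E (Scl C a) (cls E f) = cls E (Scl C a f)"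
  by (rule lift1_cls) (rule cls_eq, erule E_Scl, simp add: cls_ill)

lemmas ops_cls = Cmp_cls Pls_cls Scl_cls

lemma in_Hom_quotient:
  "F \<in> Hom (quotient_lincat C E) X Y \<longleftrightarrow> (\<exists>f. wf f \<and> dom f = X \<and> cod f = Y \<and> F = cls E f)"
  by (auto simp: quotient_lincat_def Hom_eq)

lemma quotient_ops:
  "Idn (quotient_lincat C E) X = cls E (Idn C X)"
  "Cmp (quotient_lincat C E) = lift2 E (Cmp C)"
  "Zer (quotient_lincat C E) X Y = cls E (Zer C X Y)"
  "Pls (quotient_lincat C E) = lift2 E (Pls C)"
  "Scl (quotient_lincat C E) a = lift1 E (Scl C a)"
  by (auto simp: quotient_lincat_def)

lemma cls_id_left: "cod f = X \<Longrightarrow> cls E (Cmp C (Idn C X) f) = cls E f"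
  by (rule cls_eqI, rule E_lin, rule lin_ax.id_left) (simp add: Hom_eq)

lemma cls_id_right: "dom f = X \<Longrightarrow> cls E (Cmp C f (Idn C X)) = cls E f"
  by (rule cls_eqI, rule E_lin, rule lin_ax.id_right) (simp add: Hom_eq)

lemma cls_assoc: "cls E (Cmp C (Cmp C f g) h) = cls E (Cmp C f (Cmp C g h))"
  by (rule cls_eqI, rule E_lin, rule lin_ax.cmp_assoc) (auto simp: Hom_eq)

lemma lift2_UN:
  "lift2 E h (\<Union>i\<in>I. A i) G = (\<Union>i\<in>I. lift2 E h (A i) G)"
  "lift2 E h G (\<Union>i\<in>I. A i) = (\<Union>i\<in>I. lift2 E h G (A i))"
  by (auto simp: lift2_def)

lemma lift1_UN: "lift1 E h (\<Union>i\<in>I. A i) = (\<Union>i\<in>I. lift1 E h (A i))"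
  by (auto simp: lift1_def)

lemma Cmp_cls_left: "lift2 E (Cmp C) (cls E f) H = (\<Union>h\<in>H. cls E (Cmp C f h))"
proof -
  have "(\<Union>g\<in>cls E f. cls E (Cmp C g h)) = cls E (Cmp C f h)" for h
  proof (cases "wf h")
    case True
    then show ?thesis
      by (intro lift1_gen[of "cls E" "\<lambda>f. Cmp C f h"]) (simp_all add: Cmp_cong E_refl cls_ill)
  qed (simp add: cls_ill)
  then show ?thesis
    unfolding lift2_def by blast
qed

lemma Cmp_cls_right: "lift2 E (Cmp C) H (cls E f) = (\<Union>h\<in>H. cls E (Cmp C h f))"
proof -
  have "(\<Union>g\<in>cls E f. cls E (Cmp C h g)) = cls E (Cmp C h f)" for h
  proof (cases "wf h")
    case True
    then show ?thesis
      by (intro lift1_gen[of "cls E" "\<lambda>f. Cmp C h f"]) (simp_all add: Cmp_cong E_refl cls_ill)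
  qed (simp add: cls_ill)
  then show ?thesis
    unfolding lift2_def by simp
qed

text \<open>Since ill-typed terms have the empty class, composition and scaling satisfy the following
  equations for arbitrary sets of terms, without any typing condition.\<close>

lemma Cmp_assoc_cls:
  "lift2 E (Cmp C) (lift2 E (Cmp C) F G) H = lift2 E (Cmp C) F (lift2 E (Cmp C) G H)"
proof -
  have "lift2 E (Cmp C) (lift2 E (Cmp C) F G) H = (\<Union>f\<in>F. \<Union>g\<in>G. \<Union>h\<in>H. cls E (Cmp C (Cmp C f g) h))"
    unfolding lift2_def[of E "Cmp C" F G] lift2_UN Cmp_cls_left ..
  moreover have "lift2 E (Cmp C) F (lift2 E (Cmp C) G H) = (\<Union>g\<in>G. \<Union>h\<in>H. \<Union>f\<in>F. cls E (Cmp C f (Cmp C g h)))"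
    unfolding lift2_def[of E "Cmp C" G H] lift2_UN Cmp_cls_right ..
  moreover have "(\<Union>f\<in>F. \<Union>g\<in>G. \<Union>h\<in>H. A f g h) = (\<Union>g\<in>G. \<Union>h\<in>H. \<Union>f\<in>F. A f g h)" for A :: "'b \<Rightarrow> 'b \<Rightarrow> 'b \<Rightarrow> 'b set"
    by auto
  ultimately show ?thesis
    unfolding cls_assoc by simp
qed

lemma cls_pls_assoc: "cls E (Pls C (Pls C f g) h) = cls E (Pls C f (Pls C g h))"
  by (rule cls_eqI, rule E_lin, rule lin_ax.pls_assoc) (auto simp: Hom_eq)

lemma cls_pls_commute: "cls E (Pls C f g) = cls E (Pls C g f)"
  by (rule cls_eqI, rule E_lin, rule lin_ax.pls_commute) (auto simp: Hom_eq)

lemma cls_pls_zero: "dom f = X \<Longrightarrow> cod f = Y \<Longrightarrow> cls E (Pls C f (Zer C X Y)) = cls E f"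
  by (rule cls_eqI, rule E_lin, rule lin_ax.pls_zero) (auto simp: Hom_eq)

lemma cls_pls_neg: "wf f \<Longrightarrow> cls E (Pls C f (Scl C (- 1) f)) = cls E (Zer C (dom f) (cod f))"
  by (rule cls_eq, rule E_lin, rule lin_ax.pls_neg) (auto simp: Hom_eq)

lemma cls_scl_pls: "cls E (Scl C a (Pls C f g)) = cls E (Pls C (Scl C a f) (Scl C a g))"
  by (rule cls_eqI, rule E_lin, rule lin_ax.scl_pls) (auto simp: Hom_eq)

lemma cls_add_scl: "cls E (Scl C (a + b) f) = cls E (Pls C (Scl C a f) (Scl C b f))"
  by (rule cls_eqI, rule E_lin, rule lin_ax.add_scl) (auto simp: Hom_eq)

lemma cls_mult_scl: "cls E (Scl C (a * b) f) = cls E (Scl C a (Scl C b f))"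
  by (rule cls_eqI, rule E_lin, rule lin_ax.mult_scl) (auto simp: Hom_eq)

lemma cls_one_scl: "cls E (Scl C 1 f) = cls E f"
  by (rule cls_eqI, rule E_lin, rule lin_ax.one_scl) (auto simp: Hom_eq)

lemma cls_pls_cmp: "cls E (Cmp C (Pls C f f') g) = cls E (Pls C (Cmp C f g) (Cmp C f' g))"
  by (rule cls_eqI, rule E_lin, rule lin_ax.pls_cmp) (auto simp: Hom_eq)

lemma cls_cmp_pls: "cls E (Cmp C f (Pls C g g')) = cls E (Pls C (Cmp C f g) (Cmp C f g'))"
  by (rule cls_eqI, rule E_lin, rule lin_ax.cmp_pls) (auto simp: Hom_eq)

lemma cls_scl_cmp: "cls E (Cmp C (Scl C a f) g) = cls E (Scl C a (Cmp C f g))"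
  by (rule cls_eqI, rule E_lin, rule lin_ax.scl_cmp) (auto simp: Hom_eq)

lemma cls_cmp_scl: "cls E (Cmp C f (Scl C a g)) = cls E (Scl C a (Cmp C f g))"
  by (rule cls_eqI, rule E_lin, rule lin_ax.cmp_scl) (auto simp: Hom_eq)

lemma Scl_Cmp_cls: "lift2 E (Cmp C) (lift1 E (Scl C a) F) G = lift1 E (Scl C a) (lift2 E (Cmp C) F G)"
proof -
  have "lift2 E (Cmp C) (lift1 E (Scl C a) F) G = (\<Union>f\<in>F. \<Union>g\<in>G. cls E (Cmp C (Scl C a f) g))"
    unfolding lift1_def lift2_UN Cmp_cls_left ..
  also have "\<dots> = lift1 E (Scl C a) (lift2 E (Cmp C) F G)"
    unfolding lift2_def lift1_UN Scl_cls cls_scl_cmp ..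
  finally show ?thesis .
qed

lemma Cmp_Scl_cls: "lift2 E (Cmp C) F (lift1 E (Scl C a) G) = lift1 E (Scl C a) (lift2 E (Cmp C) F G)"
proof -
  have "lift2 E (Cmp C) F (lift1 E (Scl C a) G) = (\<Union>g\<in>G. \<Union>f\<in>F. cls E (Cmp C f (Scl C a g)))"
    unfolding lift1_def lift2_UN Cmp_cls_right ..
  also have "\<dots> = (\<Union>f\<in>F. \<Union>g\<in>G. cls E (Scl C a (Cmp C f g)))"
    unfolding cls_cmp_scl by auto
  also have "\<dots> = lift1 E (Scl C a) (lift2 E (Cmp C) F G)"
    unfolding lift2_def lift1_UN Scl_cls ..
  finally show ?thesis .
qed

lemma Scl_Scl_cls: "lift1 E (Scl C a) (lift1 E (Scl C b) F) = lift1 E (Scl C (a * b)) F"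
  unfolding lift1_def[of E "Scl C b"] lift1_UN Scl_cls cls_mult_scl[symmetric] lift1_def[of E "Scl C (a * b)"] ..

lemma Cmp_reassoc: "lift2 E (Cmp C) F G = H \<Longrightarrow> lift2 E (Cmp C) F (lift2 E (Cmp C) G K) = lift2 E (Cmp C) H K"
  by (simp add: Cmp_assoc_cls[symmetric])

lemma Scl_one_cls: "lift1 E (Scl C 1) (cls E f) = cls E f"
  by (simp add: Scl_cls cls_one_scl)

lemma Scl_one_Cmp_cls: "lift1 E (Scl C 1) (lift2 E (Cmp C) F G) = lift2 E (Cmp C) F G"
  unfolding lift2_def lift1_UN Scl_one_cls ..

lemma Id_left_cls: "cod f = X \<Longrightarrow> lift2 E (Cmp C) (cls E (Idn C X)) (cls E f) = cls E f"
  by (simp add: Cmp_cls cls_id_left)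

lemma Id_right_cls: "dom f = X \<Longrightarrow> lift2 E (Cmp C) (cls E f) (cls E (Idn C X)) = cls E f"
  by (simp add: Cmp_cls cls_id_right)

lemma Id_left_Cmp_cls:
  "cod f = X \<Longrightarrow> lift2 E (Cmp C) (cls E (Idn C X)) (lift2 E (Cmp C) (cls E f) G) = lift2 E (Cmp C) (cls E f) G"
  by (simp add: Cmp_reassoc[OF Id_left_cls])

lemma Id_right_Cmp_cls:
  "dom f = X \<Longrightarrow> lift2 E (Cmp C) (cls E f) (lift2 E (Cmp C) (cls E (Idn C X)) G) = lift2 E (Cmp C) (cls E f) G"
  by (simp add: Cmp_reassoc[OF Id_right_cls])

text \<open>Distributivity fails for arbitrary sets of terms: a repeated factor could be represented
  by different members in the two summands. The additive identities are therefore restricted to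
  classes, the empty one included.\<close>

definition is_cls :: "'b set \<Rightarrow> bool"
  where "is_cls F \<longleftrightarrow> F \<in> range (cls E)"

lemma is_cls_cls: "is_cls (cls E f)"
  by (simp add: is_cls_def)

lemma is_cls_Cmp: "is_cls F \<Longrightarrow> is_cls G \<Longrightarrow> is_cls (lift2 E (Cmp C) F G)"
  by (auto simp: is_cls_def Cmp_cls)

lemma is_cls_Pls: "is_cls F \<Longrightarrow> is_cls G \<Longrightarrow> is_cls (lift2 E (Pls C) F G)"
  by (auto simp: is_cls_def Pls_cls)

lemma is_cls_Scl: "is_cls F \<Longrightarrow> is_cls (lift1 E (Scl C a) F)"
  by (auto simp: is_cls_def Scl_cls)

lemma Pls_Cmp_cls: "is_cls F \<Longrightarrow> is_cls G \<Longrightarrow> is_cls H \<Longrightarrow>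
    lift2 E (Cmp C) (lift2 E (Pls C) F G) H = lift2 E (Pls C) (lift2 E (Cmp C) F H) (lift2 E (Cmp C) G H)"
  by (auto simp: is_cls_def ops_cls cls_pls_cmp)

lemma Cmp_Pls_cls: "is_cls F \<Longrightarrow> is_cls G \<Longrightarrow> is_cls H \<Longrightarrow>
    lift2 E (Cmp C) H (lift2 E (Pls C) F G) = lift2 E (Pls C) (lift2 E (Cmp C) H F) (lift2 E (Cmp C) H G)"
  by (auto simp: is_cls_def ops_cls cls_cmp_pls)

lemma Scl_Pls_cls: "is_cls F \<Longrightarrow> is_cls G \<Longrightarrow>
    lift1 E (Scl C a) (lift2 E (Pls C) F G) = lift2 E (Pls C) (lift1 E (Scl C a) F) (lift1 E (Scl C a) G)"
  by (auto simp: is_cls_def ops_cls cls_scl_pls)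

lemma Pls_Scl_Scl_cls: "is_cls F \<Longrightarrow>
    lift2 E (Pls C) (lift1 E (Scl C a) F) (lift1 E (Scl C b) F) = lift1 E (Scl C (a + b)) F"
  by (auto simp: is_cls_def ops_cls cls_add_scl)

lemma Pls_commute_cls: "is_cls F \<Longrightarrow> is_cls G \<Longrightarrow> lift2 E (Pls C) F G = lift2 E (Pls C) G F"
  by (auto simp: is_cls_def ops_cls cls_pls_commute)

lemma Pls_assoc_cls: "is_cls F \<Longrightarrow> is_cls G \<Longrightarrow> is_cls H \<Longrightarrow>
    lift2 E (Pls C) (lift2 E (Pls C) F G) H = lift2 E (Pls C) F (lift2 E (Pls C) G H)"
  by (auto simp: is_cls_def ops_cls cls_pls_assoc)

text \<open>Write 0 as 1 + (-1) and use the axiom \<open>pls_neg\<close>. Scaling by 0 is afterwards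
  the handle on zero morphisms: whatever respects scaling respects them.\<close>

lemma Scl_zero_cls: "wf f \<Longrightarrow> lift1 E (Scl C 0) (cls E f) = cls E (Zer C (dom f) (cod f))"
proof -
  assume "wf f"
  have "lift1 E (Scl C 0) (cls E f) = cls E (Scl C (1 + - 1) f)"
    by (simp add: Scl_cls)
  also have "\<dots> = lift2 E (Pls C) (cls E (Scl C 1 f)) (cls E (Scl C (- 1) f))"
    unfolding cls_add_scl Pls_cls ..
  also have "\<dots> = cls E (Zer C (dom f) (cod f))"
    unfolding cls_one_scl Pls_cls by (rule cls_pls_neg) fact
  finally show ?thesis .
qed

lemma Pls_zero_cls: "dom f = X \<Longrightarrow> cod f = Y \<Longrightarrow> lift2 E (Pls C) (cls E f) (cls E (Zer C X Y)) = cls E f"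
  by (simp add: Pls_cls cls_pls_zero)

lemma Pls_cancel_cls:
  assumes "cls E (Pls C f h) = cls E (Pls C g h)" "wf (Pls C f h)" "wf (Pls C g h)"
  shows "cls E f = cls E g"
proof -
  have 1: "cls E f = lift2 E (Pls C) (cls E (Pls C f h)) (cls E (Scl C (- 1) h))" if "wf (Pls C f h)" for f
  proof -
    have "lift2 E (Pls C) (cls E (Pls C f h)) (cls E (Scl C (- 1) h)) = lift2 E (Pls C) (cls E f) (cls E (Pls C h (Scl C (- 1) h)))"
      by (simp add: Pls_cls cls_pls_assoc)
    also have "\<dots> = cls E f"
      using that by (simp add: cls_pls_neg Pls_zero_cls)
    finally show ?thesis ..
  qed
  show ?thesis
    by (rule trans[OF 1[OF assms(2), unfolded assms(1)] 1[OF assms(3), symmetric]])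
qed

lemma Cmp_Zer_cls: "wf f \<Longrightarrow> dom f = Y \<Longrightarrow> lift2 E (Cmp C) (cls E f) (cls E (Zer C X Y)) = cls E (Zer C X (cod f))"
  using Scl_zero_cls[of "Zer C X Y"] Scl_zero_cls[of "Cmp C f (Zer C X Y)"]
  by (metis Cmp_Scl_cls Cmp_cls typing(4-9))

lemma Zer_Cmp_cls: "wf f \<Longrightarrow> cod f = X \<Longrightarrow> lift2 E (Cmp C) (cls E (Zer C X Y)) (cls E f) = cls E (Zer C (dom f) Y)"
  using Scl_zero_cls[of "Zer C X Y"] Scl_zero_cls[of "Cmp C (Zer C X Y) f"]
  by (metis Scl_Cmp_cls Cmp_cls typing(4-9))

lemmas is_cls_intros = is_cls_cls is_cls_Cmp is_cls_Pls is_cls_Scl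

lemmas cls_lin = cls_id_left cls_id_right cls_assoc cls_pls_assoc cls_pls_commute cls_pls_zero
  cls_pls_neg cls_scl_pls cls_add_scl cls_mult_scl cls_one_scl cls_pls_cmp cls_cmp_pls
  cls_scl_cmp cls_cmp_scl

lemma quotient_lin_ax: "lin_ax (quotient_lincat C E) F G \<Longrightarrow> F = G"
  by (induction rule: lin_ax.induct; clarsimp simp: in_Hom_quotient quotient_ops ops_cls)
    (rule cls_lin; simp)+

lemma cls_in_Hom: "wf f \<Longrightarrow> dom f = X \<Longrightarrow> cod f = Y \<Longrightarrow> cls E f \<in> Hom (quotient_lincat C E) X Y"
  unfolding in_Hom_quotient by blast

lemma Hom_quotientE:
  assumes "F \<in> Hom (quotient_lincat C E) X Y"
  obtains f where "wf f" "dom f = X" "cod f = Y" "F = cls E f"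
  using assms unfolding in_Hom_quotient by blast

lemma linear_category_quotient: "linear_category (quotient_lincat C E)"
  by unfold_locales
    (erule Hom_quotientE | simp add: quotient_ops ops_cls cls_in_Hom quotient_lin_ax)+

end

text \<open>The full structures are record extensions of the quotient, hence of another type; the
  linear axioms see only the six fields compared here.\<close>

lemma linear_category_cong:
  assumes "linear_category C" and "Hom D = Hom C" "Idn D = Idn C" "Cmp D = Cmp C" "Zer D = Zer C"
    "Pls D = Pls C" "Scl D = Scl C"
  shows "linear_category D"
proof -
  interpret linear_category C by fact
  have "lin_ax D f g \<Longrightarrow> lin_ax C f g" for f g
    by (induction rule: lin_ax.induct) (auto simp: assms(2-) intro: lin_ax.intros)
  then show ?thesis
    by unfold_locales
      (auto simp: assms(2-) intro: Idn_hom Cmp_hom Zer_hom Pls_hom Scl_hom linear_axioms)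
qed

section \<open>The three presentations\<close>

interpretation OS_typed: typed_terms OS_terms os_wf os_dom os_cod
  rewrites "Idn OS_terms = OId" and "Cmp OS_terms = OCmp" and "Zer OS_terms = OZer"
    and "Pls OS_terms = OPls" and "Scl OS_terms = OScl"
  by unfold_locales (auto simp: OS_terms_def)

interpretation DS_typed: typed_terms DS_terms ds_wf ds_dom ds_cod
  rewrites "Idn DS_terms = (\<lambda>X. DOs (OId X))" and "Cmp DS_terms = DCmp" and "Zer DS_terms = DZer"
    and "Pls DS_terms = DPls" and "Scl DS_terms = DScl"
  by unfold_locales (auto simp: DS_terms_def)

interpretation B_typed: typed_terms B_terms br_wf br_dom br_cod
  rewrites "Idn B_terms = BId" and "Cmp B_terms = BCmp" and "Zer B_terms = BZer"
    and "Pls B_terms = BPls" and "Scl B_terms = BScl"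
  by unfold_locales (auto simp: B_terms_def)

lemma OS_terms_simps [simp]:
  "f \<in> Hom OS_terms X Y \<longleftrightarrow> os_wf f \<and> os_dom f = X \<and> os_cod f = Y"
  "Idn OS_terms = OId" "Cmp OS_terms = OCmp" "Zer OS_terms = OZer" "Pls OS_terms = OPls"
  "Scl OS_terms = OScl" "One OS_terms = []" "TenO OS_terms = (@)" "Ten OS_terms = OTen"
  by (auto simp: OS_terms_def)

lemma DS_terms_simps [simp]:
  "f \<in> Hom DS_terms X Y \<longleftrightarrow> ds_wf f \<and> ds_dom f = X \<and> ds_cod f = Y"
  "Idn DS_terms = (\<lambda>X. DOs (OId X))" "Cmp DS_terms = DCmp" "Zer DS_terms = DZer"
  "Pls DS_terms = DPls" "Scl DS_terms = DScl"
  by (auto simp: DS_terms_def)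

lemma B_terms_simps [simp]:
  "f \<in> Hom B_terms X Y \<longleftrightarrow> br_wf f \<and> br_dom f = X \<and> br_cod f = Y"
  "Idn B_terms = BId" "Cmp B_terms = BCmp" "Zer B_terms = BZer" "Pls B_terms = BPls"
  "Scl B_terms = BScl"
  by (auto simp: B_terms_def)

lemma mon_ax_parallel: "mon_ax OS_terms f g \<Longrightarrow> OS_typed.parallel f g"
  by (induction rule: mon_ax.induct) (auto simp: OS_typed.parallel_def)

lemma os_rel_parallel: "os_rel q t \<delta> f g \<Longrightarrow> OS_typed.parallel f g"
  by (induction rule: os_rel.induct) (auto simp: OS_typed.parallel_def R_of_def L_of_def)

lemma os_eq_parallel: "os_eq q t \<delta> f g \<Longrightarrow> OS_typed.parallel f g"
proof (induction rule: os_eq.induct)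
  case (os_lin f g)
  then show ?case by (rule OS_typed.lin_ax_parallel)
next
  case (os_mon f g)
  then show ?case by (rule mon_ax_parallel)
next
  case (os_rel f g)
  then show ?case by (rule os_rel_parallel)
qed (auto simp: OS_typed.parallel_def)

lemma act_ax_parallel: "act_ax f g \<Longrightarrow> DS_typed.parallel f g"
  by (induction rule: act_ax.induct) (auto simp: DS_typed.parallel_def)

lemma ds_rel_parallel: "ds_rel q f g \<Longrightarrow> DS_typed.parallel f g"
  by (induction rule: ds_rel.induct) (auto simp: DS_typed.parallel_def R_of_def D_of_def)

lemma ds_eq_parallel: "ds_eq q t \<delta> f g \<Longrightarrow> DS_typed.parallel f g"
proof (induction rule: ds_eq.induct)
  case (ds_lin f g)
  then show ?case by (rule DS_typed.lin_ax_parallel)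
next
  case (ds_act_ax f g)
  then show ?case by (rule act_ax_parallel)
next
  case (ds_rel f g)
  then show ?case by (rule ds_rel_parallel)
qed (auto simp: DS_typed.parallel_def OS_typed.parallel_def dest: os_eq_parallel)

lemma br_eq_parallel: "br_eq q t \<delta> f g \<Longrightarrow> B_typed.parallel f g"
proof (induction rule: br_eq.induct)
  case (br_lin f g)
  then show ?case by (rule B_typed.lin_ax_parallel)
qed (auto simp: B_typed.parallel_def)

text \<open>\<open>\<delta>\<close> is a parameter constrained by an equation, since
  \<open>q - uinv q\<close> may be a zero divisor and need not determine the quotient.\<close>

locale skein_parameters =
  fixes q t \<delta> :: "'k::{comm_ring,comm_monoid_mult}"
  assumes q_unit: "q dvd 1" and t_unit: "t dvd 1" and delta: "t - uinv t = \<delta> * (q - uinv q)"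
begin

lemma mult_uinv: "x dvd 1 \<Longrightarrow> x * uinv x = 1" for x :: 'k
proof -
  assume "x dvd 1"
  then obtain y where y: "x * y = 1" by (auto simp: dvd_def)
  have "y' = y" if "x * y' = 1" for y'
  proof -
    have "y' = (x * y) * y'" by (simp add: y)
    also have "\<dots> = (x * y') * y" by (simp only: mult_ac)
    finally show "y' = y" by (simp add: that)
  qed
  with y have "(THE y. x * y = 1) = y" by (rule the_equality)
  then show ?thesis unfolding uinv_def using y by simp
qed

lemma unit_simps:
  fixes x y :: 'k
  assumes "x dvd 1"
  shows "x * uinv x = 1" "uinv x * x = 1" "x * (uinv x * y) = y" "uinv x * (x * y) = y"
proof -
  show 1: "x * uinv x = 1" by (rule mult_uinv[OF assms])
  then show 2: "uinv x * x = 1" by (simp only: mult.commute)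
  show "x * (uinv x * y) = y" by (simp only: mult.assoc[symmetric] 1 mult_1_left)
  show "uinv x * (x * y) = y" by (simp only: mult.assoc[symmetric] 2 mult_1_left)
qed

lemmas q_inv [simp] = unit_simps[OF q_unit]
lemmas t_inv [simp] = unit_simps[OF t_unit]

sublocale O: term_category OS_terms os_wf os_dom os_cod "os_eq q t \<delta>"
  rewrites "Idn OS_terms = OId" and "Cmp OS_terms = OCmp" and "Zer OS_terms = OZer"
    and "Pls OS_terms = OPls" and "Scl OS_terms = OScl"
proof unfold_locales
  fix f g h f' g' :: "'k os"
  show "os_eq q t \<delta> f g \<Longrightarrow> typed_terms.parallel os_wf os_dom os_cod f g"
    by (rule os_eq_parallel)
  show "os_wf f \<Longrightarrow> os_eq q t \<delta> f f"
    by (rule os_refl) simp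
  show "os_eq q t \<delta> f g \<Longrightarrow> os_eq q t \<delta> g h \<Longrightarrow> os_eq q t \<delta> f h"
    by (rule os_trans)
qed (simp_all add: os_sym os_cmp os_pls os_scl os_lin)

sublocale D: term_category DS_terms ds_wf ds_dom ds_cod "ds_eq q t \<delta>"
  rewrites "Idn DS_terms = (\<lambda>X. DOs (OId X))" and "Cmp DS_terms = DCmp" and "Zer DS_terms = DZer"
    and "Pls DS_terms = DPls" and "Scl DS_terms = DScl"
proof unfold_locales
  fix f g h f' g' :: "'k ds"
  show "ds_eq q t \<delta> f g \<Longrightarrow> typed_terms.parallel ds_wf ds_dom ds_cod f g"
    by (rule ds_eq_parallel)
  show "ds_wf f \<Longrightarrow> ds_eq q t \<delta> f f"
    by (rule ds_refl) simp
  show "ds_eq q t \<delta> f g \<Longrightarrow> ds_eq q t \<delta> g h \<Longrightarrow> ds_eq q t \<delta> f h"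
    by (rule ds_trans)
qed (simp_all add: ds_sym ds_cmp ds_pls ds_scl ds_lin)

sublocale B: term_category B_terms br_wf br_dom br_cod "br_eq q t \<delta>"
  rewrites "Idn B_terms = BId" and "Cmp B_terms = BCmp" and "Zer B_terms = BZer"
    and "Pls B_terms = BPls" and "Scl B_terms = BScl"
proof unfold_locales
  fix f g h f' g' :: "'k br"
  show "br_eq q t \<delta> f g \<Longrightarrow> typed_terms.parallel br_wf br_dom br_cod f g"
    by (rule br_eq_parallel)
  show "br_wf f \<Longrightarrow> br_eq q t \<delta> f f"
    by (rule br_refl) simp
  show "br_eq q t \<delta> f g \<Longrightarrow> br_eq q t \<delta> g h \<Longrightarrow> br_eq q t \<delta> f h"
    by (rule br_trans)
qed (simp_all add: br_sym br_cmp br_pls br_scl br_lin)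

abbreviation oc :: "'k os \<Rightarrow> 'k os set" where "oc \<equiv> cls (os_eq q t \<delta>)"
abbreviation dc :: "'k ds \<Rightarrow> 'k ds set" where "dc \<equiv> cls (ds_eq q t \<delta>)"
abbreviation bc :: "'k br \<Rightarrow> 'k br set" where "bc \<equiv> cls (br_eq q t \<delta>)"

section \<open>The oriented skein category is strict monoidal\<close>

lemma Ten_cls: "lift2 (os_eq q t \<delta>) OTen (oc f) (oc g) = oc (f \<otimes>\<^sub>O g)"
  by (rule O.lift2_cls) (rule O.cls_eq, erule (1) os_ten, rule O.cls_ill, simp)

lemma OS_simps:
  "Hom (OS q t \<delta>) = Hom (quotient_lincat OS_terms (os_eq q t \<delta>))"
  "Idn (OS q t \<delta>) = (\<lambda>X. oc (OId X))" "Cmp (OS q t \<delta>) = lift2 (os_eq q t \<delta>) OCmp"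
  "Zer (OS q t \<delta>) = (\<lambda>X Y. oc (OZer X Y))" "Pls (OS q t \<delta>) = lift2 (os_eq q t \<delta>) OPls"
  "Scl (OS q t \<delta>) = (\<lambda>a. lift1 (os_eq q t \<delta>) (OScl a))"
  "One (OS q t \<delta>) = []" "TenO (OS q t \<delta>) = (@)" "Ten (OS q t \<delta>) = lift2 (os_eq q t \<delta>) OTen"
  by (auto simp: OS_def lincat.defs moncat.defs quotient_lincat_def)

lemma in_Hom_OS: "F \<in> Hom (OS q t \<delta>) X Y \<longleftrightarrow> (\<exists>f. os_wf f \<and> os_dom f = X \<and> os_cod f = Y \<and> F = oc f)"
  by (simp add: OS_simps O.in_Hom_quotient)

lemmas OS_terms_mon_ax = mon_ax.intros[where C = OS_terms, unfolded OS_terms_simps]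

lemma OS_mon_ax: "mon_ax (OS q t \<delta>) F G \<Longrightarrow> F = G"
proof (induction rule: mon_ax.induct)
  case (ten_id X Y)
  then show ?case
    by (simp add: OS_simps Ten_cls O.ops_cls) (rule O.cls_eq, rule os_mon, rule OS_terms_mon_ax)
qed (clarsimp simp: in_Hom_OS; simp add: OS_simps Ten_cls O.ops_cls;
    rule O.cls_eq, rule os_mon, rule OS_terms_mon_ax; blast)+

lemma strict_monoidal_OS: "strict_monoidal (OS q t \<delta>)"
proof -
  interpret linear_category "OS q t \<delta>"
    by (rule linear_category_cong[OF O.linear_category_quotient])
      (simp_all add: OS_simps quotient_lincat_def fun_eq_iff)
  show ?thesis
  proof
    fix F G X Y X' Y'
    assume "F \<in> Hom (OS q t \<delta>) X Y" "G \<in> Hom (OS q t \<delta>) X' Y'"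
    then obtain f g where "os_wf f" "os_dom f = X" "os_cod f = Y" "F = oc f"
      "os_wf g" "os_dom g = X'" "os_cod g = Y'" "G = oc g"
      unfolding in_Hom_OS by blast
    then show "Ten (OS q t \<delta>) F G \<in> Hom (OS q t \<delta>) (TenO (OS q t \<delta>) X X') (TenO (OS q t \<delta>) Y Y')"
      unfolding in_Hom_OS by (intro exI[of _ "f \<otimes>\<^sub>O g"]) (simp add: OS_simps Ten_cls)
  qed (simp_all add: OS_simps(7-9) OS_mon_ax)
qed

section \<open>The disoriented skein category is a module\<close>

lemma Act_cong: "ds_eq q t \<delta> f f' \<Longrightarrow> os_eq q t \<delta> g g' \<Longrightarrow> dc (f \<otimes>\<^sub>D g) = dc (f' \<otimes>\<^sub>D g')"
  by (rule D.cls_eq) (rule ds_act)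

lemma dc_Act:
  assumes "dc f = dc f'" and "oc g = oc g'"
  shows "dc (f \<otimes>\<^sub>D g) = dc (f' \<otimes>\<^sub>D g')"
proof (rule D.cls_eqI)
  assume "ds_wf (f \<otimes>\<^sub>D g) \<or> ds_wf (f' \<otimes>\<^sub>D g')"
  then have "ds_eq q t \<delta> f f' \<and> os_eq q t \<delta> g g'"
    using assms D.cls_eqD D.E_sym O.cls_eqD O.E_sym by (metis ds_wf.simps(4))
  then show "ds_eq q t \<delta> (f \<otimes>\<^sub>D g) (f' \<otimes>\<^sub>D g')" by (blast intro: ds_act)
qed

lemma dc_DOs: "oc g = oc g' \<Longrightarrow> dc (DOs g) = dc (DOs g')"
proof (rule D.cls_eqI)
  assume "oc g = oc g'" and "ds_wf (DOs g) \<or> ds_wf (DOs g')"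
  then have "os_eq q t \<delta> g g'"
    using O.cls_eqD O.E_sym by (metis ds_wf.simps(1))
  then show "ds_eq q t \<delta> (DOs g) (DOs g')" by (rule ds_os)
qed

lemma dc_DOs_cmp: "dc (DOs (g \<cdot>\<^sub>O f)) = dc (DOs g \<cdot>\<^sub>D DOs f)"
  by (rule D.cls_eqI, rule ds_act_ax, rule act_ax.DOs_cmp) auto

lemma dc_DOs_pls: "dc (DOs (OPls f g)) = dc (DPls (DOs f) (DOs g))"
  by (rule D.cls_eqI, rule ds_act_ax, rule act_ax.DOs_pls) auto

lemma dc_DOs_scl: "dc (DOs (OScl a f)) = dc (DScl a (DOs f))"
  by (rule D.cls_eqI, rule ds_act_ax, rule act_ax.DOs_scl) auto

lemma dc_DOs_act: "dc (DOs f \<otimes>\<^sub>D g) = dc (DOs (f \<otimes>\<^sub>O g))"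
  by (rule D.cls_eqI, rule ds_act_ax, rule act_ax.DOs_act) auto

lemma dc_act_cmp: "ds_dom f' = ds_cod f \<Longrightarrow> os_dom g' = os_cod g \<Longrightarrow>
    dc ((f' \<cdot>\<^sub>D f) \<otimes>\<^sub>D (g' \<cdot>\<^sub>O g)) = dc ((f' \<otimes>\<^sub>D g') \<cdot>\<^sub>D (f \<otimes>\<^sub>D g))"
  by (rule D.cls_eqI, rule ds_act_ax, rule act_ax.act_cmp) auto

lemma dc_act_act: "dc ((f \<otimes>\<^sub>D g) \<otimes>\<^sub>D h) = dc (f \<otimes>\<^sub>D (g \<otimes>\<^sub>O h))"
  by (rule D.cls_eqI, rule ds_act_ax, rule act_ax.act_act) auto

lemma dc_act_unit: "dc (f \<otimes>\<^sub>D OId []) = dc f"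
  by (rule D.cls_eqI, rule ds_act_ax, rule act_ax.act_unit) auto

lemma dc_pls_act: "dc (DPls f f' \<otimes>\<^sub>D g) = dc (DPls (f \<otimes>\<^sub>D g) (f' \<otimes>\<^sub>D g))"
  by (rule D.cls_eqI, rule ds_act_ax, rule act_ax.pls_act) auto

lemma dc_act_pls: "dc (f \<otimes>\<^sub>D OPls g g') = dc (DPls (f \<otimes>\<^sub>D g) (f \<otimes>\<^sub>D g'))"
  by (rule D.cls_eqI, rule ds_act_ax, rule act_ax.act_pls) auto

lemma dc_scl_act: "dc (DScl a f \<otimes>\<^sub>D g) = dc (DScl a (f \<otimes>\<^sub>D g))"
  by (rule D.cls_eqI, rule ds_act_ax, rule act_ax.scl_act) auto

lemma dc_act_scl: "dc (f \<otimes>\<^sub>D OScl a g) = dc (DScl a (f \<otimes>\<^sub>D g))"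
  by (rule D.cls_eqI, rule ds_act_ax, rule act_ax.act_scl) auto

lemma oc_ten: "oc f = oc f' \<Longrightarrow> oc g = oc g' \<Longrightarrow> oc (f \<otimes>\<^sub>O g) = oc (f' \<otimes>\<^sub>O g')"
  by (metis Ten_cls)

lemma oc_ten_id: "oc (OId X \<otimes>\<^sub>O OId Y) = oc (OId (X @ Y))"
  by (rule O.cls_eq, rule os_mon, rule OS_terms_mon_ax)

lemma oc_ten_assoc: "oc ((f \<otimes>\<^sub>O g) \<otimes>\<^sub>O h) = oc (f \<otimes>\<^sub>O g \<otimes>\<^sub>O h)"
  by (rule O.cls_eqI, rule os_mon, rule OS_terms_mon_ax) auto

lemma oc_ten_unit_left: "oc (OId [] \<otimes>\<^sub>O f) = oc f"
  by (rule O.cls_eqI, rule os_mon, rule OS_terms_mon_ax) auto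

lemma oc_ten_unit_right: "oc (f \<otimes>\<^sub>O OId []) = oc f"
  by (rule O.cls_eqI, rule os_mon, rule OS_terms_mon_ax) auto

lemma oc_ten_cmp: "os_dom f' = os_cod f \<Longrightarrow> os_dom g' = os_cod g \<Longrightarrow>
    oc ((f' \<cdot>\<^sub>O f) \<otimes>\<^sub>O (g' \<cdot>\<^sub>O g)) = oc ((f' \<otimes>\<^sub>O g') \<cdot>\<^sub>O (f \<otimes>\<^sub>O g))"
  by (rule O.cls_eqI, rule os_mon, rule OS_terms_mon_ax) auto

lemma oc_pls_ten: "oc (OPls f f' \<otimes>\<^sub>O g) = oc (OPls (f \<otimes>\<^sub>O g) (f' \<otimes>\<^sub>O g))"
  by (rule O.cls_eqI, rule os_mon, rule OS_terms_mon_ax) auto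

lemma oc_ten_pls: "oc (f \<otimes>\<^sub>O OPls g g') = oc (OPls (f \<otimes>\<^sub>O g) (f \<otimes>\<^sub>O g'))"
  by (rule O.cls_eqI, rule os_mon, rule OS_terms_mon_ax) auto

lemma oc_scl_ten: "oc (OScl a f \<otimes>\<^sub>O g) = oc (OScl a (f \<otimes>\<^sub>O g))"
  by (rule O.cls_eqI, rule os_mon, rule OS_terms_mon_ax) auto

lemma oc_ten_scl: "oc (f \<otimes>\<^sub>O OScl a g) = oc (OScl a (f \<otimes>\<^sub>O g))"
  by (rule O.cls_eqI, rule os_mon, rule OS_terms_mon_ax) auto

text \<open>The interchange law with \<open>f\<close> first; \<open>dc_split_act'\<close> has
  \<open>g\<close> first. Equating the two gives naturality of the action.\<close>

lemma dc_split_act: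
  assumes "os_dom g = X" "ds_cod f = Y"
  shows "dc (f \<otimes>\<^sub>D g) = dc ((DOs (OId Y) \<otimes>\<^sub>D g) \<cdot>\<^sub>D (f \<otimes>\<^sub>D OId X))"
proof -
  have "dc (f \<otimes>\<^sub>D g) = dc ((DOs (OId Y) \<cdot>\<^sub>D f) \<otimes>\<^sub>D (g \<cdot>\<^sub>O OId X))"
    by (rule dc_Act) (simp_all add: D.cls_id_left O.cls_id_right assms)
  also have "\<dots> = dc ((DOs (OId Y) \<otimes>\<^sub>D g) \<cdot>\<^sub>D (f \<otimes>\<^sub>D OId X))"
    by (rule dc_act_cmp) (simp_all add: assms)
  finally show ?thesis .
qed

lemma dc_split_act':
  assumes "os_cod g = X" "ds_dom f = Y"
  shows "dc (f \<otimes>\<^sub>D g) = dc ((f \<otimes>\<^sub>D OId X) \<cdot>\<^sub>D (DOs (OId Y) \<otimes>\<^sub>D g))"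
proof -
  have "dc (f \<otimes>\<^sub>D g) = dc ((f \<cdot>\<^sub>D DOs (OId Y)) \<otimes>\<^sub>D (OId X \<cdot>\<^sub>O g))"
    by (rule dc_Act) (simp_all add: D.cls_id_right O.cls_id_left assms)
  also have "\<dots> = dc ((f \<otimes>\<^sub>D OId X) \<cdot>\<^sub>D (DOs (OId Y) \<otimes>\<^sub>D g))"
    by (rule dc_act_cmp) (simp_all add: assms)
  finally show ?thesis .
qed

lemma dc_whisker_right_cmp:
  "dc ((f' \<cdot>\<^sub>D f) \<otimes>\<^sub>D OId X) = dc ((f' \<otimes>\<^sub>D OId X) \<cdot>\<^sub>D (f \<otimes>\<^sub>D OId X))"
proof (cases "ds_dom f' = ds_cod f")
  case True
  have "dc ((f' \<cdot>\<^sub>D f) \<otimes>\<^sub>D OId X) = dc ((f' \<cdot>\<^sub>D f) \<otimes>\<^sub>D (OId X \<cdot>\<^sub>O OId X))"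
    by (rule dc_Act) (simp_all add: O.cls_id_left)
  also have "\<dots> = dc ((f' \<otimes>\<^sub>D OId X) \<cdot>\<^sub>D (f \<otimes>\<^sub>D OId X))"
    by (rule dc_act_cmp) (simp_all add: True)
  finally show ?thesis .
qed (simp add: D.cls_ill)

lemma dc_whisker_left_cmp:
  "dc (DOs (OId X) \<otimes>\<^sub>D (g' \<cdot>\<^sub>O g)) = dc ((DOs (OId X) \<otimes>\<^sub>D g') \<cdot>\<^sub>D (DOs (OId X) \<otimes>\<^sub>D g))"
proof (cases "os_dom g' = os_cod g")
  case True
  have "dc (DOs (OId X) \<otimes>\<^sub>D (g' \<cdot>\<^sub>O g)) = dc ((DOs (OId X) \<cdot>\<^sub>D DOs (OId X)) \<otimes>\<^sub>D (g' \<cdot>\<^sub>O g))"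
    by (rule dc_Act) (simp_all add: D.cls_id_left)
  also have "\<dots> = dc ((DOs (OId X) \<otimes>\<^sub>D g') \<cdot>\<^sub>D (DOs (OId X) \<otimes>\<^sub>D g))"
    by (rule dc_act_cmp) (simp_all add: True)
  finally show ?thesis .
qed (simp add: D.cls_ill)

lemma dc_whisker_id: "dc (DOs (OId X) \<otimes>\<^sub>D OId Y) = dc (DOs (OId (X @ Y)))"
  by (simp add: dc_DOs_act dc_DOs[OF oc_ten_id])

lemma DS_simps:
  "Hom (DS q t \<delta>) = Hom (quotient_lincat DS_terms (ds_eq q t \<delta>))"
  "Idn (DS q t \<delta>) = (\<lambda>X. dc (DOs (OId X)))" "Cmp (DS q t \<delta>) = lift2 (ds_eq q t \<delta>) DCmp"
  "Zer (DS q t \<delta>) = (\<lambda>X Y. dc (DZer X Y))" "Pls (DS q t \<delta>) = lift2 (ds_eq q t \<delta>) DPls"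
  "Scl (DS q t \<delta>) = (\<lambda>a. lift1 (ds_eq q t \<delta>) (DScl a))"
  "ActO (DS q t \<delta>) = (@)"
  "ActF (DS q t \<delta>) = (\<lambda>F X. lift1 (ds_eq q t \<delta>) (\<lambda>f. f \<otimes>\<^sub>D OId X) F)"
  "ActN (DS q t \<delta>) = (\<lambda>X. lift1 (ds_eq q t \<delta>) (\<lambda>g. DOs (OId X) \<otimes>\<^sub>D g))"
  by (auto simp: DS_def lincat.defs modcat.defs quotient_lincat_def)

lemma DS_ActF_cls: "lift1 (ds_eq q t \<delta>) (\<lambda>f. f \<otimes>\<^sub>D OId X) (dc f) = dc (f \<otimes>\<^sub>D OId X)"
  by (rule D.lift1_cls) (rule Act_cong, assumption, simp add: O.E_refl, simp add: D.cls_ill)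

lemma DS_ActN_cls: "lift1 (ds_eq q t \<delta>) (\<lambda>g. DOs (OId X) \<otimes>\<^sub>D g) (oc g) = dc (DOs (OId X) \<otimes>\<^sub>D g)"
  by (rule O.lift1_cls) (rule Act_cong, simp add: D.E_refl, assumption, simp add: D.cls_ill)

lemma in_Hom_DS: "F \<in> Hom (DS q t \<delta>) X Y \<longleftrightarrow> (\<exists>f. ds_wf f \<and> ds_dom f = X \<and> ds_cod f = Y \<and> F = dc f)"
  by (simp add: DS_simps D.in_Hom_quotient)

lemma dc_in_Hom: "ds_wf f \<Longrightarrow> ds_dom f = X \<Longrightarrow> ds_cod f = Y \<Longrightarrow> dc f \<in> Hom (DS q t \<delta>) X Y"
  unfolding in_Hom_DS by blast

lemma Hom_DS_E:
  assumes "F \<in> Hom (DS q t \<delta>) X Y"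
  obtains f where "ds_wf f" "ds_dom f = X" "ds_cod f = Y" "F = dc f"
  using assms unfolding in_Hom_DS by blast

lemma Hom_OS_E:
  assumes "F \<in> Hom (OS q t \<delta>) X Y"
  obtains f where "os_wf f" "os_dom f = X" "os_cod f = Y" "F = oc f"
  using assms unfolding in_Hom_OS by blast

lemma linear_category_DS: "linear_category (DS q t \<delta>)"
  by (rule linear_category_cong[OF D.linear_category_quotient])
    (simp_all add: DS_simps quotient_lincat_def fun_eq_iff)

lemmas DS_ops_cls = D.ops_cls DS_ActF_cls DS_ActN_cls

lemma right_module_DS: "right_module (OS q t \<delta>) (DS q t \<delta>)"
proof -
  interpret strict_monoidal "OS q t \<delta>" by (rule strict_monoidal_OS)
  interpret linear_category "DS q t \<delta>" by (rule linear_category_DS)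
  show ?thesis
  proof (unfold_locales, goal_cases)
    \<comment> \<open>Naturality: both composites equal the class of
      \<open>f \<otimes>\<^sub>D g\<close>.\<close>
    case (7 F A B G X Y)
    then obtain f g where *: "ds_wf f" "ds_dom f = A" "ds_cod f = B" "F = dc f"
      "os_wf g" "os_dom g = X" "os_cod g = Y" "G = oc g"
      unfolding in_Hom_DS in_Hom_OS by blast
    then show ?case
      by (simp add: DS_simps DS_ops_cls)
        (metis dc_split_act dc_split_act')
  next
    case (15 F A B X Y)
    then obtain f where *: "F = dc f"
      unfolding in_Hom_DS in_Hom_OS by blast
    have "dc (f \<otimes>\<^sub>D OId (X @ Y)) = dc (f \<otimes>\<^sub>D (OId X \<otimes>\<^sub>O OId Y))"
      by (rule dc_Act) (simp_all add: oc_ten_id)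
    then show ?case
      by (simp add: * OS_simps DS_simps DS_ops_cls dc_act_act)
  next
    \<comment> \<open>The component at a tensor product is split so that \<open>g\<close> acts
      before \<open>h\<close>.\<close>
    case (16 G X X' H Y Y' A)
    then obtain g h where *: "os_wf g" "os_dom g = X" "os_cod g = X'" "G = oc g"
       "os_wf h" "os_dom h = Y" "os_cod h = Y'" "H = oc h"
      unfolding in_Hom_DS in_Hom_OS by blast
    have "dc (DOs (OId A) \<otimes>\<^sub>D (g \<otimes>\<^sub>O h)) = dc ((DOs (OId A) \<otimes>\<^sub>D g) \<otimes>\<^sub>D h)"
      by (simp add: dc_act_act)
    also have "\<dots> = dc ((DOs (OId (A @ X')) \<otimes>\<^sub>D h) \<cdot>\<^sub>D ((DOs (OId A) \<otimes>\<^sub>D g) \<otimes>\<^sub>D OId Y))"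
      by (rule dc_split_act) (use * in simp_all)
    finally show ?case
      by (simp add: * OS_simps DS_simps DS_ops_cls Ten_cls)
  qed ((elim Hom_DS_E Hom_OS_E)?;
      simp add: OS_simps(2-) DS_simps(2-) DS_ops_cls O.ops_cls Ten_cls dc_whisker_right_cmp
        dc_whisker_left_cmp dc_act_unit dc_whisker_id dc_pls_act dc_act_pls dc_scl_act dc_act_scl dc_in_Hom)+
qed

end

text \<open>Successors are kept in the form \<open>n + 1\<close>, because the relations of B are
  stated with \<open>n + 1\<close> and \<open>n + 2\<close> and have to match after
  simplification.\<close>

lemma length_Cons_plus_1 [simp]: "length (x # xs) = length xs + 1"
  by simp

declare list.size(4) [simp del] One_nat_def [simp del] add_2_eq_Suc [simp del] add_2_eq_Suc' [simp del]

section \<open>Calculations in the iquantum Brauer category\<close>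

lemmas B_terms_lin_ax = lin_ax.intros[where C = B_terms, unfolded B_terms_simps]

lemma br_shift_typing [simp]:
  "br_dom (br_shift k f) = br_dom f + k" "br_cod (br_shift k f) = br_cod f + k"
  "br_wf f \<Longrightarrow> br_wf (br_shift k f)"
  by (induction f) auto

context skein_parameters begin

abbreviation bcmp (infixr "\<odot>" 70) where "F \<odot> G \<equiv> lift2 (br_eq q t \<delta>) BCmp F G"
abbreviation bpls (infixl "\<boxplus>" 65) where "F \<boxplus> G \<equiv> lift2 (br_eq q t \<delta>) BPls F G"
abbreviation bscl (infixr "\<boxdot>" 75) where "a \<boxdot> F \<equiv> lift1 (br_eq q t \<delta>) (BScl a) F"

abbreviation S where "S n i \<equiv> bc (BSig n i)"
abbreviation I where "I n i \<equiv> bc (BInv n i)"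
abbreviation U where "U n \<equiv> bc (BCup n)"
abbreviation A where "A n \<equiv> bc (BCap n)"
abbreviation J where "J n \<equiv> bc (BId n)"

abbreviation z where "z \<equiv> q - uinv q"

lemmas bc_push = B.ops_cls[symmetric]
lemmas b_assoc = B.Cmp_assoc_cls
lemmas b_id = B.Id_left_cls B.Id_right_cls B.Id_left_Cmp_cls B.Id_right_Cmp_cls
lemmas b_scl = B.Scl_Cmp_cls B.Cmp_Scl_cls B.Scl_Scl_cls B.Scl_one_cls B.Scl_one_Cmp_cls
text \<open>Products are normalized to the right; this version of an equation applies to factors
  that are followed by further ones.\<close>

lemmas b_re = B.Cmp_reassoc[unfolded b_assoc]

lemma b_rel: "br_rel q t \<delta> f g \<Longrightarrow> br_wf f \<Longrightarrow> br_wf g \<Longrightarrow> br_dom f = br_dom g \<Longrightarrow> br_cod f = br_cod g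
    \<Longrightarrow> bc f = bc g"
  by (rule B.cls_eq, rule br_eq.br_rel) auto

lemma S_I: "1 \<le> i \<Longrightarrow> i < n \<Longrightarrow> S n i \<odot> I n i = J n"
  unfolding B.ops_cls by (rule b_rel, rule br_rel.intros) auto

lemma I_S: "1 \<le> i \<Longrightarrow> i < n \<Longrightarrow> I n i \<odot> S n i = J n"
  unfolding B.ops_cls by (rule b_rel, rule br_rel.intros) auto

lemmas cancel = b_assoc S_I I_S S_I[THEN b_re] I_S[THEN b_re] b_id

lemma braid: "1 \<le> i \<Longrightarrow> i + 1 < n \<Longrightarrow> S n i \<odot> S n (i+1) \<odot> S n i = S n (i+1) \<odot> S n i \<odot> S n (i+1)"
  unfolding B.ops_cls by (rule b_rel, rule br_rel.intros) auto

lemma far: "i + 1 < j \<or> j + 1 < i \<Longrightarrow> 1 \<le> i \<Longrightarrow> i < n \<Longrightarrow> 1 \<le> j \<Longrightarrow> j < n \<Longrightarrow> S n i \<odot> S n j = S n j \<odot> S n i"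
  unfolding B.ops_cls by (rule b_rel, rule br_rel.intros) auto

lemma skein: "1 \<le> i \<Longrightarrow> i < n \<Longrightarrow> S n i \<boxplus> (- 1) \<boxdot> I n i = z \<boxdot> J n"
  unfolding B.ops_cls by (rule b_rel, rule br_rel.intros) auto

lemma U_S: "1 \<le> i \<Longrightarrow> i < n \<Longrightarrow> U n \<odot> S n i = S (n+2) (i+2) \<odot> U n"
  unfolding B.ops_cls by (rule b_rel, rule br_rel.intros) auto

lemma A_S: "1 \<le> i \<Longrightarrow> i < n \<Longrightarrow> A n \<odot> S (n+2) (i+2) = S n i \<odot> A n"
  unfolding B.ops_cls by (rule b_rel, rule br_rel.intros) auto

lemma A_U: "A n \<odot> U n = \<delta> \<boxdot> J n"
  unfolding B.ops_cls by (rule b_rel, rule br_rel.intros) auto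

lemma A_S1: "A n \<odot> S (n+2) 1 = q \<boxdot> A n"
  unfolding B.ops_cls by (rule b_rel, rule br_rel.intros) auto

lemma S1_U: "S (n+2) 1 \<odot> U n = q \<boxdot> U n"
  unfolding B.ops_cls by (rule b_rel, rule br_rel.intros) auto

lemma A_S2_U: "1 \<le> n \<Longrightarrow> A n \<odot> S (n+2) 2 \<odot> U n = t \<boxdot> J n"
  unfolding B.ops_cls by (rule b_rel, rule br_rel.intros) auto

lemma A_SSII_U: "2 \<le> n \<Longrightarrow>
    A n \<odot> S (n+2) 2 \<odot> S (n+2) 3 \<odot> I (n+2) 1 \<odot> I (n+2) 2 \<odot> U n = U (n-2) \<odot> A (n-2)"
  unfolding B.ops_cls by (rule b_rel, rule br_rel.intros) auto

lemma A_A_IISS: "A n \<odot> A (n+2) \<odot> I (n+4) 2 \<odot> I (n+4) 3 \<odot> S (n+4) 1 \<odot> S (n+4) 2 = A n \<odot> A (n+2)"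
  unfolding B.ops_cls by (rule b_rel, rule br_rel.intros) auto

lemma IISS_U_U: "I (n+4) 2 \<odot> I (n+4) 1 \<odot> S (n+4) 3 \<odot> S (n+4) 2 \<odot> U (n+2) \<odot> U n = U (n+2) \<odot> U n"
  unfolding B.ops_cls by (rule b_rel, rule br_rel.intros) auto

text \<open>Insert an inverse pair, commute by \<open>far\<close>, and cancel; the version with two
  inverses uses the mixed one.\<close>

lemma far_inv:
  assumes "i + 1 < j \<or> j + 1 < i" "1 \<le> i" "i < n" "1 \<le> j" "j < n"
  shows "S n i \<odot> I n j = I n j \<odot> S n i" "I n i \<odot> S n j = S n j \<odot> I n i" "I n i \<odot> I n j = I n j \<odot> I n i"
proof -
  have 1: "S n i \<odot> I n j = I n j \<odot> S n i" if "i + 1 < j \<or> j + 1 < i" "1 \<le> i" "i < n" "1 \<le> j" "j < n" for i j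
  proof -
    have "S n i \<odot> I n j = I n j \<odot> S n j \<odot> S n i \<odot> I n j" using that by (simp add: cancel)
    also have "\<dots> = I n j \<odot> S n i \<odot> S n j \<odot> I n j" using that by (simp add: b_assoc far[of i j, symmetric, THEN b_re])
    finally show ?thesis using that by (simp add: cancel)
  qed
  show "S n i \<odot> I n j = I n j \<odot> S n i" "I n i \<odot> S n j = S n j \<odot> I n i"
    using 1[of i j] 1[of j i] assms by metis+
  have "I n i \<odot> I n j = I n i \<odot> I n j \<odot> S n i \<odot> I n i" using assms by (simp add: cancel)
  also have "\<dots> = I n i \<odot> S n i \<odot> I n j \<odot> I n i" using assms by (simp add: b_assoc 1[of i j, symmetric, THEN b_re])
  finally show "I n i \<odot> I n j = I n j \<odot> I n i" using assms by (simp add: cancel)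
qed

text \<open>Each version arises by inserting inverse pairs until a positive braid word appears, to
  which \<open>braid\<close> is applied once.\<close>

lemma braid_mixed:
  assumes "1 \<le> i" "i + 1 < n"
  shows "S n i \<odot> I n (i+1) \<odot> I n i = I n (i+1) \<odot> I n i \<odot> S n (i+1)"
    and "S n i \<odot> S n (i+1) \<odot> I n i = I n (i+1) \<odot> S n i \<odot> S n (i+1)"
    and "S n (i+1) \<odot> S n i \<odot> I n (i+1) = I n i \<odot> S n (i+1) \<odot> S n i"
    and "I n i \<odot> I n (i+1) \<odot> S n i = S n (i+1) \<odot> I n i \<odot> I n (i+1)"
proof -
  have "S n i \<odot> I n (i+1) \<odot> I n i = I n (i+1) \<odot> I n i \<odot> (S n i \<odot> S n (i+1) \<odot> S n i) \<odot> I n (i+1) \<odot> I n i"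
    using assms by (simp add: cancel)
  also have "\<dots> = I n (i+1) \<odot> I n i \<odot> S n (i+1)"
    using assms by (simp only: braid) (simp add: cancel)
  finally show "S n i \<odot> I n (i+1) \<odot> I n i = I n (i+1) \<odot> I n i \<odot> S n (i+1)" .
  have "S n i \<odot> S n (i+1) \<odot> I n i = I n (i+1) \<odot> (S n (i+1) \<odot> S n i \<odot> S n (i+1)) \<odot> I n i"
    using assms by (simp add: cancel)
  also have "\<dots> = I n (i+1) \<odot> S n i \<odot> S n (i+1)"
    using assms by (simp only: braid[symmetric]) (simp add: cancel)
  finally show "S n i \<odot> S n (i+1) \<odot> I n i = I n (i+1) \<odot> S n i \<odot> S n (i+1)" .
  have "S n (i+1) \<odot> S n i \<odot> I n (i+1) = I n i \<odot> (S n i \<odot> S n (i+1) \<odot> S n i) \<odot> I n (i+1)"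
    using assms by (simp add: cancel)
  also have "\<dots> = I n i \<odot> S n (i+1) \<odot> S n i"
    using assms by (simp only: braid) (simp add: cancel)
  finally show "S n (i+1) \<odot> S n i \<odot> I n (i+1) = I n i \<odot> S n (i+1) \<odot> S n i" .
  have "I n i \<odot> I n (i+1) \<odot> S n i = I n i \<odot> I n (i+1) \<odot> (S n i \<odot> S n (i+1) \<odot> S n i) \<odot> I n i \<odot> I n (i+1)"
    using assms by (simp add: cancel)
  also have "\<dots> = S n (i+1) \<odot> I n i \<odot> I n (i+1)"
    using assms by (simp only: braid) (simp add: cancel)
  finally show "I n i \<odot> I n (i+1) \<odot> S n i = S n (i+1) \<odot> I n i \<odot> I n (i+1)" .
qed

lemma U_I: "1 \<le> i \<Longrightarrow> i < n \<Longrightarrow> U n \<odot> I n i = I (n+2) (i+2) \<odot> U n"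
proof -
  assume i: "1 \<le> i" "i < n"
  have "U n \<odot> I n i = I (n+2) (i+2) \<odot> S (n+2) (i+2) \<odot> U n \<odot> I n i" using i by (simp add: cancel)
  also have "\<dots> = I (n+2) (i+2) \<odot> U n \<odot> S n i \<odot> I n i" using i U_S[symmetric, THEN b_re] by (simp add: b_assoc)
  finally show ?thesis using i by (simp add: cancel)
qed

lemma A_I: "1 \<le> i \<Longrightarrow> i < n \<Longrightarrow> A n \<odot> I (n+2) (i+2) = I n i \<odot> A n"
proof -
  assume i: "1 \<le> i" "i < n"
  have "A n \<odot> I (n+2) (i+2) = I n i \<odot> S n i \<odot> A n \<odot> I (n+2) (i+2)" using i by (simp add: cancel)
  also have "\<dots> = I n i \<odot> A n \<odot> S (n+2) (i+2) \<odot> I (n+2) (i+2)" using i A_S[symmetric, THEN b_re] by (simp add: b_assoc)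
  finally show ?thesis using i by (simp add: cancel)
qed

lemma A_I1: "A n \<odot> I (n+2) 1 = uinv q \<boxdot> A n"
proof -
  have "uinv q \<boxdot> A n = uinv q \<boxdot> (A n \<odot> S (n+2) 1) \<odot> I (n+2) 1" by (simp add: cancel b_scl)
  also have "\<dots> = A n \<odot> I (n+2) 1" unfolding A_S1 by (simp add: b_scl)
  finally show ?thesis ..
qed

lemma I1_U: "I (n+2) 1 \<odot> U n = uinv q \<boxdot> U n"
proof -
  have "uinv q \<boxdot> U n = uinv q \<boxdot> I (n+2) 1 \<odot> (S (n+2) 1 \<odot> U n)" by (simp add: cancel b_scl)
  also have "\<dots> = I (n+2) 1 \<odot> U n" unfolding S1_U by (simp add: b_scl)
  finally show ?thesis ..
qed

lemma I_skein: "1 \<le> i \<Longrightarrow> i < n \<Longrightarrow> I n i = S n i \<boxplus> (- z) \<boxdot> J n"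
proof -
  assume i: "1 \<le> i" "i < n"
  have "S n i \<boxplus> (- z) \<boxdot> J n = S n i \<boxplus> (- 1) \<boxdot> (z \<boxdot> J n)" by (simp add: b_scl)
  also have "\<dots> = S n i \<boxplus> (- 1) \<boxdot> (S n i \<boxplus> (- 1) \<boxdot> I n i)" using skein[OF i] by simp
  also have "\<dots> = (1 \<boxdot> S n i \<boxplus> (- 1) \<boxdot> S n i) \<boxplus> I n i"
    by (simp add: B.Scl_Pls_cls B.is_cls_intros b_scl B.Pls_assoc_cls)
  also have "\<dots> = I n i"
    unfolding B.Pls_Scl_Scl_cls[OF B.is_cls_cls] using i
    by (simp add: B.Scl_zero_cls B.Pls_commute_cls B.is_cls_intros B.Pls_zero_cls)
  finally show ?thesis ..
qed

lemma A_I2_U: "1 \<le> n \<Longrightarrow> A n \<odot> I (n+2) 2 \<odot> U n = uinv t \<boxdot> J n"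
proof -
  assume n: "1 \<le> n"
  \<comment> \<open>The equation imposed on \<open>\<delta>\<close>: it makes the negative kink the
    inverse of the positive kink \<open>t\<close>.\<close>
  have *: "t + - z * \<delta> = uinv t" using delta by (simp add: algebra_simps)
  have "A n \<odot> I (n+2) 2 \<odot> U n = A n \<odot> S (n+2) 2 \<odot> U n \<boxplus> (- z) \<boxdot> (A n \<odot> U n)"
    using n by (simp add: I_skein B.Pls_Cmp_cls B.Cmp_Pls_cls B.is_cls_intros b_scl b_id)
  also have "\<dots> = (t + - z * \<delta>) \<boxdot> J n"
    using n by (simp add: A_S2_U A_U b_scl B.Pls_Scl_Scl_cls[OF B.is_cls_cls])
  finally show ?thesis unfolding * .
qed

text \<open>The crossings \<open>1\<close> and \<open>3\<close> between a cup and a cap can be exchanged: by the skein relation the two sides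
  differ by a multiple of \<open>A \<sigma>\<^sub>2 (\<sigma>\<^sub>3 - \<sigma>\<^sub>1) \<sigma>\<^sub>2\<^sup>-\<^sup>1 U\<close>, and both terms of this difference are equal to t.\<close>

lemma A_SSI_U:
  assumes "2 \<le> n"
  shows "A n \<odot> S (n+2) 2 \<odot> S (n+2) 1 \<odot> I (n+2) 2 \<odot> U n = t \<boxdot> J n"
    and "A n \<odot> S (n+2) 2 \<odot> S (n+2) 3 \<odot> I (n+2) 2 \<odot> U n = t \<boxdot> J n"
proof -
  have "A n \<odot> S (n+2) 2 \<odot> S (n+2) 1 \<odot> I (n+2) 2 \<odot> U n
      = (A n \<odot> I (n+2) 1) \<odot> S (n+2) 2 \<odot> (S (n+2) 1 \<odot> U n)"
    using assms braid_mixed(3)[of 1 "n+2", THEN b_re] by (simp add: b_assoc)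
  also have "\<dots> = t \<boxdot> J n"
    unfolding A_I1 S1_U using assms by (simp add: b_scl A_S2_U)
  finally show "A n \<odot> S (n+2) 2 \<odot> S (n+2) 1 \<odot> I (n+2) 2 \<odot> U n = t \<boxdot> J n" .
  have "A n \<odot> S (n+2) 2 \<odot> S (n+2) 3 \<odot> I (n+2) 2 \<odot> U n
      = (A n \<odot> I (n+2) (1+2)) \<odot> S (n+2) 2 \<odot> (S (n+2) (1+2) \<odot> U n)"
    using assms braid_mixed(2)[of 2 "n+2", THEN b_re] by (simp add: b_assoc)
  also have "\<dots> = I n 1 \<odot> (A n \<odot> S (n+2) 2 \<odot> U n) \<odot> S n 1"
    using assms A_I[of 1 n] U_S[of 1 n] by (simp add: b_assoc)
  also have "\<dots> = t \<boxdot> J n"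
    using assms by (simp add: A_S2_U b_scl cancel)
  finally show "A n \<odot> S (n+2) 2 \<odot> S (n+2) 3 \<odot> I (n+2) 2 \<odot> U n = t \<boxdot> J n" .
qed

text \<open>The variant met when \<open>c'\<close> is moved past a cap: the inverse sits on crossing
  3 instead of 1. Both sides are expanded by \<open>I_skein\<close>; the main terms agree since
  crossings 1 and 3 commute, the corrections by \<open>A_SSI_U\<close>.\<close>

lemma A_SSII_U':
  assumes "2 \<le> n"
  shows "A n \<odot> S (n+2) 2 \<odot> S (n+2) 1 \<odot> I (n+2) 3 \<odot> I (n+2) 2 \<odot> U n = U (n-2) \<odot> A (n-2)"
proof -
  let ?S = "S (n+2)" and ?I = "I (n+2)"
  let ?L = "A n \<odot> ?S 2 \<odot> ?S 1 \<odot> ?S 3 \<odot> ?I 2 \<odot> U n"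
  have 1: "A n \<odot> ?S 2 \<odot> ?S 1 \<odot> ?I 3 \<odot> ?I 2 \<odot> U n
      = ?L \<boxplus> (- z) \<boxdot> (A n \<odot> ?S 2 \<odot> ?S 1 \<odot> ?I 2 \<odot> U n)"
    using assms by (simp add: I_skein[of 3] B.Pls_Cmp_cls B.Cmp_Pls_cls B.is_cls_intros b_scl b_id)
  have 2: "A n \<odot> ?S 2 \<odot> ?S 3 \<odot> ?I 1 \<odot> ?I 2 \<odot> U n
      = A n \<odot> ?S 2 \<odot> ?S 3 \<odot> ?S 1 \<odot> ?I 2 \<odot> U n \<boxplus> (- z) \<boxdot> (A n \<odot> ?S 2 \<odot> ?S 3 \<odot> ?I 2 \<odot> U n)"
    using assms by (simp add: I_skein[of 1] B.Pls_Cmp_cls B.Cmp_Pls_cls B.is_cls_intros b_scl b_id)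
  have 3: "?S 1 \<odot> ?S 3 = ?S 3 \<odot> ?S 1"
    using assms by (intro far) auto
  show ?thesis
    using 1 2 A_SSI_U[OF assms] A_SSII_U[OF assms] 3[THEN b_re] by (simp add: b_assoc)
qed

section \<open>The action on the iquantum Brauer category\<close>

lemma br_shift_shift [simp]: "br_shift k (br_shift l f) = br_shift (l + k) f"
  by (induction f) (auto simp: add.assoc)

lemma br_shift_0 [simp]: "br_shift 0 f = f"
  by (induction f) auto

lemma lin_ax_br_shift: "lin_ax B_terms f g \<Longrightarrow> lin_ax B_terms (br_shift k f) (br_shift k g)"
  for f g :: "'k br"
  by (induction rule: lin_ax.induct) (simp, (rule B_terms_lin_ax; force))+

lemma nat_induct_plus_1 [case_names 0 Suc]: "P 0 \<Longrightarrow> (\<And>n. P n \<Longrightarrow> P (n + 1)) \<Longrightarrow> P (n :: nat)"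
  unfolding Suc_eq_plus1[symmetric] by (induction n) auto

lemma add_numerals:
  "n + 1 + 1 = n + 2" "n + 1 + 2 = n + 3" "n + 1 + 3 = n + 4" "n + 1 + 4 = n + 5"
  "n + 2 + 1 = n + 3" "n + 2 + 2 = n + 4" "n + 2 + 3 = n + 5" "n + 3 + 1 = n + 4" "n + 3 + 2 = n + 5"
  for n :: nat
  by simp_all

lemma shift_numeral: "n + numeral w + k = n + k + numeral w" for n k :: nat
  by simp

lemma br_rel_shift: "br_rel q t \<delta> f g \<Longrightarrow> br_rel q t \<delta> (br_shift k f) (br_shift k g)"
proof (induction rule: br_rel.induct)
  \<comment> \<open>The subtraction in \<open>n - 2\<close> is truncated and commutes with adding
    \<open>k\<close> because \<open>n \<ge> 2\<close>.\<close>
  case (12 n)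
  then show ?case using br_rel.intros(12)[of "n+k"] by (simp add: add_ac)
qed (simp add: shift_numeral; rule br_rel.intros; simp)+

lemma br_eq_shift: "br_eq q t \<delta> f g \<Longrightarrow> br_eq q t \<delta> (br_shift k f) (br_shift k g)"
proof (induction rule: br_eq.induct)
  case (br_refl f m n)
  then show ?case by (intro br_eq.br_refl) auto
next
  case (br_trans f g h)
  then show ?case by (blast intro: br_eq.br_trans)
next
  case (br_lin f g)
  then show ?case by (intro br_eq.br_lin lin_ax_br_shift)
next
  case (br_rel f g m n)
  then show ?case by (intro br_eq.br_rel[of _ _ _ _ _ "m + k" "n + k"] br_rel_shift) auto
qed (auto intro: br_eq.intros)

lemma bc_shift: "bc f = bc g \<Longrightarrow> br_wf f \<Longrightarrow> bc (br_shift k f) = bc (br_shift k g)"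
  by (rule B.cls_eq, rule br_eq_shift, rule B.cls_eqD)

lemma sigs_simps [simp]:
  "sigs n [] = BId n" "sigs n (i # is) = BSig n i \<cdot>\<^sub>B sigs n is"
  "invs n [] = BId n" "invs n (i # is) = BInv n i \<cdot>\<^sub>B invs n is"
  by (simp_all add: sigs_def invs_def)

lemma sigs_dom_cod [simp]:
  "br_dom (sigs n is) = n" "br_cod (sigs n is) = n" "br_dom (invs n is) = n" "br_cod (invs n is) = n"
  by (induction "is") auto

lemma sigs_wf [simp]:
  "br_wf (sigs n is) \<longleftrightarrow> (\<forall>i\<in>set is. 1 \<le> i \<and> i < n)" "br_wf (invs n is) \<longleftrightarrow> (\<forall>i\<in>set is. 1 \<le> i \<and> i < n)"
  by (induction "is") auto

lemma sigs_shift [simp]: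
  "br_shift k (sigs n is) = sigs (n + k) is" "br_shift k (invs n is) = invs (n + k) is"
  by (induction "is") auto

lemma br_act_dom [simp]: "br_dom (br_act q t r g) = r + length (os_dom g)"
  by (induction g arbitrary: r) auto

lemma br_act_cod [simp]: "br_cod (br_act q t r g) = r + length (os_cod g)"
  by (induction g arbitrary: r) auto

lemma br_act_wf [simp]: "os_wf g \<Longrightarrow> br_wf (br_act q t r g)"
  by (induction g arbitrary: r) auto

lemma shift_cmp_eq:
  assumes "bc a \<odot> bc b = bc c \<odot> bc d" "br_wf a" "br_wf b" "br_dom a = br_cod b"
  shows "bc (br_shift k a) \<odot> bc (br_shift k b) = bc (br_shift k c) \<odot> bc (br_shift k d)"
  using bc_shift[of "a \<cdot>\<^sub>B b" "c \<cdot>\<^sub>B d" k] assms by (simp add: B.ops_cls)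

lemma sigs_append:
  "bc (sigs n (is @ js)) = bc (sigs n is) \<odot> bc (sigs n js)"
  "bc (invs n (is @ js)) = bc (invs n is) \<odot> bc (invs n js)"
  by (induction "is") (simp_all add: bc_push b_id b_assoc)

lemma S_sigs_commute:
  assumes "1 \<le> j" "j < n" "\<forall>i\<in>set is. 1 \<le> i \<and> i + 1 < j"
  shows "S n j \<odot> bc (sigs n is) = bc (sigs n is) \<odot> S n j" "I n j \<odot> bc (sigs n is) = bc (sigs n is) \<odot> I n j"
    "S n j \<odot> bc (invs n is) = bc (invs n is) \<odot> S n j" "I n j \<odot> bc (invs n is) = bc (invs n is) \<odot> I n j"
  using assms(3)
  by (induction "is")
    (use assms(1,2) in \<open>simp_all add: bc_push b_id b_assoc far[THEN b_re] far_inv[THEN b_re]\<close>)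

lemma upt_plus_1: "i \<le> j \<Longrightarrow> [i..<j+1] = [i..<j] @ [j]"
  unfolding Suc_eq_plus1[symmetric] by (rule upt_Suc_append)

text \<open>\<open>k\<close> counts strands added on the right. It has to vary: the recursion in
  \<open>r\<close> turns the last of \<open>r + 1\<close> strands on the left into one of those on
  the right.\<close>

definition cc where "cc k r = bc (br_shift k (br_act q t r Oc))"
definition cc' where "cc' k r = bc (br_shift k (br_act q t r Oc'))"
definition dd where "dd k r = bc (br_shift k (br_act q t r Od))"
definition dd' where "dd' k r = bc (br_shift k (br_act q t r Od'))"

lemma upt_range: "rev [1..<r+1+1] = (r+1) # rev [1..<r+1]" "rev [2..<r+1+2] = (r+2) # rev [2..<r+2]"
  "[1..<r+1+1] = [1..<r+1] @ [r+1]" "[2..<r+1+2] = [2..<r+2] @ [r+2]"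
  using upt_plus_1[of 1 "r+1"] upt_plus_1[of 2 "r+2"] by (simp_all add: add_ac)

text \<open>The new factor of index \<open>r + 2\<close> commutes with the inverses of index at most
  \<open>r\<close>, so the two new factors come to stand together. They are the half braiding across
  the word down-up.\<close>

lemma cc_step: "cc k (r+1) = I (r+3+k) (r+1) \<odot> S (r+3+k) (r+2) \<odot> cc (k+1) r"
  unfolding cc_def br_act.simps br_shift.simps bc_push sigs_shift upt_range sigs_simps
  using S_sigs_commute(3)[of "r+2" "r+3+k" "rev [1..<r+1]", symmetric, THEN b_re]
  by (simp add: bc_push b_assoc add_ac)

lemma cc'_step: "cc' k (r+1) = S (r+3+k) (r+1) \<odot> I (r+3+k) (r+2) \<odot> cc' (k+1) r"
  unfolding cc'_def br_act.simps br_shift.simps bc_push sigs_shift upt_range sigs_simps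
  using S_sigs_commute(2)[of "r+2" "r+3+k" "rev [1..<r+1]", symmetric, THEN b_re]
  by (simp add: bc_push b_assoc b_scl add_ac)

lemma dd_step: "dd k (r+1) = dd (k+1) r \<odot> S (r+3+k) (r+2) \<odot> I (r+3+k) (r+1)"
  unfolding dd_def br_act.simps br_shift.simps bc_push sigs_shift upt_range sigs_append sigs_simps
  using S_sigs_commute(3)[of "r+2" "r+3+k" "[1..<r+1]", THEN b_re]
  by (simp add: bc_push b_assoc b_scl b_id add_ac)

lemma dd'_step: "dd' k (r+1) = dd' (k+1) r \<odot> I (r+3+k) (r+2) \<odot> S (r+3+k) (r+1)"
  unfolding dd'_def br_act.simps br_shift.simps bc_push sigs_shift upt_range sigs_append sigs_simps
  using S_sigs_commute(2)[of "r+2" "r+3+k" "[1..<r+1]", THEN b_re]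
  by (simp add: bc_push b_assoc b_scl b_id add_ac)

lemma at_0:
  "cc k 0 = U k" "cc' k 0 = (uinv q * t) \<boxdot> U k" "dd k 0 = (q * uinv t) \<boxdot> A k" "dd' k 0 = A k"
  by (simp_all add: cc_def cc'_def dd_def dd'_def bc_push b_id)

lemma braid_act:
  "S (r+3+k) (r+1) \<odot> S (r+3+k) (r+2) \<odot> S (r+3+k) (r+1) = S (r+3+k) (r+2) \<odot> S (r+3+k) (r+1) \<odot> S (r+3+k) (r+2)"
  "S (r+3+k) (r+1) \<odot> I (r+3+k) (r+2) \<odot> I (r+3+k) (r+1) = I (r+3+k) (r+2) \<odot> I (r+3+k) (r+1) \<odot> S (r+3+k) (r+2)"
  "I (r+3+k) (r+1) \<odot> I (r+3+k) (r+2) \<odot> S (r+3+k) (r+1) = S (r+3+k) (r+2) \<odot> I (r+3+k) (r+1) \<odot> I (r+3+k) (r+2)"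
  using braid[of "r+1" "r+3+k"] braid_mixed(1,4)[of "r+1" "r+3+k"] by (simp_all add: add.assoc)

text \<open>In B both orientations act by one more strand, so \<open>c\<close> and \<open>c'\<close>
  become comparable. For \<open>r = 0\<close> the scalar \<open>uinv q * t\<close> is
  \<open>t\<close> times the \<open>uinv q\<close> from untwisting the cup; the step is a mixed
  braid relation. With \<open>dd'_dd\<close> this halves the work on naturality.\<close>

lemma cc'_cc: "cc' k r = t \<boxdot> I (r+2+k) (r+1) \<odot> cc k r"
proof (induction r arbitrary: k rule: nat_induct_plus_1)
  case 0
  show ?case using I1_U[of k] by (simp add: at_0 b_scl add_ac mult_ac)
next
  case (Suc r)
  have "cc' k (r+1) = t \<boxdot> S (r+3+k) (r+1) \<odot> I (r+3+k) (r+2) \<odot> I (r+3+k) (r+1) \<odot> cc (k+1) r"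
    unfolding cc'_step Suc by (simp add: b_scl b_assoc add_ac)
  also have "\<dots> = t \<boxdot> I (r+3+k) (r+2) \<odot> cc k (r+1)"
    unfolding cc_step using braid_act(2)[THEN b_re] by (simp add: b_scl b_assoc)
  finally show ?case by (simp only: add_numerals)
qed

lemma dd'_dd: "dd' k r = t \<boxdot> dd k r \<odot> I (r+2+k) (r+1)"
proof (induction r arbitrary: k rule: nat_induct_plus_1)
  case 0
  show ?case using A_I1[of k] by (simp add: at_0 b_scl add_ac mult_ac)
next
  case (Suc r)
  have "dd' k (r+1) = t \<boxdot> dd (k+1) r \<odot> I (r+3+k) (r+1) \<odot> I (r+3+k) (r+2) \<odot> S (r+3+k) (r+1)"
    unfolding dd'_step Suc by (simp add: b_scl b_assoc add_ac)
  also have "\<dots> = t \<boxdot> dd k (r+1) \<odot> I (r+3+k) (r+2)"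
    unfolding dd_step using braid_act(3) by (simp add: b_scl b_assoc)
  finally show ?case by (simp only: add_numerals)
qed

section \<open>Naturality of the action in the morphisms of B\<close>

definition natural_at :: "'k os \<Rightarrow> 'k br \<Rightarrow> bool"
  where "natural_at g m \<longleftrightarrow> bc (br_act q t (br_cod m) g) \<odot> bc (br_shift (length (os_dom g)) m)
    = bc (br_shift (length (os_cod g)) m) \<odot> bc (br_act q t (br_dom m) g)"

text \<open>Naturality squares can be pasted, added and scaled, and the square for an inverse
  crossing is the inverted square of the crossing. Hence only crossings, cups and caps
  remain.\<close>

lemma natural_at_br:
  assumes "os_wf g" and sig: "\<And>n i. 1 \<le> i \<Longrightarrow> i < n \<Longrightarrow> natural_at g (BSig n i)"
    and cup: "\<And>n. natural_at g (BCup n)" and cap: "\<And>n. natural_at g (BCap n)"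
  shows "br_wf m \<Longrightarrow> natural_at g m"
proof (induction m)
  case (BId n)
  show ?case by (simp add: natural_at_def b_id)
next
  case (BInv n i)
  let ?a = "length (os_dom g)" and ?b = "length (os_cod g)" and ?g = "bc (br_act q t n g)"
  have "?g \<odot> I (n + ?a) i = I (n + ?b) i \<odot> (S (n + ?b) i \<odot> ?g) \<odot> I (n + ?a) i"
    using BInv by (simp add: cancel)
  also have "\<dots> = I (n + ?b) i \<odot> (?g \<odot> S (n + ?a) i) \<odot> I (n + ?a) i"
    using sig[of i n] BInv by (simp add: natural_at_def)
  also have "\<dots> = I (n + ?b) i \<odot> ?g"
    using BInv by (simp add: cancel)
  finally show ?case by (simp add: natural_at_def)
next
  case (BCmp f h)
  then have f: "natural_at g f" and h: "natural_at g h" and e: "br_dom f = br_cod h" by auto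
  show ?case
    unfolding natural_at_def br_shift.simps bc_push br_cod.simps br_dom.simps
    using f[unfolded natural_at_def, THEN b_re] h[unfolded natural_at_def] e by (simp add: b_assoc)
next
  case (BZer m n)
  show ?case using assms(1) by (simp add: natural_at_def B.Cmp_Zer_cls B.Zer_Cmp_cls)
next
  case (BPls f h)
  then show ?case by (simp add: natural_at_def bc_push B.Cmp_Pls_cls B.Pls_Cmp_cls B.is_cls_intros)
next
  case (BScl a f)
  then show ?case by (simp add: natural_at_def bc_push b_scl)
qed (use cup cap sig in auto)

lemma natural_at_X:
  assumes "br_wf m"
  shows "natural_at OXp m" "natural_at OXm m"
proof -
  have S: "natural_at OXp (BSig n i)" "natural_at OXm (BSig n i)" if "1 \<le> i" "i < n" for n i
    unfolding natural_at_def using that by (simp_all, intro far, simp_all) (intro far_inv(2), simp_all)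
  have U: "natural_at OXp (BCup n)" "natural_at OXm (BCup n)" for n
    using U_S[of "n+1" "n+2"] U_I[of "n+1" "n+2"] by (simp_all add: natural_at_def add_numerals)
  have A: "natural_at OXp (BCap n)" "natural_at OXm (BCap n)" for n
    using A_S[of "n+1" "n+2"] A_I[of "n+1" "n+2"] by (simp_all add: natural_at_def add_numerals)
  show "natural_at OXp m" "natural_at OXm m"
    by (rule natural_at_br[OF _ _ _ _ assms]; simp add: S U A)+
qed

lemma add_k:
  "n + (k + 1) = n + 1 + k" "n + 2 + (k + 1) = n + 3 + k" "n + 3 + (k + 1) = n + 4 + k" "n + 4 + (k + 1) = n + 5 + k" 
  "n + 1 + (k + 1) = n + 2 + k" "n + 1 + (k + 2) = n + 3 + k"
  "n + (k + 2) = n + 2 + k" "n + 2 + (k + 2) = n + 4 + k" "n + (2 + k) = n + 2 + k" "n + 2 + (2 + k) = n + 4 + k"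
  "n + 1 + (2 + k) = n + 3 + k" "n + 3 + k + 2 = n + 5 + k" "n + 2 + k + 2 = n + 4 + k"
  for n k :: nat
  by simp_all

lemmas nums = add_numerals add_k

lemma X_natural:
  assumes "br_wf m"
  shows "S (br_cod m + 2 + k) (br_cod m + 1) \<odot> bc (br_shift (k + 2) m) = bc (br_shift (k + 2) m) \<odot> S (br_dom m + 2 + k) (br_dom m + 1)"
    "I (br_cod m + 2 + k) (br_cod m + 1) \<odot> bc (br_shift (k + 2) m) = bc (br_shift (k + 2) m) \<odot> I (br_dom m + 2 + k) (br_dom m + 1)"
  using shift_cmp_eq[OF natural_at_X(1)[OF assms, unfolded natural_at_def], of k]
    shift_cmp_eq[OF natural_at_X(2)[OF assms, unfolded natural_at_def], of k] assms
  by (simp_all add: add.commute[of 2 k])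

lemma X_cc:
  "S (r + 4 + k) (r + 3) \<odot> cc (k + 2) r = cc (k + 2) r \<odot> S (r + 2 + k) (r + 1)"
  "I (r + 4 + k) (r + 3) \<odot> cc (k + 2) r = cc (k + 2) r \<odot> I (r + 2 + k) (r + 1)"
  using X_natural[of "br_act q t r Oc" k] by (simp_all add: cc_def nums)

lemma X_dd:
  "dd (k + 2) r \<odot> S (r + 4 + k) (r + 3) = S (r + 2 + k) (r + 1) \<odot> dd (k + 2) r"
  "dd (k + 2) r \<odot> I (r + 4 + k) (r + 3) = I (r + 2 + k) (r + 1) \<odot> dd (k + 2) r"
  using X_natural[of "br_act q t r Od" k] by (simp_all add: dd_def nums)

text \<open>The rightmost strand is peeled off; crossings that do not involve it commute with the
  factors from \<open>cc_step\<close>. The last crossing involves the last two strands, so both are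
  peeled off, and braid relations carry it across.\<close>

lemma S_cc: "1 \<le> i \<Longrightarrow> i < n \<Longrightarrow> cc k n \<odot> S (n + k) i = S (n + 2 + k) i \<odot> cc k n"
proof (induction n arbitrary: k rule: nat_induct_plus_1)
  case (Suc n)
  show ?case
  proof (cases "i < n")
    case True
    have "cc k (n+1) \<odot> S (n + 1 + k) i = I (n + 3 + k) (n + 1) \<odot> S (n + 3 + k) (n + 2) \<odot> S (n + 3 + k) i \<odot> cc (k + 1) n"
      unfolding cc_step using Suc.IH[of "k + 1"] True Suc.prems by (simp add: b_assoc nums)
    also have "\<dots> = S (n + 3 + k) i \<odot> cc k (n+1)"
      using True Suc.prems far[of i "n+2" "n+3+k", THEN b_re] far_inv(1)[of i "n+1" "n+3+k", THEN b_re]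
      by (simp add: cc_step b_assoc)
    finally show ?thesis by (simp add: nums)
  next
    case False
    then obtain p where p: "n = p + 1" "i = p + 1"
      using Suc.prems by (metis add.commute le_add_diff_inverse less_add_one linorder_neqE_nat not_less_eq Suc_eq_plus1)
    let ?S = "S (p+4+k)" and ?I = "I (p+4+k)"
    have "cc k (p+1+1) \<odot> S (p + 1 + 1 + k) (p+1)
      = ?I (p+2) \<odot> ?S (p+3) \<odot> ?I (p+1) \<odot> ?S (p+2) \<odot> cc (k+2) p \<odot> S (p + 2 + k) (p+1)"
      unfolding cc_step by (simp add: b_assoc nums)
    also have "\<dots> = ?I (p+2) \<odot> ?S (p+3) \<odot> ?I (p+1) \<odot> ?S (p+2) \<odot> ?S (p+3) \<odot> cc (k+2) p"
      by (simp only: X_cc)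
    also have "\<dots> = ?I (p+2) \<odot> ?I (p+1) \<odot> ?S (p+3) \<odot> ?S (p+2) \<odot> ?S (p+3) \<odot> cc (k+2) p"
      using far_inv(1)[of "p+3" "p+1" "p+4+k", THEN b_re] by (simp add: b_assoc)
    also have "\<dots> = ?I (p+2) \<odot> ?I (p+1) \<odot> ?S (p+2) \<odot> ?S (p+3) \<odot> ?S (p+2) \<odot> cc (k+2) p"
      using braid_act(1)[of "p+1" k, THEN b_re] by (simp add: b_assoc nums)
    also have "\<dots> = ?S (p+1) \<odot> ?I (p+2) \<odot> ?I (p+1) \<odot> ?S (p+3) \<odot> ?S (p+2) \<odot> cc (k+2) p"
      using braid_act(2)[of p "k+1", THEN b_re] by (simp add: b_assoc nums)
    also have "\<dots> = ?S (p+1) \<odot> cc k (p+1+1)"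
      unfolding cc_step using far_inv(1)[of "p+3" "p+1" "p+4+k", THEN b_re] by (simp add: b_assoc nums)
    finally show ?thesis by (simp add: p nums)
  qed
qed simp

text \<open>The mirror image of \<open>S_cc\<close>, with the order of composition reversed.\<close>

lemma S_dd: "1 \<le> i \<Longrightarrow> i < n \<Longrightarrow> dd k n \<odot> S (n + 2 + k) i = S (n + k) i \<odot> dd k n"
proof (induction n arbitrary: k rule: nat_induct_plus_1)
  case (Suc n)
  show ?case
  proof (cases "i < n")
    case True
    have "dd k (n+1) \<odot> S (n + 3 + k) i = (dd (k + 1) n \<odot> S (n + 3 + k) i) \<odot> S (n + 3 + k) (n + 2) \<odot> I (n + 3 + k) (n + 1)"
      using True Suc.prems far[of i "n+2" "n+3+k", THEN b_re] far_inv(1)[of i "n+1" "n+3+k"]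
      by (simp add: dd_step b_assoc)
    also have "\<dots> = S (n + 1 + k) i \<odot> dd k (n+1)"
      unfolding dd_step using Suc.IH[of "k + 1"] True Suc.prems by (simp add: b_assoc nums)
    finally show ?thesis by (simp add: nums)
  next
    case False
    then obtain p where p: "n = p + 1" "i = p + 1"
      using Suc.prems by (metis add.commute le_add_diff_inverse less_add_one linorder_neqE_nat not_less_eq Suc_eq_plus1)
    let ?S = "S (p+4+k)" and ?I = "I (p+4+k)"
    have "dd k (p+1+1) \<odot> ?S (p+1)
      = dd (k+2) p \<odot> ?S (p+2) \<odot> ?I (p+1) \<odot> ?S (p+3) \<odot> ?I (p+2) \<odot> ?S (p+1)"
      unfolding dd_step by (simp add: b_assoc nums)
    also have "\<dots> = dd (k+2) p \<odot> ?S (p+2) \<odot> ?S (p+3) \<odot> ?I (p+1) \<odot> ?I (p+2) \<odot> ?S (p+1)"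
      using far_inv(1)[of "p+3" "p+1" "p+4+k", THEN b_re] by (simp add: b_assoc)
    also have "\<dots> = dd (k+2) p \<odot> (?S (p+2) \<odot> ?S (p+3) \<odot> ?S (p+2)) \<odot> ?I (p+1) \<odot> ?I (p+2)"
      using braid_act(3)[of p "k+1"] by (simp add: b_assoc nums)
    also have "\<dots> = (dd (k+2) p \<odot> ?S (p+3)) \<odot> ?S (p+2) \<odot> ?S (p+3) \<odot> ?I (p+1) \<odot> ?I (p+2)"
      using braid_act(1)[of "p+1" k] by (simp add: b_assoc nums)
    also have "\<dots> = (S (p+2+k) (p+1) \<odot> dd (k+2) p) \<odot> ?S (p+2) \<odot> ?S (p+3) \<odot> ?I (p+1) \<odot> ?I (p+2)"
      by (simp only: X_dd)
    also have "\<dots> = S (p+2+k) (p+1) \<odot> dd k (p+1+1)"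
      unfolding dd_step using far_inv(1)[of "p+3" "p+1" "p+4+k", THEN b_re] by (simp add: b_assoc nums)
    finally show ?thesis by (simp add: p nums)
  qed
qed simp

text \<open>The step slides the half braiding past the cup by \<open>U_S\<close> and
  \<open>U_I\<close>; the base case is the defining relation for two cups. Likewise
  \<open>dd_U\<close>, \<open>cc'_A\<close> and \<open>dd'_A\<close> start from
  \<open>A_SSII_U\<close>, \<open>A_SSII_U'\<close> and \<open>A_A_IISS\<close>.\<close>

lemma cc_U: "cc k (n + 2) \<odot> U (n + k) = U (n + 2 + k) \<odot> cc k n"
proof (induction n arbitrary: k rule: nat_induct_plus_1)
  case 0
  have "cc k (0+1+1) \<odot> U k = I (k+4) 2 \<odot> I (k+4) 1 \<odot> S (k+4) 3 \<odot> S (k+4) 2 \<odot> U (k+2) \<odot> U k"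
    unfolding cc_step using far_inv(1)[of 3 1 "k+4", THEN b_re] by (simp add: b_assoc at_0 nums add.commute[of _ k])
  then show ?case using IISS_U_U[of k] by (simp add: at_0 nums add.commute[of _ k])
next
  case (Suc n)
  have "cc k (n + 2 + 1) \<odot> U (n + 1 + k) = I (n+5+k) (n+3) \<odot> S (n+5+k) (n+4) \<odot> U (n+3+k) \<odot> cc (k+1) n"
    unfolding cc_step using Suc.IH[of "k+1"] by (simp only: b_assoc nums)
  also have "\<dots> = U (n+3+k) \<odot> cc k (n+1)"
    using U_S[of "n+2" "n+3+k", THEN b_re] U_I[of "n+1" "n+3+k", THEN b_re]
    by (simp add: cc_step b_assoc nums)
  finally show ?case by (simp only: nums)
qed

lemma dd_U: "dd k (n + 2) \<odot> U (n + 2 + k) = U (n + k) \<odot> dd k n"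
proof (induction n arbitrary: k rule: nat_induct_plus_1)
  case 0
  have "dd k (0+1+1) \<odot> U (k+2) = (q * uinv t) \<boxdot> A (k+2) \<odot> S (k+4) 2 \<odot> S (k+4) 3 \<odot> I (k+4) 1 \<odot> I (k+4) 2 \<odot> U (k+2)"
    unfolding dd_step using far_inv(1)[of 3 1 "k+4", THEN b_re] by (simp add: b_assoc at_0 nums add.commute[of _ k])
  then show ?case using A_SSII_U[of "k+2"] by (simp add: at_0 nums add.commute[of _ k] b_scl)
next
  case (Suc n)
  have "dd k (n + 2 + 1) \<odot> U (n + 3 + k) = dd (k+1) (n+2) \<odot> S (n+5+k) (n+4) \<odot> I (n+5+k) (n+3) \<odot> U (n+3+k)"
    unfolding dd_step by (simp only: b_assoc nums)
  also have "\<dots> = (dd (k+1) (n+2) \<odot> U (n+3+k)) \<odot> S (n+3+k) (n+2) \<odot> I (n+3+k) (n+1)"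
    using U_S[of "n+2" "n+3+k", THEN b_re] U_I[of "n+1" "n+3+k"]
    by (simp add: b_assoc nums)
  also have "\<dots> = U (n+1+k) \<odot> dd k (n+1)"
    unfolding dd_step using Suc.IH[of "k+1"] by (simp only: b_assoc nums)
  finally show ?case by (simp only: nums)
qed

lemma cc'_A: "cc' k n \<odot> A (n + k) = A (n + 2 + k) \<odot> cc' k (n + 2)"
proof (induction n arbitrary: k rule: nat_induct_plus_1)
  case 0
  have "A (k+2) \<odot> cc' k (0+1+1) = (uinv q * t) \<boxdot> A (k+2) \<odot> S (k+4) 2 \<odot> S (k+4) 1 \<odot> I (k+4) 3 \<odot> I (k+4) 2 \<odot> U (k+2)"
    unfolding cc'_step using far_inv(1)[of 1 3 "k+4", THEN b_re] by (simp add: b_assoc b_scl at_0 nums add.commute[of _ k])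
  then show ?case using A_SSII_U'[of "k+2"] by (simp add: at_0 nums add.commute[of _ k] b_scl)
next
  case (Suc n)
  have "A (n + 3 + k) \<odot> cc' k (n + 2 + 1) = A (n+3+k) \<odot> S (n+5+k) (n+3) \<odot> I (n+5+k) (n+4) \<odot> cc' (k+1) (n+2)"
    unfolding cc'_step by (simp only: b_assoc nums)
  also have "\<dots> = S (n+3+k) (n+1) \<odot> I (n+3+k) (n+2) \<odot> (A (n+3+k) \<odot> cc' (k+1) (n+2))"
    using A_I[of "n+2" "n+3+k", THEN b_re] A_S[of "n+1" "n+3+k", THEN b_re]
    by (simp add: b_assoc nums)
  also have "\<dots> = cc' k (n+1) \<odot> A (n+1+k)"
    unfolding cc'_step using Suc.IH[of "k+1"] by (simp only: b_assoc nums)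
  finally show ?case by (simp only: nums)
qed

lemma dd'_A: "dd' k n \<odot> A (n + 2 + k) = A (n + k) \<odot> dd' k (n + 2)"
proof (induction n arbitrary: k rule: nat_induct_plus_1)
  case 0
  have "A k \<odot> dd' k (0+1+1) = A k \<odot> A (k+2) \<odot> I (k+4) 2 \<odot> I (k+4) 3 \<odot> S (k+4) 1 \<odot> S (k+4) 2"
    unfolding dd'_step using far_inv(1)[of 1 3 "k+4", THEN b_re] by (simp add: b_assoc at_0 nums add.commute[of _ k])
  then show ?case using A_A_IISS[of k] by (simp add: at_0 nums add.commute[of _ k])
next
  case (Suc n)
  have "A (n+1+k) \<odot> dd' k (n + 2 + 1) = A (n+1+k) \<odot> dd' (k+1) (n+2) \<odot> I (n+5+k) (n+4) \<odot> S (n+5+k) (n+3)"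
    unfolding dd'_step by (simp only: b_assoc nums)
  also have "\<dots> = dd' (k+1) n \<odot> A (n+3+k) \<odot> I (n+5+k) (n+4) \<odot> S (n+5+k) (n+3)"
    using Suc.IH[of "k+1", symmetric, THEN b_re] by (simp only: b_assoc nums)
  also have "\<dots> = dd' (k+1) n \<odot> I (n+3+k) (n+2) \<odot> S (n+3+k) (n+1) \<odot> A (n+3+k)"
    using A_I[of "n+2" "n+3+k", THEN b_re] A_S[of "n+1" "n+3+k"]
    by (simp add: b_assoc nums)
  also have "\<dots> = dd' k (n+1) \<odot> A (n+3+k)"
    unfolding dd'_step by (simp only: b_assoc nums)
  finally show ?case by (simp only: nums)
qed

text \<open>The cases left open above are transferred: a cap passes \<open>c\<close> because it
  passes \<open>c'\<close> and the crossing by which the two differ, and then \<open>c'\<close>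
  inherits naturality from \<open>c\<close>. The same works for \<open>d\<close> and
  \<open>d'\<close>.\<close>

lemma natural_at_cups:
  assumes "br_wf m"
  shows "natural_at Oc m" "natural_at Oc' m" "natural_at Od m" "natural_at Od' m"
proof -
  have 0: "cc 0 n = bc (br_act q t n Oc)" "cc' 0 n = bc (br_act q t n Oc')"
    "dd 0 n = bc (br_act q t n Od)" "dd' 0 n = bc (br_act q t n Od')" for n
    by (simp_all add: cc_def cc'_def dd_def dd'_def del: br_act.simps)
  have cc: "cc 0 n = uinv t \<boxdot> S (n+2) (n+1) \<odot> cc' 0 n" for n
    unfolding cc'_cc by (simp add: b_scl cancel) (simp add: 0 b_id b_scl del: br_act.simps)
  have dd: "dd 0 n = uinv t \<boxdot> dd' 0 n \<odot> S (n+2) (n+1)" for n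
    unfolding dd'_dd by (simp add: b_scl cancel) (simp add: 0 b_id b_scl del: br_act.simps)
  have A: "S (n+2) (n+1) \<odot> A (n+2) = A (n+2) \<odot> S (n+4) (n+3)" for n
    using A_S[of "n+1" "n+2"] by (simp add: nums)
  show c: "natural_at Oc m"
  proof (rule natural_at_br[OF _ _ _ _ assms])
    have "cc 0 n \<odot> A n = A (n+2) \<odot> cc 0 (n+2)" for n
      using cc'_A[of 0 n] A[of n, THEN b_re] by (simp add: cc b_scl b_assoc nums)
    then show "natural_at Oc (BCap n)" for n
      by (simp add: natural_at_def 0 del: br_act.simps)
  qed (use S_cc[of _ _ 0] cc_U[of 0] in \<open>simp_all add: natural_at_def 0 del: br_act.simps\<close>)
  show d: "natural_at Od m"
  proof (rule natural_at_br[OF _ _ _ _ assms])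
    have "dd 0 n \<odot> A (n+2) = A n \<odot> dd 0 (n+2)" for n
      using dd'_A[of 0 n, THEN b_re] A[of n] by (simp add: dd b_scl b_assoc nums)
    then show "natural_at Od (BCap n)" for n
      by (simp add: natural_at_def 0 del: br_act.simps)
  qed (use S_dd[of _ _ 0] dd_U[of 0] in \<open>simp_all add: natural_at_def 0 del: br_act.simps\<close>)
  have c': "cc 0 (br_cod m) \<odot> bc m = bc (br_shift 2 m) \<odot> cc 0 (br_dom m)"
    and d': "dd 0 (br_cod m) \<odot> bc (br_shift 2 m) = bc m \<odot> dd 0 (br_dom m)"
    using c d by (simp_all add: natural_at_def 0 del: br_act.simps)
  have "cc' 0 (br_cod m) \<odot> bc m = bc (br_shift 2 m) \<odot> cc' 0 (br_dom m)"
    using c' X_natural(2)[OF assms, of 0, THEN b_re] by (simp add: cc'_cc b_scl b_assoc)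
  then show "natural_at Oc' m"
    by (simp add: natural_at_def 0 del: br_act.simps)
  have "dd' 0 (br_cod m) \<odot> bc (br_shift 2 m) = bc m \<odot> dd' 0 (br_dom m)"
    using d'[THEN b_re] X_natural(2)[OF assms, of 0] by (simp add: dd'_dd b_scl b_assoc)
  then show "natural_at Od' m"
    by (simp add: natural_at_def 0 del: br_act.simps)
qed

lemma natural_at_all: "os_wf g \<Longrightarrow> br_wf m \<Longrightarrow> natural_at g m"
proof (induction g arbitrary: m)
  case (OId X)
  then show ?case by (simp add: natural_at_def b_id)
next
  case (OCmp f g)
  then have "natural_at f m" "natural_at g m" by auto
  then show ?case
    using OCmp.prems(1) unfolding natural_at_def br_act.simps bc_push
    by (simp add: b_assoc) (simp flip: b_assoc)
next
  case (OTen f g)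
  then have f: "natural_at f m" and g: "natural_at g (br_shift (length (os_cod f)) m)" by auto
  have "bc (br_shift (length (os_dom g)) (br_act q t (br_cod m) f)) \<odot>
      bc (br_shift (length (os_dom f) + length (os_dom g)) m)
    = bc (br_shift (length (os_cod f) + length (os_dom g)) m) \<odot>
      bc (br_shift (length (os_dom g)) (br_act q t (br_dom m) f))"
    using shift_cmp_eq[OF f[unfolded natural_at_def], of "length (os_dom g)"] OTen.prems by simp
  then show ?case
    using g[unfolded natural_at_def, THEN b_re] unfolding natural_at_def br_act.simps bc_push
    by (simp add: b_assoc)
next
  case (OZer X Y)
  then show ?case by (simp add: natural_at_def B.Cmp_Zer_cls B.Zer_Cmp_cls)
next
  case (OPls f g)
  then show ?case
    by (simp add: natural_at_def bc_push B.Cmp_Pls_cls B.Pls_Cmp_cls B.is_cls_intros)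
next
  case (OScl a f)
  then show ?case by (simp add: natural_at_def bc_push b_scl)
qed (simp_all only: natural_at_X natural_at_cups)

text \<open>A strand can be moved from the right to the left of the word \<open>X\<close>, which lies to the right of \<open>r\<close>
  other strands.\<close>

primrec half_braid :: "nat \<Rightarrow> nat \<Rightarrow> ori list \<Rightarrow> 'k br" where
  "half_braid n r [] = BId n"
| "half_braid n r (a # X) = (if a = Up then BSig n (r + 1) else BInv n (r + 1)) \<cdot>\<^sub>B half_braid n (r + 1) X"

lemma half_braid_typing [simp]:
  "br_dom (half_braid n r X) = n" "br_cod (half_braid n r X) = n"
  "r + length X < n \<Longrightarrow> br_wf (half_braid n r X)"
  by (induction X arbitrary: r) auto

lemma half_braid_append:
  "bc (half_braid n r (X @ Y)) = bc (half_braid n r X) \<odot> bc (half_braid n (r + length X) Y)"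
  by (induction X arbitrary: r) (simp_all add: bc_push b_id b_assoc add_ac)

lemma half_braid_shift: "br_shift k (half_braid n r X) = half_braid (n + k) r X"
  by (induction X arbitrary: r) auto

text \<open>A right inverse is what the cancellation in \<open>os_rel_act\<close> asks for.\<close>

lemma half_braid_inverse:
  "r + length X < n \<Longrightarrow> \<exists>f. bc (half_braid n r X) \<odot> bc f = J n"
proof (induction X arbitrary: r)
  case (Cons a X)
  then obtain f where f: "bc (half_braid n (r + 1) X) \<odot> bc f = J n"
  proof -
    have "r + 1 + length X < n" using Cons.prems by simp
    then show thesis using Cons.IH that by blast
  qed
  have "bc (half_braid n r (a # X)) \<odot> bc (f \<cdot>\<^sub>B (if a = Up then BInv n (r + 1) else BSig n (r + 1))) = J n"
    using Cons.prems f[THEN b_re] by (simp add: bc_push b_assoc cancel)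
  then show ?case ..
next
  case Nil
  then show ?case using b_id(1)[of "BId n" n] by auto
qed

lemma half_braid_natural_left:
  assumes "br_wf m" "r = br_cod m" "r' = br_dom m" "n = r + 1 + length X + k" "n' = r' + 1 + length X + k"
  shows "bc (half_braid n r X) \<odot> bc (br_shift (length X + 1 + k) m)
    = bc (br_shift (length X + 1 + k) m) \<odot> bc (half_braid n' r' X)"
  using assms
proof (induction X arbitrary: m r r' k n n')
  case Nil
  then show ?case by (simp add: b_id)
next
  case (Cons a X)
  have i: "1 + (length X + 1 + k) = length X + k + 2" "length (a # X) + 1 + k = length X + k + 2" by simp_all
  have n: "n = br_cod m + 2 + (length X + k)" "n' = br_dom m + 2 + (length X + k)" using Cons.prems by simp_all
  have X: "bc (half_braid n (r + 1) X) \<odot> bc (br_shift (length X + 1 + k) (br_shift 1 m))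
    = bc (br_shift (length X + 1 + k) (br_shift 1 m)) \<odot> bc (half_braid n' (r' + 1) X)"
    by (rule Cons.IH) (use Cons.prems in auto)
  have S: "S n (r+1) \<odot> bc (br_shift (length X + k + 2) m) = bc (br_shift (length X + k + 2) m) \<odot> S n' (r'+1)"
    "I n (r+1) \<odot> bc (br_shift (length X + k + 2) m) = bc (br_shift (length X + k + 2) m) \<odot> I n' (r'+1)"
    unfolding Cons.prems(2,3) n by (rule X_natural[OF Cons.prems(1)])+
  show ?case
    unfolding i using X[unfolded br_shift_shift i] S[THEN b_re] by (simp add: bc_push b_assoc)
qed

lemma braid_act': "I (r+3+k) (r+2) \<odot> S (r+3+k) (r+1) \<odot> S (r+3+k) (r+2) = S (r+3+k) (r+1) \<odot> S (r+3+k) (r+2) \<odot> I (r+3+k) (r+1)"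
  using braid_mixed(2)[of "r+1" "r+3+k"] by (simp add: nums)

text \<open>For crossings this is a braid relation; for cups and caps it is the recursion in
  \<open>r\<close>, which splits off exactly this half braiding. A tensor product takes two passes,
  across \<open>f\<close> and across \<open>g\<close>; in between, naturality (\<open>nf\<close>,
  \<open>ng\<close>) moves the other factor out of the way.\<close>

lemma half_braid_natural:
  "os_wf g \<Longrightarrow> bc (br_act q t (r+1) g) \<odot> bc (half_braid (r + 1 + length (os_dom g)) r (os_dom g))
    = bc (half_braid (r + 1 + length (os_cod g)) r (os_cod g)) \<odot> bc (br_shift 1 (br_act q t r g))"
proof (induction g arbitrary: r)
  case (OId X)
  show ?case by (simp add: b_id add_ac)
next
  case OXp
  show ?case using braid_act(1)[of r 0] by (simp add: bc_push b_assoc b_id nums)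
next
  case OXm
  show ?case using braid_act'[of r 0] by (simp add: bc_push b_assoc b_id nums)
next
  case Oc
  show ?case using cc_step[of 0 r]
    by (simp add: b_id nums cc_def b_assoc bc_push del: br_act.simps)
next
  case Oc'
  show ?case using cc'_step[of 0 r]
    by (simp add: b_id nums cc'_def b_assoc bc_push del: br_act.simps)
next
  case Od
  show ?case using dd_step[of 0 r]
    by (simp add: b_id nums dd_def b_assoc bc_push cancel del: br_act.simps)
next
  case Od'
  show ?case using dd'_step[of 0 r]
    by (simp add: b_id nums dd'_def b_assoc bc_push cancel del: br_act.simps)
next
  case (OCmp f g)
  then have f: "bc (br_act q t (r+1) f) \<odot> bc (half_braid (r + 1 + length (os_dom f)) r (os_dom f))
    = bc (half_braid (r + 1 + length (os_cod f)) r (os_cod f)) \<odot> bc (br_shift 1 (br_act q t r f))"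
   and g: "bc (br_act q t (r+1) g) \<odot> bc (half_braid (r + 1 + length (os_dom g)) r (os_dom g))
    = bc (half_braid (r + 1 + length (os_cod g)) r (os_cod g)) \<odot> bc (br_shift 1 (br_act q t r g))"
   and e: "os_dom f = os_cod g"
    by auto
  show ?case
    using g f[THEN b_re] e unfolding br_act.simps bc_push by (simp add: bc_push b_assoc)
next
  case (OTen f g)
  let ?Xf = "os_dom f" and ?Yf = "os_cod f" and ?Xg = "os_dom g" and ?Yg = "os_cod g"
  let ?r = "r + length ?Yf" and ?n = "r + 1 + length ?Yf + length ?Xg"
  have f: "bc (br_act q t (r+1) f) \<odot> bc (half_braid (r + 1 + length ?Xf) r ?Xf)
    = bc (half_braid (r + 1 + length ?Yf) r ?Yf) \<odot> bc (br_shift 1 (br_act q t r f))"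
    and g: "bc (br_act q t (?r+1) g) \<odot> bc (half_braid (?r + 1 + length ?Xg) ?r ?Xg)
    = bc (half_braid (?r + 1 + length ?Yg) ?r ?Yg) \<odot> bc (br_shift 1 (br_act q t ?r g))"
    using OTen by auto
  have f': "bc (br_shift (length ?Xg) (br_act q t (r+1) f)) \<odot> bc (half_braid (r + 1 + length ?Xf + length ?Xg) r ?Xf)
    = bc (half_braid ?n r ?Yf) \<odot> bc (br_shift (1 + length ?Xg) (br_act q t r f))"
    using shift_cmp_eq[OF f, of "length ?Xg"] OTen.prems by (simp add: half_braid_shift)
  have nf: "bc (br_shift (length ?Xg + 1) (br_act q t r f)) \<odot> bc (half_braid (r + 1 + length ?Xf + length ?Xg) (r + length ?Xf) ?Xg)
    = bc (half_braid ?n ?r ?Xg) \<odot> bc (br_shift (length ?Xg + 1) (br_act q t r f))"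
    using half_braid_natural_left[of "br_act q t r f" ?r "r + length ?Xf" ?n ?Xg 0 "r + 1 + length ?Xf + length ?Xg"] OTen.prems
    by simp
  have ng: "bc (br_act q t (r + 1 + length ?Yf) g) \<odot> bc (half_braid ?n r ?Yf)
    = bc (half_braid (r + 1 + length ?Yf + length ?Yg) r ?Yf) \<odot> bc (br_act q t (r + 1 + length ?Yf) g)"
    using natural_at_all[of g "half_braid (r + 1 + length ?Yf) r ?Yf"] OTen.prems
    by (simp add: natural_at_def half_braid_shift)
  show ?case
    using f'[THEN b_re] nf ng[THEN b_re] g[THEN b_re]
    by (simp add: bc_push half_braid_append b_assoc add_ac)
next
  case (OZer X Y)
  show ?case by (simp add: B.Cmp_Zer_cls B.Zer_Cmp_cls add_ac)
next
  case (OPls f g)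
  then show ?case
    by (simp add: bc_push B.Cmp_Pls_cls B.Pls_Cmp_cls B.is_cls_intros)
next
  case (OScl a f)
  then show ?case by (simp add: bc_push b_scl)
qed

section \<open>The relations of the oriented skein category under the action\<close>

lemma lin_ax_br_act: "lin_ax OS_terms f g \<Longrightarrow> lin_ax B_terms (br_act q t r f) (br_act q t r g)"
  by (induction rule: lin_ax.induct) (simp, (rule B_terms_lin_ax; force))+

lemma mon_ax_br_act: "mon_ax OS_terms f g \<Longrightarrow> bc (br_act q t r f) = bc (br_act q t r g)"
proof (induction rule: mon_ax.induct)
  case (ten_id X Y)
  show ?case by (simp add: bc_push b_id add_ac)
next
  \<comment> \<open>The interchange law is naturality of the action of \<open>g\<close> at the
    morphism by which \<open>f'\<close> acts.\<close>
  case (ten_cmp f X Y f' Z g X' Y' g' Z')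
  have "bc (br_act q t (r + length Z) g) \<odot> bc (br_shift (length X') (br_act q t r f'))
    = bc (br_shift (length Y') (br_act q t r f')) \<odot> bc (br_act q t (r + length Y) g)"
    using natural_at_all[of g "br_act q t r f'"] ten_cmp by (simp add: natural_at_def)
  from this[THEN b_re] show ?case
    using ten_cmp by (simp add: bc_push b_assoc)
next
  case (ten_assoc f X Y g X' Y' h X'' Y'')
  then show ?case by (simp add: bc_push b_assoc add_ac)
next
  case (ten_unit_left f X Y)
  then show ?case by (simp add: bc_push b_id)
next
  case (ten_unit_right f X Y)
  then show ?case by (simp add: bc_push b_id)
qed (simp_all add: bc_push b_scl B.Cmp_Pls_cls B.Pls_Cmp_cls B.is_cls_intros)

lemma cup_eqs:
  "bc (br_shift k (br_act q t r Oc)) = cc k r" "bc (br_act q t r Oc) = cc 0 r"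
  "bc (br_shift k (br_act q t r Oc')) = cc' k r" "bc (br_act q t r Oc') = cc' 0 r"
  "bc (br_shift k (br_act q t r Od)) = dd k r" "bc (br_act q t r Od) = dd 0 r"
  "bc (br_shift k (br_act q t r Od')) = dd' k r" "bc (br_act q t r Od') = dd' 0 r"
  by (simp_all only: cc_def cc'_def dd_def dd'_def br_shift_0)

lemma cup_12:
  "cc k 1 = I (k + 3) 1 \<odot> S (k + 3) 2 \<odot> U (k + 1)"
  "cc' k 1 = (uinv q * t) \<boxdot> S (k + 3) 1 \<odot> I (k + 3) 2 \<odot> U (k + 1)"
  "dd k 1 = (q * uinv t) \<boxdot> A (k + 1) \<odot> S (k + 3) 2 \<odot> I (k + 3) 1"
  "cc' k 2 = (uinv q * t) \<boxdot> S (k + 4) 2 \<odot> I (k + 4) 3 \<odot> S (k + 4) 1 \<odot> I (k + 4) 2 \<odot> U (k + 2)"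
  "dd k 2 = (q * uinv t) \<boxdot> A (k + 2) \<odot> S (k + 4) 2 \<odot> S (k + 4) 3 \<odot> I (k + 4) 1 \<odot> I (k + 4) 2"
proof -
  show 1: "cc k 1 = I (k + 3) 1 \<odot> S (k + 3) 2 \<odot> U (k + 1)"
    using cc_step[of k 0] by (simp add: at_0 add_ac)
  show 2: "cc' k 1 = (uinv q * t) \<boxdot> S (k + 3) 1 \<odot> I (k + 3) 2 \<odot> U (k + 1)" for k
    using cc'_step[of k 0] by (simp add: at_0 add_ac b_scl)
  show 3: "dd k 1 = (q * uinv t) \<boxdot> A (k + 1) \<odot> S (k + 3) 2 \<odot> I (k + 3) 1" for k
    using dd_step[of k 0] by (simp add: at_0 add_ac b_scl)
  show "cc' k 2 = (uinv q * t) \<boxdot> S (k + 4) 2 \<odot> I (k + 4) 3 \<odot> S (k + 4) 1 \<odot> I (k + 4) 2 \<odot> U (k + 2)"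
    using cc'_step[of k 1] by (simp add: 2 b_scl b_assoc nums add.commute[of _ k])
  show "dd k 2 = (q * uinv t) \<boxdot> A (k + 2) \<odot> S (k + 4) 2 \<odot> S (k + 4) 3 \<odot> I (k + 4) 1 \<odot> I (k + 4) 2"
    using dd_step[of k 1] far_inv(1)[of 3 1 "k + 4", THEN b_re] by (simp add: 3 b_scl b_assoc nums add.commute[of _ k])
qed

text \<open>The scalar \<open>q * uinv t\<close> of \<open>d\<close> is cancelled by the
  \<open>uinv q\<close> from untwisting the cup and the \<open>t\<close> from the kink in
  \<open>A_S2_U\<close>.\<close>

lemma act_R: "bc (br_act q t 0 (R_of OXp)) = S 2 1"
proof -
  have "bc (br_act q t 0 (R_of OXp)) = (q * uinv t) \<boxdot> A 2 \<odot> S 4 2 \<odot> S 4 3 \<odot> (I 4 1 \<odot> U 2)"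
    unfolding R_of_def by (simp add: bc_push b_assoc cup_eqs cup_12 at_0 b_id b_scl cancel del: br_act.simps(2-7))
      (simp add: b_id cancel)
  then show ?thesis
    using I1_U[of 2] U_S[of 1 2, symmetric] A_S2_U[of 2, THEN b_re] by (simp add: b_scl b_assoc mult_ac b_id)
qed

text \<open>Here a negative kink appears, and its value \<open>uinv t\<close> cancels the
  \<open>t\<close> in the action of \<open>c'\<close>. Through \<open>A_I2_U\<close> this
  invertibility relation depends on the equation for \<open>\<delta>\<close>.\<close>

lemma act_L: "bc (br_act q t 0 (L_of OXm)) = I 2 1"
proof -
  have 1: "I 4 2 \<odot> S 4 2 = J 4" by (rule I_S) simp_all
  have "bc (br_act q t 0 (L_of OXm)) = (uinv q * t) \<boxdot> A 2 \<odot> I 4 3 \<odot> S 4 1 \<odot> I 4 2 \<odot> U 2"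
    unfolding L_of_def by (simp add: bc_push b_assoc cup_eqs cup_12 at_0 b_id b_scl 1[THEN b_re] del: br_act.simps(2-7))
      (simp add: b_id b_scl 1[THEN b_re])
  also have "\<dots> = (uinv q * t) \<boxdot> I 2 1 \<odot> (A 2 \<odot> S 4 1) \<odot> I 4 2 \<odot> U 2"
    using A_I[of 1 2, THEN b_re] by (simp add: b_scl b_assoc)
  also have "\<dots> = I 2 1"
    using A_S1[of 2] A_I2_U[of 2] by (simp add: b_scl b_assoc mult_ac b_id)
  finally show ?thesis .
qed

lemma os_rel_act_0:
  assumes "os_rel q t \<delta> f g"
  shows "bc (br_act q t 0 f) = bc (br_act q t 0 g)"
  using assms
proof (cases rule: os_rel.cases)
  case 3
  then show ?thesis using braid[of 1 3] by (simp add: bc_push b_id b_assoc)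
next
  case 4
  then show ?thesis by (simp add: bc_push act_L act_R cancel)
next
  case 5
  then show ?thesis by (simp add: bc_push act_L act_R cancel)
next
  case 6
  then show ?thesis using skein[of 1 2] by (simp add: bc_push)
next
  case 7
  then show ?thesis
    using A_S2_U[of 1] by (simp add: bc_push cup_eqs at_0 b_id b_assoc b_scl del: br_act.simps(2-7))
      (simp add: bc_push b_id)
next
  case 8
  have "A 1 \<odot> S 3 2 \<odot> S 3 1 \<odot> I 3 2 \<odot> U 1 = t \<boxdot> J 1"
    using braid_mixed(3)[of 1 3, THEN b_re] A_I1[of 1, THEN b_re] S1_U[of 1] A_S2_U[of 1] by (simp add: b_assoc b_scl)
  with 8 show ?thesis
    by (simp add: bc_push cup_eqs cup_12 b_id b_assoc b_scl del: br_act.simps(2-7))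
      (simp add: bc_push b_id cancel b_scl mult_ac)
next
  case 9
  then show ?thesis
    using A_U[of 0] by (simp add: bc_push cup_eqs at_0 b_scl mult_ac del: br_act.simps(2-7))
next
  case 10
  have "A 1 \<odot> I 3 1 \<odot> S 3 2 \<odot> U 1 = (uinv q * t) \<boxdot> J 1"
    using A_I1[of 1, THEN b_re] A_S2_U[of 1] by (simp add: b_scl)
  with 10 show ?thesis
    by (simp add: bc_push cup_eqs cup_12 at_0 b_id b_assoc b_scl mult_ac del: br_act.simps(2-7))
next
  case 11
  have "A 1 \<odot> S 3 2 \<odot> I 3 1 \<odot> U 1 = (uinv q * t) \<boxdot> J 1"
    using I1_U[of 1] A_S2_U[of 1] by (simp add: b_scl)
  with 11 show ?thesis
    by (simp add: bc_push cup_eqs cup_12 at_0 b_id b_assoc b_scl mult_ac del: br_act.simps(2-7))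
qed (simp_all add: bc_push cancel)

lemma cancel_right:
  assumes "bc f \<odot> bc b = bc g \<odot> bc b" "bc b \<odot> bc b' = J n" "br_dom f = n" "br_dom g = n"
  shows "bc f = bc g"
proof -
  have "bc f = bc f \<odot> bc b \<odot> bc b'"
    unfolding assms(2) using assms by (simp add: b_id)
  also have "\<dots> = bc g \<odot> bc b \<odot> bc b'"
    using assms(1) by (simp flip: b_assoc)
  also have "\<dots> = bc g"
    unfolding assms(2) using assms by (simp add: b_id)
  finally show ?thesis .
qed

lemma os_rel_act: "os_rel q t \<delta> f g \<Longrightarrow> bc (br_act q t r f) = bc (br_act q t r g)"
proof (induction r rule: nat_induct_plus_1)
  case 0
  then show ?case by (rule os_rel_act_0)
next
  case (Suc r)
  then have p: "os_wf f" "os_wf g" "os_dom f = os_dom g" "os_cod f = os_cod g"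
    using os_rel_parallel[OF Suc.prems] by (auto simp: OS_typed.parallel_def)
  obtain b where b: "bc (half_braid (r + 1 + length (os_dom g)) r (os_dom g)) \<odot> bc b = J (r + 1 + length (os_dom g))"
    using half_braid_inverse[of r "os_dom g" "r + 1 + length (os_dom g)"] by auto
  have "bc (br_shift 1 (br_act q t r f)) = bc (br_shift 1 (br_act q t r g))"
    by (rule bc_shift) (simp_all add: Suc p)
  then have "bc (br_act q t (r+1) f) \<odot> bc (half_braid (r + 1 + length (os_dom g)) r (os_dom g))
    = bc (br_act q t (r+1) g) \<odot> bc (half_braid (r + 1 + length (os_dom g)) r (os_dom g))"
    using half_braid_natural[of f r] half_braid_natural[of g r] p by simp
  then show ?case
    by (rule cancel_right[OF _ b]) (simp_all add: p)
qed

lemma os_eq_act: "os_eq q t \<delta> f g \<Longrightarrow> bc (br_act q t r f) = bc (br_act q t r g)"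
proof (induction arbitrary: r rule: os_eq.induct)
  case (os_ten f f' g g')
  then have "OS_typed.parallel f f'" "OS_typed.parallel g g'"
    using os_eq_parallel by blast+
  then show ?case
    using os_ten.IH bc_shift[OF os_ten.IH(1)] by (simp add: OS_typed.parallel_def bc_push)
next
  case (os_lin f g)
  then show ?case by (intro B.cls_eq br_lin lin_ax_br_act)
next
  case (os_mon f g)
  then show ?case by (rule mon_ax_br_act)
next
  case (os_rel f g)
  then show ?case by (rule os_rel_act)
qed (simp_all add: bc_push)

section \<open>The iquantum Brauer category is a module\<close>

lemma Brauer_simps:
  "Hom (Brauer q t \<delta>) = Hom (quotient_lincat B_terms (br_eq q t \<delta>))"
  "Idn (Brauer q t \<delta>) = (\<lambda>n. bc (BId n))" "Cmp (Brauer q t \<delta>) = lift2 (br_eq q t \<delta>) BCmp"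
  "Zer (Brauer q t \<delta>) = (\<lambda>m n. bc (BZer m n))" "Pls (Brauer q t \<delta>) = lift2 (br_eq q t \<delta>) BPls"
  "Scl (Brauer q t \<delta>) = (\<lambda>a. lift1 (br_eq q t \<delta>) (BScl a))"
  "ActO (Brauer q t \<delta>) = (\<lambda>r X. r + length X)"
  "ActF (Brauer q t \<delta>) = (\<lambda>F X. lift1 (br_eq q t \<delta>) (br_shift (length X)) F)"
  "ActN (Brauer q t \<delta>) = (\<lambda>r. lift1 (br_eq q t \<delta>) (br_act q t r))"
  by (auto simp: Brauer_def lincat.defs modcat.defs quotient_lincat_def)

lemma in_Hom_Brauer: "F \<in> Hom (Brauer q t \<delta>) m n \<longleftrightarrow> (\<exists>f. br_wf f \<and> br_dom f = m \<and> br_cod f = n \<and> F = bc f)"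
  by (simp add: Brauer_simps B.in_Hom_quotient)

lemma Hom_Brauer_E:
  assumes "F \<in> Hom (Brauer q t \<delta>) m n"
  obtains f where "br_wf f" "br_dom f = m" "br_cod f = n" "F = bc f"
  using assms unfolding in_Hom_Brauer by blast

lemma bc_in_Hom: "br_wf f \<Longrightarrow> br_dom f = m \<Longrightarrow> br_cod f = n \<Longrightarrow> bc f \<in> Hom (Brauer q t \<delta>) m n"
  unfolding in_Hom_Brauer by blast

lemma linear_category_Brauer: "linear_category (Brauer q t \<delta>)"
  by (rule linear_category_cong[OF B.linear_category_quotient])
    (simp_all add: Brauer_simps quotient_lincat_def fun_eq_iff)

lemma lift1_const: "f \<in> F \<Longrightarrow> (\<And>g. g \<in> F \<Longrightarrow> cls E (h g) = G) \<Longrightarrow> lift1 E h F = G"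
  unfolding lift1_def by auto

text \<open>Unlike for the other operations, \<open>br_shift\<close> can turn an ill-formed term into a well-formed one.\<close>

lemma Brauer_ActF_cls: "br_wf f \<Longrightarrow> lift1 (br_eq q t \<delta>) (br_shift k) (bc f) = bc (br_shift k f)"
proof -
  assume f: "br_wf f"
  have "bc (br_shift k g) = bc (br_shift k f)" if "g \<in> bc f" for g
    using that by - (rule B.cls_eq, rule br_eq_shift, rule B.E_sym, simp add: cls_def)
  then show ?thesis
    by (rule lift1_const[OF B.cls_self[OF f]])
qed

lemma Brauer_ActN_cls: "os_wf g \<Longrightarrow> lift1 (br_eq q t \<delta>) (br_act q t r) (oc g) = bc (br_act q t r g)"
proof -
  assume g: "os_wf g"
  have "bc (br_act q t r f) = bc (br_act q t r g)" if "f \<in> oc g" for f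
    using that by - (rule os_eq_act, rule O.E_sym, simp add: cls_def)
  then show ?thesis
    by (rule lift1_const[OF O.cls_self[OF g]])
qed

lemma right_module_Brauer: "right_module (OS q t \<delta>) (Brauer q t \<delta>)"
proof -
  interpret strict_monoidal "OS q t \<delta>" by (rule strict_monoidal_OS)
  interpret linear_category "Brauer q t \<delta>" by (rule linear_category_Brauer)
  show ?thesis
  proof (unfold_locales, goal_cases)
    case (7 F m n G X Y)
    then obtain f g where *: "br_wf f" "br_dom f = m" "br_cod f = n" "F = bc f"
      "os_wf g" "os_dom g = X" "os_cod g = Y" "G = oc g"
      unfolding in_Hom_Brauer in_Hom_OS by blast
    then show ?case
      using natural_at_all[of g f] by (simp add: Brauer_simps(2-) Brauer_ActF_cls Brauer_ActN_cls natural_at_def)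
  qed ((elim Hom_Brauer_E Hom_OS_E)?;
      simp add: OS_simps(2-) Brauer_simps(2-) B.ops_cls O.ops_cls Ten_cls Brauer_ActF_cls Brauer_ActN_cls
        bc_in_Hom add_ac)+
qed

end

section \<open>The functor F\<close>

primrec F_term :: "'k::{comm_ring,comm_monoid_mult} \<Rightarrow> 'k \<Rightarrow> 'k ds \<Rightarrow> 'k br" where
  "F_term q t (DOs g) = br_act q t 0 g"
| "F_term q t DTau = BId 1"
| "F_term q t DTau' = BId 1"
| "F_term q t (f \<otimes>\<^sub>D g) =
    br_act q t (length (ds_cod f)) g \<cdot>\<^sub>B br_shift (length (os_dom g)) (F_term q t f)"
| "F_term q t (f \<cdot>\<^sub>D g) = F_term q t f \<cdot>\<^sub>B F_term q t g"
| "F_term q t (DZer X Y) = BZer (length X) (length Y)"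
| "F_term q t (DPls f g) = BPls (F_term q t f) (F_term q t g)"
| "F_term q t (DScl a f) = BScl a (F_term q t f)"

context skein_parameters begin

abbreviation F where "F \<equiv> F_term q t"

lemma F_typing [simp]: "br_dom (F f) = length (ds_dom f)" "br_cod (F f) = length (ds_cod f)"
  "ds_wf f \<Longrightarrow> br_wf (F f)"
  by (induction f) auto

lemma lin_ax_F: "lin_ax DS_terms f g \<Longrightarrow> lin_ax B_terms (F f) (F g)"
  by (induction rule: lin_ax.induct) (simp, (rule B_terms_lin_ax; force))+

lemma act_ax_F: "act_ax f g \<Longrightarrow> bc (F f) = bc (F g)"
proof (induction rule: act_ax.induct)
  case (act_cmp f X Y f' Z g X' Y' g' Z')
  then have "bc (br_act q t (length Z) g) \<odot> bc (br_shift (length X') (F f'))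
    = bc (br_shift (length Y') (F f')) \<odot> bc (br_act q t (length Y) g)"
    using natural_at_all[of g "F f'"] by (simp add: natural_at_def)
  from this[THEN b_re] show ?case
    using act_cmp by (simp add: bc_push b_assoc)
qed (simp_all add: bc_push b_id b_assoc b_scl B.Cmp_Pls_cls B.Pls_Cmp_cls B.is_cls_intros add_ac)

text \<open>Conjugation by the half braiding again, evaluated by the braid relation. Positions other
  than 0 are required for the inner \<open>R\<close> of \<open>D_of\<close> and for naturality of
  the comparison \<open>et\<close> at \<open>R\<close>.\<close>

lemma act_R_all: "bc (br_act q t r (R_of OXp)) = S (r+2) (r+1)"
proof (induction r rule: nat_induct_plus_1)
  case 0
  show ?case using act_R by simp
next
  case (Suc r)
  have e: "half_braid (r + 1 + length [Up, Dn]) r [Up, Dn] = BSig (r+3) (r+1) \<cdot>\<^sub>B BInv (r+3) (r+2) \<cdot>\<^sub>B BId (r+3)"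
    "half_braid (r + 1 + length [Dn, Up]) r [Dn, Up] = BInv (r+3) (r+1) \<cdot>\<^sub>B BSig (r+3) (r+2) \<cdot>\<^sub>B BId (r+3)"
    by (simp_all add: nums)
  have wf: "os_wf (R_of OXp)" "os_dom (R_of OXp) = [Up, Dn]" "os_cod (R_of OXp) = [Dn, Up]"
    by (simp_all add: R_of_def)
  have s: "bc (br_shift 1 (br_act q t r (R_of OXp))) = S (r+3) (r+1)"
    using bc_shift[OF Suc br_act_wf[OF wf(1)], of 1] by (simp add: nums)
  let ?G = "bc (br_act q t (r+1) (R_of OXp))"
  have 1: "?G \<odot> S (r+3) (r+1) \<odot> I (r+3) (r+2) = I (r+3) (r+1) \<odot> S (r+3) (r+2) \<odot> S (r+3) (r+1)"
    using half_braid_natural[of "R_of OXp" r] unfolding wf e s by (simp add: bc_push b_id b_assoc wf)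
  have 2: "?G \<odot> J (r+3) = ?G"
    by (simp add: b_id wf nums)
  have "?G \<odot> J (r+3) = ?G \<odot> S (r+3) (r+1) \<odot> I (r+3) (r+2) \<odot> S (r+3) (r+2) \<odot> I (r+3) (r+1)"
    by (simp add: cancel)
  also have "\<dots> = (I (r+3) (r+1) \<odot> S (r+3) (r+2) \<odot> S (r+3) (r+1)) \<odot> S (r+3) (r+2) \<odot> I (r+3) (r+1)"
    using 1[THEN b_re] by (simp add: b_assoc)
  also have "\<dots> = S (r+3) (r+2)"
    using braid_act(1)[of r 0, symmetric, THEN b_re] by (simp add: b_assoc cancel)
  finally show ?case unfolding 2 by (simp only: nums)
qed

text \<open>\<open>R_of OXp\<close> acts by the same crossing as \<open>OXp\<close>, so the formula
  for \<open>D_of\<close> turns into the one for \<open>R_of\<close>.\<close>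

lemma act_D: "bc (br_act q t 0 (D_of OXp)) = S 2 1"
proof -
  have "bc (br_act q t 1 (R_of OXp)) = bc (BSig 3 2)"
    using act_R_all[of 1] by simp
  then have R: "bc (br_shift 1 (br_act q t 1 (R_of OXp))) = S 4 2"
    using bc_shift[of "br_act q t 1 (R_of OXp)" "BSig 3 2" 1] by (simp add: R_of_def)
  have "bc (br_act q t 0 (D_of OXp)) = dd 0 2 \<odot> S 4 2 \<odot> U 2"
    using R unfolding D_of_def by (simp add: bc_push b_assoc cup_eqs at_0 b_id cancel R_of_def del: br_act.simps(4-7))
  also have "\<dots> = bc (br_act q t 0 (R_of OXp))"
    unfolding R_of_def by (simp add: bc_push b_assoc cup_eqs at_0 b_id cancel del: br_act.simps(4-7))
  finally show ?thesis using act_R by simp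
qed

text \<open>By the skein relation \<open>R_-\<close> is \<open>R_+\<close> minus z times
  \<open>c d\<close>. The correction acts at \<open>B\<^sub>0\<close> by a cup after a cap, up to
  the scalar contained in the action of \<open>d\<close>.\<close>

lemma act_Rm: "bc (br_act q t 0 (R_of OXm)) = S 2 1 \<boxplus> (- z * (q * uinv t)) \<boxdot> U 0 \<odot> A 0"
proof -
  have "bc (br_act q t 0 (R_of OXm)) = dd 0 2 \<odot> I 4 2 \<odot> U 2"
    unfolding R_of_def by (simp add: bc_push b_assoc cup_eqs at_0 b_id cancel del: br_act.simps(4-7))
  also have "\<dots> = dd 0 2 \<odot> S 4 2 \<odot> U 2 \<boxplus> (- z) \<boxdot> dd 0 2 \<odot> U 2"
    by (simp add: I_skein dd_def B.Cmp_Pls_cls B.Pls_Cmp_cls B.is_cls_intros b_scl b_id cancel del: br_act.simps(4-7))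
  also have "dd 0 2 \<odot> S 4 2 \<odot> U 2 = S 2 1"
    using act_R unfolding R_of_def by (simp add: bc_push b_assoc cup_eqs at_0 b_id cancel del: br_act.simps(4-7))
  also have "(- z) \<boxdot> dd 0 2 \<odot> U 2 = (- z * (q * uinv t)) \<boxdot> U 0 \<odot> A 0"
    using dd_U[of 0 0] by (simp add: b_scl at_0)
  finally show ?thesis .
qed

lemma ds_rel_F: "ds_rel q f g \<Longrightarrow> bc (F f) = bc (F g)"
proof (induction rule: ds_rel.induct)
  \<comment> \<open>With toggles sent to identities, and both \<open>OXp\<close> and
    \<open>D_of OXp\<close> to \<open>S 2 1\<close>, the relation says that \<open>S 2 1\<close>
    commutes with the image of \<open>R_of OXm\<close>. The correction term in \<open>act_Rm\<close>
    is scaled by \<open>q\<close> from either side.\<close>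
  case 3
  have "S 2 1 \<odot> bc (br_act q t 0 (R_of OXm)) = bc (br_act q t 0 (R_of OXm)) \<odot> S 2 1"
    using A_S1[of 0] S1_U[of 0, THEN b_re]
    by (simp add: act_Rm B.Cmp_Pls_cls B.Pls_Cmp_cls B.is_cls_intros b_scl b_assoc)
  moreover have "bc (br_act q t 0 (R_of OXm)) \<odot> J 2 = bc (br_act q t 0 (R_of OXm))"
    "J 2 \<odot> bc (br_act q t 0 (R_of OXm)) = bc (br_act q t 0 (R_of OXm))"
    by (simp_all add: b_id R_of_def)
  ultimately show ?case
    using b_re[of "J 2" "bc (br_act q t 0 (R_of OXm))"] by (simp add: bc_push act_D b_id b_assoc)
next
  case 4
  show ?case using A_S1[of 0] by (simp add: bc_push b_id b_scl)
next
  case 5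
  show ?case using S1_U[of 0] by (simp add: bc_push b_id b_scl)
qed (simp_all add: bc_push b_id)

lemma ds_eq_F: "ds_eq q t \<delta> f g \<Longrightarrow> bc (F f) = bc (F g)"
proof (induction rule: ds_eq.induct)
  case (ds_os g g')
  then show ?case using os_eq_act by simp
next
  case (ds_act f f' g g')
  then have "DS_typed.parallel f f'" "OS_typed.parallel g g'"
    using ds_eq_parallel os_eq_parallel by blast+
  then show ?case
    using bc_shift[OF ds_act.IH] os_eq_act[OF ds_act.hyps(2)]
    by (simp add: OS_typed.parallel_def DS_typed.parallel_def bc_push)
next
  case (ds_lin f g)
  then show ?case by (intro B.cls_eq br_lin lin_ax_F)
next
  case (ds_act_ax f g)
  then show ?case by (rule act_ax_F)
next
  case (ds_rel f g)
  then show ?case by (rule ds_rel_F)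
qed (simp_all add: bc_push)

definition F_mor :: "'k ds set \<Rightarrow> 'k br set" where "F_mor = lift1 (br_eq q t \<delta>) F"

lemma F_mor_cls: "ds_wf f \<Longrightarrow> F_mor (dc f) = bc (F f)"
proof -
  assume f: "ds_wf f"
  have "bc (F g) = bc (F f)" if "g \<in> dc f" for g
    using that by - (rule ds_eq_F, rule D.E_sym, simp add: cls_def)
  then show ?thesis
    unfolding F_mor_def by (rule lift1_const[OF D.cls_self[OF f]])
qed

lemma linear_functor_F: "linear_functor (DS q t \<delta>) (Brauer q t \<delta>) length F_mor"
  by unfold_locales ((elim Hom_DS_E)?; simp add: DS_simps(2-) Brauer_simps(2-) D.ops_cls B.ops_cls F_mor_cls bc_in_Hom)+

lemma strict_module_morphism_F: "strict_module_morphism (OS q t \<delta>) (DS q t \<delta>) (Brauer q t \<delta>) length F_mor"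
  unfolding strict_module_morphism_def
proof
  show "\<forall>A X. length (ActO (DS q t \<delta>) A X) = ActO (Brauer q t \<delta>) (length A) X"
    by (simp add: DS_simps Brauer_simps)
  interpret right_module "OS q t \<delta>" "DS q t \<delta>" by (rule right_module_DS)
  interpret N: right_module "OS q t \<delta>" "Brauer q t \<delta>" by (rule right_module_Brauer)
  interpret linear_functor "DS q t \<delta>" "Brauer q t \<delta>" length F_mor by (rule linear_functor_F)
  show "module_morphism (OS q t \<delta>) (DS q t \<delta>) (Brauer q t \<delta>) length F_mor
     (\<lambda>A X. Idn (Brauer q t \<delta>) (ActO (Brauer q t \<delta>) (length A) X))"
  proof (unfold_locales, goal_cases)
    case (1 A X)
    have "J (length A + length X) \<odot> J (length A + length X) = J (length A + length X)"
      by (simp add: b_id)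
    then show ?case
      unfolding is_iso_def using bc_in_Hom[of "BId (length A + length X)"]
      by (auto simp: DS_simps(2-) Brauer_simps(2-))
  qed ((elim Hom_DS_E Hom_OS_E)?;
      simp add: OS_simps(2-) DS_simps(2-) Brauer_simps(2-) DS_ops_cls F_mor_cls Brauer_ActF_cls Brauer_ActN_cls
        b_id bc_push add_ac)+
qed

lemma is_F_F: "is_F q t \<delta> length F_mor"
  unfolding is_F_def using strict_module_morphism_F
  by (simp add: toggle_def toggle'_def F_mor_cls Brauer_simps)

text \<open>The structure maps of a strict morphism are identities, so its values on right
  whiskerings and on the components of the action are prescribed. Every action term splits into
  these two by \<open>dc_split_act\<close>, and the toggles are given.\<close>

lemma is_F_unique:
  assumes "is_F q t \<delta> GO GM"
  shows "GO = length" and "ds_wf f \<Longrightarrow> GM (dc f) = bc (F f)"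
proof -
  from assms have G: "GO (ActO (DS q t \<delta>) A X) = ActO (Brauer q t \<delta>) (GO A) X" "GO [] = 0"
    "GM (dc DTau) = J 1" "GM (dc DTau') = J 1"
    and m: "module_morphism (OS q t \<delta>) (DS q t \<delta>) (Brauer q t \<delta>) GO GM
       (\<lambda>A X. Idn (Brauer q t \<delta>) (ActO (Brauer q t \<delta>) (GO A) X))" for A X
    by (auto simp: is_F_def strict_module_morphism_def toggle_def toggle'_def Brauer_simps)
  interpret module_morphism "OS q t \<delta>" "DS q t \<delta>" "Brauer q t \<delta>" GO GM
     "\<lambda>A X. Idn (Brauer q t \<delta>) (ActO (Brauer q t \<delta>) (GO A) X)"
    by (rule m)
  \<comment> \<open>Every word is the empty word acted on by that word, so strictness determines the
    objects.\<close>
  show GO: "GO = length"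
    using G(1)[of "[]"] G(2) by (simp add: fun_eq_iff DS_simps Brauer_simps)
  have actN: "GM (dc (DOs (OId X) \<otimes>\<^sub>D g)) = bc (br_act q t (length X) g)" if g: "os_wf g" for X g
  proof -
    have "oc g \<in> Hom (OS q t \<delta>) (os_dom g) (os_cod g)"
      using that unfolding in_Hom_OS by blast
    moreover obtain h where "br_wf h" "br_cod h = length X + length (os_cod g)"
      "GM (dc (DOs (OId X) \<otimes>\<^sub>D g)) = bc h"
    proof (rule Hom_Brauer_E)
      show "GM (dc (DOs (OId X) \<otimes>\<^sub>D g)) \<in> Hom (Brauer q t \<delta>) (length X + length (os_dom g)) (length X + length (os_cod g))"
        using F.functor_hom[OF dc_in_Hom[of "DOs (OId X) \<otimes>\<^sub>D g" "X @ os_dom g" "X @ os_cod g"]] g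
        by (simp add: GO)
    qed blast
    ultimately show ?thesis
      using omega_natural_right[of "oc g" "os_dom g" "os_cod g" X] that
      by (simp add: DS_simps(2-) Brauer_simps(2-) DS_ops_cls Brauer_ActN_cls GO b_id)
  qed
  have actF: "GM (dc (f \<otimes>\<^sub>D OId X)) = bc (br_shift (length X) h)"
    if f: "ds_wf f" "GM (dc f) = bc h" "br_wf h" "br_dom h = length (ds_dom f)" for f h X
  proof -
    obtain k where "br_wf k" "br_cod k = length (ds_cod f) + length X" "GM (dc (f \<otimes>\<^sub>D OId X)) = bc k"
    proof (rule Hom_Brauer_E)
      show "GM (dc (f \<otimes>\<^sub>D OId X)) \<in> Hom (Brauer q t \<delta>) (length (ds_dom f) + length X) (length (ds_cod f) + length X)"
        using F.functor_hom[OF dc_in_Hom[of "f \<otimes>\<^sub>D OId X" "ds_dom f @ X" "ds_cod f @ X"]] f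
        by (simp add: GO)
    qed blast
    moreover have "dc f \<in> Hom (DS q t \<delta>) (ds_dom f) (ds_cod f)"
      using that by (simp add: dc_in_Hom)
    ultimately show ?thesis
      using omega_natural_left[of "dc f" "ds_dom f" "ds_cod f" X] that
      by (simp add: DS_simps(2-) Brauer_simps(2-) DS_ops_cls Brauer_ActF_cls GO b_id)
  qed
  show "ds_wf f \<Longrightarrow> GM (dc f) = bc (F f)"
  proof (induction f)
    case (DOs g)
    have "dc (DOs g) = dc (DOs (OId []) \<otimes>\<^sub>D g)"
      by (simp add: dc_DOs_act dc_DOs[OF oc_ten_unit_left])
    then show ?case using actN[of g "[]"] DOs by simp
  next
    case (DAct f g)
    have "dc (f \<otimes>\<^sub>D g) = lift2 (ds_eq q t \<delta>) DCmp (dc (DOs (OId (ds_cod f)) \<otimes>\<^sub>D g)) (dc (f \<otimes>\<^sub>D OId (os_dom g)))"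
      unfolding D.ops_cls by (rule dc_split_act) simp_all
    moreover have "GM (lift2 (ds_eq q t \<delta>) DCmp (dc (DOs (OId (ds_cod f)) \<otimes>\<^sub>D g)) (dc (f \<otimes>\<^sub>D OId (os_dom g))))
       = GM (dc (DOs (OId (ds_cod f)) \<otimes>\<^sub>D g)) \<odot> GM (dc (f \<otimes>\<^sub>D OId (os_dom g)))"
      using F.functor_cmp[OF dc_in_Hom[OF _ refl refl] dc_in_Hom[OF _ _ refl], of "f \<otimes>\<^sub>D OId (os_dom g)" "DOs (OId (ds_cod f)) \<otimes>\<^sub>D g"] DAct.prems
      by (simp add: DS_simps(2-) Brauer_simps(2-))
    ultimately show ?case
      using DAct actN actF[of f "F f"] by (simp add: bc_push)
  next
    case (DCmp f g)
    then show ?case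
      using F.functor_cmp[OF dc_in_Hom[OF _ refl refl] dc_in_Hom[OF _ _ refl], of g f]
      by (simp add: DS_simps(2-) Brauer_simps(2-) bc_push D.ops_cls)
  next
    \<comment> \<open>Preservation of zero is not among the axioms of \<open>linear_functor\<close>;
      it is deduced from scaling by 0.\<close>
    case (DZer X Y)
    have "GM (dc (DZer X Y)) = GM (Scl (DS q t \<delta>) 0 (dc (DZer X Y)))"
      using D.Scl_zero_cls[of "DZer X Y"] by (simp add: DS_simps(2-))
    also have "\<dots> = Scl (Brauer q t \<delta>) 0 (GM (dc (DZer X Y)))"
      by (rule F.functor_scl[OF dc_in_Hom[OF _ refl refl]]) simp
    also have "\<dots> = bc (BZer (length X) (length Y))"
      using F.functor_hom[OF dc_in_Hom[of "DZer X Y" X Y]]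
      by (auto simp: GO B.Scl_zero_cls Brauer_simps(2-) elim!: Hom_Brauer_E)
    finally show ?case by simp
  next
    case (DPls f g)
    then show ?case
      using F.functor_pls[OF dc_in_Hom[OF _ refl refl] dc_in_Hom, of f g]
      by (simp add: DS_simps(2-) Brauer_simps(2-) bc_push D.ops_cls)
  next
    case (DScl a f)
    then show ?case
      using F.functor_scl[OF dc_in_Hom[OF _ refl refl], of f]
      by (simp add: DS_simps(2-) Brauer_simps(2-) bc_push D.ops_cls)
  qed (simp_all add: G)
qed

end

section \<open>Calculations in the disoriented skein category\<close>

context skein_parameters begin

abbreviation dcmp (infixr "\<star>" 70) where "M \<star> N \<equiv> lift2 (ds_eq q t \<delta>) DCmp M N"
abbreviation dpls (infixl "\<oplus>" 65) where "M \<oplus> N \<equiv> lift2 (ds_eq q t \<delta>) DPls M N"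
abbreviation dscl (infixr "\<bullet>" 75) where "a \<bullet> M \<equiv> lift1 (ds_eq q t \<delta>) (DScl a) M"
abbreviation E where "E X \<equiv> dc (DOs (OId X))"

lemmas dc_push = D.ops_cls[symmetric]
lemmas d_assoc = D.Cmp_assoc_cls
lemmas d_scl = D.Scl_Cmp_cls D.Cmp_Scl_cls D.Scl_Scl_cls D.Scl_one_cls D.Scl_one_Cmp_cls
lemmas d_re = D.Cmp_reassoc[unfolded d_assoc]

text \<open>Morphisms of the oriented skein category can be whiskered on both sides, toggles
  (\<open>tg\<close>, \<open>tg'\<close>) only on the right. With whiskers kept as words, the
  interchange laws show the position of each factor.\<close>

definition lt :: "ori list \<Rightarrow> 'k os \<Rightarrow> ori list \<Rightarrow> 'k ds set"
  where "lt X g Y = dc (DOs (OId X \<otimes>\<^sub>O g \<otimes>\<^sub>O OId Y))"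

definition tg :: "ori list \<Rightarrow> 'k ds set" where "tg Y = dc (DTau \<otimes>\<^sub>D OId Y)"
definition tg' :: "ori list \<Rightarrow> 'k ds set" where "tg' Y = dc (DTau' \<otimes>\<^sub>D OId Y)"

lemma E_lt:
  "Z = X @ os_cod g @ Y \<Longrightarrow> E Z \<star> lt X g Y = lt X g Y"
  "Z = X @ os_dom g @ Y \<Longrightarrow> lt X g Y \<star> E Z = lt X g Y"
  by (simp_all add: lt_def D.Id_left_cls D.Id_right_cls)

lemma E_tg:
  "Z = Up # Y \<Longrightarrow> E Z \<star> tg Y = tg Y" "Z = Dn # Y \<Longrightarrow> tg Y \<star> E Z = tg Y"
  "Z = Dn # Y \<Longrightarrow> E Z \<star> tg' Y = tg' Y" "Z = Up # Y \<Longrightarrow> tg' Y \<star> E Z = tg' Y"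
  by (simp_all add: tg_def tg'_def D.Id_left_cls D.Id_right_cls)

lemma E_E: "E X \<star> E X = E X"
  by (simp add: D.Id_left_cls)

lemmas d_id = E_lt E_tg E_E E_lt[THEN d_re] E_tg[THEN d_re] E_E[THEN d_re]

lemma is_cls_lt [simp]: "D.is_cls (lt X g Y)" "D.is_cls (tg Y)" "D.is_cls (tg' Y)"
  by (simp_all add: lt_def tg_def tg'_def D.is_cls_intros)

lemma oc_id_cmp: "oc (OId X) = oc (OId X \<cdot>\<^sub>O OId X)"
  by (simp add: O.cls_id_left)

lemma lt_cong: "oc g = oc h \<Longrightarrow> lt X g Y = lt X h Y"
  unfolding lt_def by (intro dc_DOs oc_ten refl)

lemma lt_cmp: "lt X (g \<cdot>\<^sub>O h) Y = lt X g Y \<star> lt X h Y"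
proof (cases "os_dom g = os_cod h")
  case True
  have "oc (OId X \<otimes>\<^sub>O (g \<cdot>\<^sub>O h) \<otimes>\<^sub>O OId Y) = oc (OId X \<otimes>\<^sub>O ((g \<cdot>\<^sub>O h) \<otimes>\<^sub>O (OId Y \<cdot>\<^sub>O OId Y)))"
    by (intro oc_ten refl oc_id_cmp)
  also have "\<dots> = oc ((OId X \<cdot>\<^sub>O OId X) \<otimes>\<^sub>O ((g \<otimes>\<^sub>O OId Y) \<cdot>\<^sub>O (h \<otimes>\<^sub>O OId Y)))"
    by (rule oc_ten, rule oc_id_cmp, rule oc_ten_cmp) (simp_all add: True)
  also have "\<dots> = oc ((OId X \<otimes>\<^sub>O g \<otimes>\<^sub>O OId Y) \<cdot>\<^sub>O (OId X \<otimes>\<^sub>O h \<otimes>\<^sub>O OId Y))"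
    by (rule oc_ten_cmp) (simp_all add: True)
  finally show ?thesis
    unfolding lt_def by (simp add: D.Cmp_cls flip: dc_DOs_cmp) (rule dc_DOs)
qed (simp add: lt_def D.Cmp_cls D.cls_ill)

lemma oc_interchange:
  assumes "os_cod h = V" "os_dom g = W"
  shows "oc (g \<otimes>\<^sub>O h) = oc ((g \<otimes>\<^sub>O OId V) \<cdot>\<^sub>O (OId W \<otimes>\<^sub>O h))"
proof -
  have "oc (g \<otimes>\<^sub>O h) = oc ((g \<cdot>\<^sub>O OId W) \<otimes>\<^sub>O (OId V \<cdot>\<^sub>O h))"
    by (rule oc_ten) (simp_all add: O.cls_id_left O.cls_id_right assms)
  also have "\<dots> = oc ((g \<otimes>\<^sub>O OId V) \<cdot>\<^sub>O (OId W \<otimes>\<^sub>O h))"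
    by (rule oc_ten_cmp) (simp_all add: assms)
  finally show ?thesis .
qed

lemma oc_interchange':
  assumes "os_dom h = V" "os_cod g = W"
  shows "oc (g \<otimes>\<^sub>O h) = oc ((OId W \<otimes>\<^sub>O h) \<cdot>\<^sub>O (g \<otimes>\<^sub>O OId V))"
proof -
  have "oc (g \<otimes>\<^sub>O h) = oc ((OId W \<cdot>\<^sub>O g) \<otimes>\<^sub>O (h \<cdot>\<^sub>O OId V))"
    by (rule oc_ten) (simp_all add: O.cls_id_left O.cls_id_right assms)
  also have "\<dots> = oc ((OId W \<otimes>\<^sub>O h) \<cdot>\<^sub>O (g \<otimes>\<^sub>O OId V))"
    by (rule oc_ten_cmp) (simp_all add: assms)
  finally show ?thesis .
qed

lemma lt_left: "lt X (OId Y \<otimes>\<^sub>O g) Z = lt (X @ Y) g Z"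
proof -
  have "oc (OId X \<otimes>\<^sub>O (OId Y \<otimes>\<^sub>O g) \<otimes>\<^sub>O OId Z) = oc (OId X \<otimes>\<^sub>O (OId Y \<otimes>\<^sub>O (g \<otimes>\<^sub>O OId Z)))"
    by (intro oc_ten refl oc_ten_assoc)
  also have "\<dots> = oc ((OId X \<otimes>\<^sub>O OId Y) \<otimes>\<^sub>O (g \<otimes>\<^sub>O OId Z))"
    by (rule oc_ten_assoc[symmetric])
  also have "\<dots> = oc (OId (X @ Y) \<otimes>\<^sub>O (g \<otimes>\<^sub>O OId Z))"
    by (intro oc_ten refl oc_ten_id)
  finally show ?thesis unfolding lt_def by (rule dc_DOs)
qed

lemma lt_right: "lt X (g \<otimes>\<^sub>O OId Y) Z = lt X g (Y @ Z)"
proof -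
  have "oc (OId X \<otimes>\<^sub>O (g \<otimes>\<^sub>O OId Y) \<otimes>\<^sub>O OId Z) = oc (OId X \<otimes>\<^sub>O (g \<otimes>\<^sub>O (OId Y \<otimes>\<^sub>O OId Z)))"
    by (intro oc_ten refl oc_ten_assoc)
  also have "\<dots> = oc (OId X \<otimes>\<^sub>O (g \<otimes>\<^sub>O OId (Y @ Z)))"
    by (intro oc_ten refl oc_ten_id)
  finally show ?thesis unfolding lt_def by (rule dc_DOs)
qed

lemma lt_id: "lt X (OId Z) Y = E (X @ Z @ Y)"
proof -
  have "oc (OId X \<otimes>\<^sub>O OId Z \<otimes>\<^sub>O OId Y) = oc (OId X \<otimes>\<^sub>O OId (Z @ Y))"
    by (intro oc_ten refl oc_ten_id)
  also have "\<dots> = oc (OId (X @ Z @ Y))"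
    by (rule oc_ten_id)
  finally show ?thesis unfolding lt_def by (rule dc_DOs)
qed

lemma lt_scl: "lt X (OScl a g) Y = a \<bullet> lt X g Y"
proof -
  have "oc (OId X \<otimes>\<^sub>O OScl a g \<otimes>\<^sub>O OId Y) = oc (OId X \<otimes>\<^sub>O OScl a (g \<otimes>\<^sub>O OId Y))"
    by (intro oc_ten refl oc_scl_ten)
  also have "\<dots> = oc (OScl a (OId X \<otimes>\<^sub>O g \<otimes>\<^sub>O OId Y))"
    by (rule oc_ten_scl)
  finally show ?thesis unfolding lt_def by (simp add: D.Scl_cls flip: dc_DOs_scl) (rule dc_DOs)
qed

lemma lt_pls: "lt X (OPls f g) Y = lt X f Y \<oplus> lt X g Y"
proof -
  have "oc (OId X \<otimes>\<^sub>O OPls f g \<otimes>\<^sub>O OId Y) = oc (OId X \<otimes>\<^sub>O OPls (f \<otimes>\<^sub>O OId Y) (g \<otimes>\<^sub>O OId Y))"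
    by (intro oc_ten refl oc_pls_ten)
  also have "\<dots> = oc (OPls (OId X \<otimes>\<^sub>O f \<otimes>\<^sub>O OId Y) (OId X \<otimes>\<^sub>O g \<otimes>\<^sub>O OId Y))"
    by (rule oc_ten_pls)
  finally show ?thesis unfolding lt_def by (simp add: D.Pls_cls flip: dc_DOs_pls) (rule dc_DOs)
qed

lemma lt_ten: "lt X (g \<otimes>\<^sub>O h) Y = lt X g (os_cod h @ Y) \<star> lt (X @ os_dom g) h Y"
  using lt_cong[OF oc_interchange[OF refl refl, of g h], of X Y]
  by (simp add: lt_cmp lt_left lt_right)

lemma lt_ten': "lt X (g \<otimes>\<^sub>O h) Y = lt (X @ os_cod g) h Y \<star> lt X g (os_dom h @ Y)"
  using lt_cong[OF oc_interchange'[OF refl refl, of g h], of X Y]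
  by (simp add: lt_cmp lt_left lt_right)

text \<open>\<open>Y\<close> is the word separating the two morphisms, so this covers all pairs in
  disjoint positions.\<close>

lemma lt_interchange:
  "lt X g (Y @ os_cod h @ Z) \<star> lt (X @ os_dom g @ Y) h Z = lt (X @ os_cod g @ Y) h Z \<star> lt X g (Y @ os_dom h @ Z)"
  using lt_ten[of X g "OId Y \<otimes>\<^sub>O h" Z] lt_ten'[of X g "OId Y \<otimes>\<^sub>O h" Z] by (simp add: lt_left)

lemmas lts = lt_cmp lt_left lt_right lt_id lt_scl lt_pls

lemma DOs_act_lt: "dc (DOs (OId X) \<otimes>\<^sub>D (OId Y \<otimes>\<^sub>O g \<otimes>\<^sub>O OId Z)) = lt (X @ Y) g Z"
proof -
  have "oc (OId X \<otimes>\<^sub>O OId Y \<otimes>\<^sub>O (g \<otimes>\<^sub>O OId Z)) = oc ((OId X \<otimes>\<^sub>O OId Y) \<otimes>\<^sub>O (g \<otimes>\<^sub>O OId Z))"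
    by (rule oc_ten_assoc[symmetric])
  also have "\<dots> = oc (OId (X @ Y) \<otimes>\<^sub>O (g \<otimes>\<^sub>O OId Z))"
    by (intro oc_ten refl oc_ten_id)
  finally show ?thesis unfolding lt_def dc_DOs_act by (rule dc_DOs)
qed

lemma DOs_lt: "dc (DOs g) = lt [] g []"
proof -
  have "oc (OId [] \<otimes>\<^sub>O g \<otimes>\<^sub>O OId []) = oc (OId [] \<otimes>\<^sub>O g)"
    by (intro oc_ten refl oc_ten_unit_right)
  also have "\<dots> = oc g"
    by (rule oc_ten_unit_left)
  finally show ?thesis unfolding lt_def by (intro dc_DOs) (rule sym)
qed

lemma tg_interchange:
  "tg (X @ os_cod g @ Y) \<star> lt (Dn # X) g Y = lt (Up # X) g Y \<star> tg (X @ os_dom g @ Y)"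
  "tg' (X @ os_cod g @ Y) \<star> lt (Up # X) g Y = lt (Dn # X) g Y \<star> tg' (X @ os_dom g @ Y)"
proof -
  have 1: "dc (f \<otimes>\<^sub>D OId (X @ os_cod g @ Y)) \<star> lt (ds_dom f @ X) g Y
      = lt (ds_cod f @ X) g Y \<star> dc (f \<otimes>\<^sub>D OId (X @ os_dom g @ Y))" for f
    using dc_split_act[of "OId X \<otimes>\<^sub>O g \<otimes>\<^sub>O OId Y" _ f] dc_split_act'[of "OId X \<otimes>\<^sub>O g \<otimes>\<^sub>O OId Y" _ f]
    by (simp add: dc_push DOs_act_lt)
  show "tg (X @ os_cod g @ Y) \<star> lt (Dn # X) g Y = lt (Up # X) g Y \<star> tg (X @ os_dom g @ Y)"
    "tg' (X @ os_cod g @ Y) \<star> lt (Up # X) g Y = lt (Dn # X) g Y \<star> tg' (X @ os_dom g @ Y)"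
    using 1[of DTau] 1[of DTau'] by (simp_all add: tg_def tg'_def)
qed

text \<open>The toggle relations are given without further strands on the right; \<open>rt Y\<close>
  carries them to any right-hand word.\<close>

definition rt :: "ori list \<Rightarrow> 'k ds set \<Rightarrow> 'k ds set"
  where "rt Z M = lift1 (ds_eq q t \<delta>) (\<lambda>f. f \<otimes>\<^sub>D OId Z) M"

lemma rt_cls: "rt Z (dc f) = dc (f \<otimes>\<^sub>D OId Z)"
  by (simp add: rt_def DS_ActF_cls)

lemma rt_UN: "rt Z (\<Union>i\<in>K. N i) = (\<Union>i\<in>K. rt Z (N i))"
  unfolding rt_def by (rule D.lift1_UN)

lemma rt_cmp: "rt Z (M \<star> N) = rt Z M \<star> rt Z N"
proof -
  have "rt Z (M \<star> N) = (\<Union>f\<in>M. \<Union>g\<in>N. dc ((f \<otimes>\<^sub>D OId Z) \<cdot>\<^sub>D (g \<otimes>\<^sub>D OId Z)))"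
    unfolding lift2_def[of _ _ M] rt_UN rt_cls dc_whisker_right_cmp ..
  also have "\<dots> = rt Z M \<star> rt Z N"
    unfolding rt_def lift1_def D.lift2_UN D.Cmp_cls by auto
  finally show ?thesis .
qed

lemma rt_scl: "rt Z (a \<bullet> M) = a \<bullet> rt Z M"
proof -
  have "rt Z (a \<bullet> M) = (\<Union>f\<in>M. dc (DScl a (f \<otimes>\<^sub>D OId Z)))"
    unfolding lift1_def[of _ _ M] rt_UN rt_cls dc_scl_act ..
  also have "\<dots> = a \<bullet> rt Z M"
    unfolding rt_def lift1_def[of _ _ M] D.lift1_UN D.Scl_cls ..
  finally show ?thesis .
qed

lemma rt_lt: "rt Z (lt X g Y) = lt X g (Y @ Z)"
proof -
  have "oc ((OId X \<otimes>\<^sub>O g \<otimes>\<^sub>O OId Y) \<otimes>\<^sub>O OId Z) = oc (OId X \<otimes>\<^sub>O ((g \<otimes>\<^sub>O OId Y) \<otimes>\<^sub>O OId Z))"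
    by (rule oc_ten_assoc)
  also have "\<dots> = oc (OId X \<otimes>\<^sub>O (g \<otimes>\<^sub>O (OId Y \<otimes>\<^sub>O OId Z)))"
    by (intro oc_ten refl oc_ten_assoc)
  also have "\<dots> = oc (OId X \<otimes>\<^sub>O (g \<otimes>\<^sub>O OId (Y @ Z)))"
    by (intro oc_ten refl oc_ten_id)
  finally show ?thesis unfolding lt_def rt_cls dc_DOs_act by (rule dc_DOs)
qed

lemma rt_tg: "rt Z (tg Y) = tg (Y @ Z)" "rt Z (tg' Y) = tg' (Y @ Z)"
  unfolding tg_def tg'_def rt_cls dc_act_act by (intro dc_Act refl oc_ten_id)+

lemma rt_E: "rt Z (E X) = E (X @ Z)"
  by (simp add: rt_cls dc_whisker_id)

lemmas rts = rt_cmp rt_scl rt_lt rt_tg rt_E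

section \<open>Relations of the oriented skein category in arbitrary position\<close>

lemma lt_rel: "os_rel q t \<delta> g h \<Longrightarrow> lt X g Y = lt X h Y"
  by (rule lt_cong, rule O.cls_eq, rule os_eq.os_rel)

abbreviation R where "R \<equiv> R_of OXp"
abbreviation L where "L \<equiv> L_of OXm"

lemma RL_typing [simp]:
  "os_dom (R_of g) = [Up, Dn]" "os_cod (R_of g) = [Dn, Up]" "os_dom (L_of g) = [Dn, Up]" "os_cod (L_of g) = [Up, Dn]"
  "os_dom (D_of g) = [Dn, Dn]" "os_cod (D_of g) = [Dn, Dn]"
  by (simp_all add: R_of_def L_of_def D_of_def)

lemma x_inv: "lt X OXp Y \<star> lt X OXm Y = E (X @ Up # Up # Y)" "lt X OXm Y \<star> lt X OXp Y = E (X @ Up # Up # Y)"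
  using lt_rel[OF os_rel.intros(1), of X Y] lt_rel[OF os_rel.intros(2), of X Y] by (simp_all add: lts)

lemma R_inv: "lt X L Y \<star> lt X R Y = E (X @ Up # Dn # Y)" "lt X R Y \<star> lt X L Y = E (X @ Dn # Up # Y)"
  using lt_rel[OF os_rel.intros(4), of X Y] lt_rel[OF os_rel.intros(5), of X Y] by (simp_all add: lts)

lemma x_braid:
  "lt X OXp (Up # Y) \<star> lt (X @ [Up]) OXp Y \<star> lt X OXp (Up # Y) =
   lt (X @ [Up]) OXp Y \<star> lt X OXp (Up # Y) \<star> lt (X @ [Up]) OXp Y"
  using lt_rel[OF os_rel.intros(3), of X Y] by (simp add: lts d_assoc)

lemma x_skein: "lt X OXp Y \<oplus> (- 1) \<bullet> lt X OXm Y = z \<bullet> E (X @ Up # Up # Y)"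
  using lt_rel[OF os_rel.intros(6), of X Y] by (simp add: lts)

lemma twist: "lt X Od' (Up # Y) \<star> lt (X @ [Dn]) OXp Y \<star> lt X Oc (Up # Y) = t \<bullet> E (X @ Up # Y)"
  using lt_rel[OF os_rel.intros(7), of X Y] by (simp add: lts d_assoc)

lemma twist': "lt (X @ [Up]) Od Y \<star> lt X OXp (Dn # Y) \<star> lt (X @ [Up]) Oc' Y = t \<bullet> E (X @ Up # Y)"
  using lt_rel[OF os_rel.intros(8), of X Y] by (simp add: lts d_assoc)

lemma bubble: "lt X Od Y \<star> lt X Oc' Y = \<delta> \<bullet> E (X @ Y)"
  using lt_rel[OF os_rel.intros(9), of X Y] by (simp add: lts)

lemma zigzag: "lt X Od (Up # Y) \<star> lt (X @ [Up]) Oc Y = E (X @ Up # Y)"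
  using lt_rel[OF os_rel.intros(10), of X Y] by (simp add: lts)

lemma zigzag': "lt (X @ [Dn]) Od Y \<star> lt X Oc (Dn # Y) = E (X @ Dn # Y)"
  using lt_rel[OF os_rel.intros(11), of X Y] by (simp add: lts)

lemmas d_cancel = d_assoc x_inv x_inv[THEN d_re] R_inv R_inv[THEN d_re] d_id

text \<open>The mate of \<open>g : \<up> b \<rightarrow> b' \<up>\<close> under the adjunction given by c and d.\<close>

definition mate :: "'k os \<Rightarrow> ori \<Rightarrow> ori \<Rightarrow> 'k os"
  where "mate g b b' = (OId [Dn, b'] \<otimes>\<^sub>O Od) \<cdot>\<^sub>O (OId [Dn] \<otimes>\<^sub>O g \<otimes>\<^sub>O OId [Dn]) \<cdot>\<^sub>O (Oc \<otimes>\<^sub>O OId [b, Dn])"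

text \<open>Composing the mate with a further cup creates a zigzag at its cap, which straightens
  once the interchange law has brought the two together.\<close>

lemma mate_c:
  assumes "os_dom g = [Up, b]" "os_cod g = [b', Up]"
  shows "lt X (mate g b b') (Up # Y) \<star> lt (X @ [b]) Oc Y = lt (X @ [Dn]) g Y \<star> lt X Oc (b # Y)"
proof -
  have "lt X (mate g b b') (Up # Y) \<star> lt (X @ [b]) Oc Y =
    lt (X @ [Dn, b']) Od (Up # Y) \<star> lt (X @ [Dn]) g (Dn # Up # Y) \<star> lt X Oc (b # Dn # Up # Y) \<star> lt (X @ [b]) Oc Y"
    by (simp add: mate_def lts d_assoc)
  also have "\<dots> = lt (X @ [Dn, b']) Od (Up # Y) \<star> lt (X @ [Dn, b', Up]) Oc Y \<star> lt (X @ [Dn]) g Y \<star> lt X Oc (b # Y)"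
    using lt_interchange[of X Oc "[b]" Oc Y] lt_interchange[of "X @ [Dn]" g "[]" Oc Y, THEN d_re] assms
    by (simp add: d_assoc)
  also have "\<dots> = lt (X @ [Dn]) g Y \<star> lt X Oc (b # Y)"
    using zigzag[of "X @ [Dn, b']" Y, THEN d_re] assms by (simp add: d_id)
  finally show ?thesis .
qed

lemma mate_d:
  assumes "os_dom g = [Up, b]" "os_cod g = [b', Up]"
  shows "lt (X @ [b']) Od Y \<star> lt X g (Dn # Y) = lt X Od (b' # Y) \<star> lt (X @ [Up]) (mate g b b') Y"
proof -
  have "lt X Od (b' # Y) \<star> lt (X @ [Up]) (mate g b b') Y =
    lt X Od (b' # Y) \<star> lt (X @ [Up, Dn, b']) Od Y \<star> lt (X @ [Up, Dn]) g (Dn # Y) \<star> lt (X @ [Up]) Oc (b # Dn # Y)"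
    by (simp add: mate_def lts d_assoc)
  also have "\<dots> = lt (X @ [b']) Od Y \<star> lt X g (Dn # Y) \<star> lt X Od (Up # b # Dn # Y) \<star> lt (X @ [Up]) Oc (b # Dn # Y)"
    using lt_interchange[of X Od "[b']" Od Y, THEN d_re] lt_interchange[of X Od "[]" g "Dn # Y", THEN d_re] assms
    by (simp add: d_assoc)
  also have "\<dots> = lt (X @ [b']) Od Y \<star> lt X g (Dn # Y)"
    using zigzag[of X "b # Dn # Y"] assms by (simp add: d_id)
  finally show ?thesis ..
qed

section \<open>Sliding crossings past the oriented cups and caps\<close>

lemma R_mate: "R_of g = mate g Up Up" and D_mate: "D_of g = mate (R_of g) Dn Dn"
  by (simp_all add: R_of_def D_of_def mate_def)

lemma R_c: "os_dom g = [Up, Up] \<Longrightarrow> os_cod g = [Up, Up] \<Longrightarrow>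
    lt X (R_of g) (Up # Y) \<star> lt (X @ [Up]) Oc Y = lt (X @ [Dn]) g Y \<star> lt X Oc (Up # Y)"
  unfolding R_mate by (rule mate_c)

lemma R_d: "os_dom g = [Up, Up] \<Longrightarrow> os_cod g = [Up, Up] \<Longrightarrow>
    lt (X @ [Up]) Od Y \<star> lt X g (Dn # Y) = lt X Od (Up # Y) \<star> lt (X @ [Up]) (R_of g) Y"
  unfolding R_mate by (rule mate_d)

lemma D_c: "lt X (D_of g) (Up # Y) \<star> lt (X @ [Dn]) Oc Y = lt (X @ [Dn]) (R_of g) Y \<star> lt X Oc (Dn # Y)"
  unfolding D_mate by (rule mate_c) simp_all

lemma D_d: "lt (X @ [Dn]) Od Y \<star> lt X (R_of g) (Dn # Y) = lt X Od (Dn # Y) \<star> lt (X @ [Up]) (D_of g) Y"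
  unfolding D_mate by (rule mate_d) simp_all

text \<open>Morphisms whose target begins with \<open>\<down>\<close>, or whose source ends with \<open>\<down>\<close>, are determined by
  their transposes.\<close>

lemma bend_d:
  assumes f: "os_cod f = Dn # V" "os_dom f = W" and g: "os_cod g = Dn # V" "os_dom g = W"
    and eq: "\<And>X. lt X Od (V @ Y) \<star> lt (X @ [Up]) f Y = lt X Od (V @ Y) \<star> lt (X @ [Up]) g Y"
  shows "lt X f Y = lt X g Y"
proof -
  have "lt (X @ [Dn]) Od (V @ Y) \<star> lt (X @ [Dn, Up]) h Y \<star> lt X Oc (W @ Y) = lt X h Y"
    if "os_cod h = Dn # V" "os_dom h = W" for h
    using that lt_interchange[of X Oc "[]" h Y, symmetric] zigzag'[of X "V @ Y", THEN d_re]
    by (simp add: d_id)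
  from this[OF f] this[OF g] eq[of "X @ [Dn]", THEN d_re] show ?thesis
    by (simp add: d_assoc)
qed

lemma bend_c:
  assumes f: "os_dom f = W @ [Dn]" "os_cod f = V" and g: "os_dom g = W @ [Dn]" "os_cod g = V"
    and eq: "\<And>Y. lt X f (Up # Y) \<star> lt (X @ W) Oc Y = lt X g (Up # Y) \<star> lt (X @ W) Oc Y"
  shows "lt X f Y = lt X g Y"
proof -
  have "lt (X @ V) Od Y \<star> lt X h (Up # Dn # Y) \<star> lt (X @ W) Oc (Dn # Y) = lt X h Y"
    if "os_dom h = W @ [Dn]" "os_cod h = V" for h
    using that lt_interchange[of X h "[]" Od Y, symmetric, THEN d_re] zigzag'[of "X @ W" Y]
    by (simp add: d_id d_assoc)
  from this[OF f] this[OF g] eq[of "Dn # Y"] show ?thesis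
    by simp
qed

text \<open>Bending the first arrow up turns \<open>R\<close> into a crossing by \<open>R_d\<close>;
  the claim becomes the second kink relation \<open>twist'\<close>.\<close>

lemma R_c': "lt X R Y \<star> lt X Oc' Y = t \<bullet> lt X Oc Y"
proof -
  have "lt X (R \<cdot>\<^sub>O Oc') Y = lt X (OScl t Oc) Y"
  proof (rule bend_d[where V = "[Up]" and W = "[]"])
    fix X
    have "lt X Od ([Up] @ Y) \<star> lt (X @ [Up]) (R \<cdot>\<^sub>O Oc') Y
      = lt (X @ [Up]) Od Y \<star> lt X OXp (Dn # Y) \<star> lt (X @ [Up]) Oc' Y"
      using R_d[of OXp X Y, symmetric, THEN d_re] by (simp add: lts d_assoc)
    also have "\<dots> = lt X Od ([Up] @ Y) \<star> lt (X @ [Up]) (OScl t Oc) Y"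
      using twist'[of X Y] zigzag[of X Y] by (simp add: lts d_scl)
    finally show "lt X Od ([Up] @ Y) \<star> lt (X @ [Up]) (R \<cdot>\<^sub>O Oc') Y = \<dots>" .
  qed simp_all
  then show ?thesis by (simp add: lts)
qed

text \<open>The transposed argument: after composing with a cup, \<open>R_c\<close> leads to the
  first kink relation \<open>twist\<close>.\<close>

lemma d'_R: "lt X Od' Y \<star> lt X R Y = t \<bullet> lt X Od Y"
proof -
  have "lt X (Od' \<cdot>\<^sub>O R) Y = lt X (OScl t Od) Y"
  proof (rule bend_c[where V = "[]" and W = "[Up]"])
    fix Y
    have "lt X (Od' \<cdot>\<^sub>O R) (Up # Y) \<star> lt (X @ [Up]) Oc Y
      = lt X Od' (Up # Y) \<star> lt (X @ [Dn]) OXp Y \<star> lt X Oc (Up # Y)"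
      using R_c[of OXp X Y] by (simp add: lts d_assoc)
    also have "\<dots> = lt X (OScl t Od) (Up # Y) \<star> lt (X @ [Up]) Oc Y"
      using twist[of X Y] zigzag[of X Y] by (simp add: lts d_scl)
    finally show "lt X (Od' \<cdot>\<^sub>O R) (Up # Y) \<star> lt (X @ [Up]) Oc Y = \<dots>" .
  qed simp_all
  then show ?thesis by (simp add: lts)
qed

text \<open>\<open>R\<close> has the inverse \<open>L\<close>, so \<open>R_c'\<close> can be solved
  for \<open>c'\<close>. Together with \<open>d'_eq\<close> this reduces naturality of the
  comparison at \<open>c'\<close> and \<open>d'\<close> to that at \<open>c\<close>,
  \<open>d\<close> and \<open>L\<close>.\<close>

lemma c'_eq: "lt X Oc' Y = t \<bullet> lt X L Y \<star> lt X Oc Y"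
proof -
  have "lt X Oc' Y = lt X L Y \<star> (lt X R Y \<star> lt X Oc' Y)"
    by (simp add: d_cancel)
  then show ?thesis unfolding R_c' by (simp add: d_scl)
qed

lemma d'_eq: "lt X Od' Y = t \<bullet> lt X Od Y \<star> lt X L Y"
proof -
  have "lt X Od' Y = (lt X Od' Y \<star> lt X R Y) \<star> lt X L Y"
    by (simp add: d_cancel)
  then show ?thesis unfolding d'_R by (simp add: d_scl)
qed

text \<open>Both this circle and the one in \<open>bubble\<close> reduce to \<open>t\<close> times
  \<open>d L c\<close>.\<close>

lemma d'_c: "lt X Od' Y \<star> lt X Oc Y = \<delta> \<bullet> E (X @ Y)"
  using bubble[of X Y] by (simp add: d'_eq c'_eq d_scl d_assoc)

text \<open>The braid relation with one strand reversed. Bending the downward strand up turns each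
  \<open>R\<close> into a crossing by \<open>R_d\<close> and leaves the braid relation
  \<open>x_braid\<close>.\<close>

lemma RRx:
  "lt X R (Up # Y) \<star> lt (X @ [Up]) R Y \<star> lt X OXp (Dn # Y)
    = lt (X @ [Dn]) OXp Y \<star> lt X R (Up # Y) \<star> lt (X @ [Up]) R Y"
proof -
  let ?f = "(R \<otimes>\<^sub>O OId [Up]) \<cdot>\<^sub>O (OId [Up] \<otimes>\<^sub>O R) \<cdot>\<^sub>O (OXp \<otimes>\<^sub>O OId [Dn])"
  let ?g = "(OId [Dn] \<otimes>\<^sub>O OXp) \<cdot>\<^sub>O (R \<otimes>\<^sub>O OId [Up]) \<cdot>\<^sub>O (OId [Up] \<otimes>\<^sub>O R)"
  have "lt X ?f Y = lt X ?g Y"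
  proof (rule bend_d[where V = "[Up, Up]" and W = "[Up, Up, Dn]"])
    fix X
    let ?d = "lt (X @ [Up, Up]) Od Y" and ?x = "lt X OXp (Up # Dn # Y)" and ?y = "lt (X @ [Up]) OXp (Dn # Y)"
    have 1: "lt X Od (Up # Up # Y) \<star> lt (X @ [Up]) R (Up # Y) = lt (X @ [Up]) Od (Up # Y) \<star> lt X OXp (Dn # Up # Y)"
      using R_d[of OXp X "Up # Y"] by simp
    have 2: "lt X OXp (Dn # Up # Y) \<star> lt (X @ [Up, Up]) R Y = lt (X @ [Up, Up]) R Y \<star> ?x"
      using lt_interchange[of X OXp "[]" R Y] by simp
    have 3: "lt (X @ [Up]) Od (Up # Y) \<star> lt (X @ [Up, Up]) R Y = ?d \<star> ?y"
      using R_d[of OXp "X @ [Up]" Y] by simp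
    have 4: "lt X Od (Up # Up # Y) \<star> lt (X @ [Up, Dn]) OXp Y = lt X OXp Y \<star> lt X Od (Up # Up # Y)"
      using lt_interchange[of X Od "[]" OXp Y] by simp
    have 5: "lt X OXp Y \<star> ?d = ?d \<star> ?x"
      using lt_interchange[of X OXp "[]" Od Y] by simp
    have 6: "lt X Od (Up # Up # Y) \<star> lt (X @ [Up]) R (Up # Y) \<star> lt (X @ [Up, Up]) R Y = ?d \<star> ?y \<star> ?x"
      by (simp add: 1[THEN d_re] 2 3[THEN d_re] d_assoc)
    have "lt X Od (Up # Up # Y) \<star> lt (X @ [Up]) R (Up # Y) \<star> lt (X @ [Up, Up]) R Y \<star> ?y = ?d \<star> ?y \<star> ?x \<star> ?y"
      using 6 by (simp flip: d_assoc)
    also have "\<dots> = ?d \<star> ?x \<star> ?y \<star> ?x"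
      using x_braid[of X "Dn # Y"] by simp
    also have "\<dots> = lt X Od (Up # Up # Y) \<star> lt (X @ [Up, Dn]) OXp Y \<star> lt (X @ [Up]) R (Up # Y) \<star> lt (X @ [Up, Up]) R Y"
      by (simp add: 4[THEN d_re] 6 5[THEN d_re] d_assoc)
    finally show "lt X Od ([Up, Up] @ Y) \<star> lt (X @ [Up]) ?f Y = lt X Od ([Up, Up] @ Y) \<star> lt (X @ [Up]) ?g Y"
      by (simp add: lts d_assoc)
  qed simp_all
  then show ?thesis by (simp add: lts)
qed

text \<open>The cap is treated as \<open>t\<close> times \<open>d L\<close>: \<open>RRx\<close>
  brings an \<open>R\<close> next to \<open>d\<close>, and \<open>R_d\<close> moves \<open>d\<close>
  to the other side of the strand.\<close>

lemma d'_slide: "lt X Od' (Up # Y) \<star> lt (X @ [Dn]) OXm Y \<star> lt X R (Up # Y) = lt (X @ [Up]) Od' Y"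
proof -
  have "lt (X @ [Dn]) OXm Y \<star> lt X R (Up # Y) =
    lt (X @ [Dn]) OXm Y \<star> (lt X R (Up # Y) \<star> lt (X @ [Up]) R Y \<star> lt X OXp (Dn # Y)) \<star> lt X OXm (Dn # Y) \<star> lt (X @ [Up]) L Y"
    by (simp add: d_cancel)
  also have "\<dots> = lt X R (Up # Y) \<star> lt (X @ [Up]) R Y \<star> lt X OXm (Dn # Y) \<star> lt (X @ [Up]) L Y"
    unfolding RRx by (simp add: d_cancel)
  finally have 1: "lt (X @ [Dn]) OXm Y \<star> lt X R (Up # Y) = \<dots>" .
  have "lt X Od' (Up # Y) \<star> lt (X @ [Dn]) OXm Y \<star> lt X R (Up # Y)
    = t \<bullet> (lt X Od (Up # Y) \<star> lt (X @ [Up]) R Y) \<star> lt X OXm (Dn # Y) \<star> lt (X @ [Up]) L Y"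
    unfolding 1 d'_eq by (simp add: d_cancel d_scl)
  also have "\<dots> = lt (X @ [Up]) Od' Y"
    using R_d[of OXp X Y, symmetric] by (simp add: d'_eq d_cancel d_scl)
  finally show ?thesis .
qed

text \<open>The crossing D is X rotated by a half turn.\<close>

lemma d_d_D:
  assumes "g = OXp \<or> g = OXm"
  shows "lt X Od Y \<star> lt (X @ [Up]) Od (Dn # Y) \<star> lt (X @ [Up, Up]) (D_of g) Y
    = lt X Od Y \<star> lt (X @ [Up]) Od (Dn # Y) \<star> lt X g (Dn # Dn # Y)"
proof -
  have g: "os_dom g = [Up, Up]" "os_cod g = [Up, Up]" using assms by auto
  have i: "lt X Od Y \<star> lt (X @ [Up, Dn]) Od Y = lt X Od Y \<star> lt X Od (Up # Dn # Y)"
    using lt_interchange[of X Od "[]" Od Y] by simp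
  have "lt X Od Y \<star> lt (X @ [Up]) Od (Dn # Y) \<star> lt (X @ [Up, Up]) (D_of g) Y
    = lt X Od Y \<star> lt (X @ [Up, Dn]) Od Y \<star> lt (X @ [Up]) (R_of g) (Dn # Y)"
    using D_d[of "X @ [Up]" Y g] by simp
  also have "\<dots> = lt X Od Y \<star> lt X Od (Up # Dn # Y) \<star> lt (X @ [Up]) (R_of g) (Dn # Y)"
    using i[THEN d_re] by (simp add: d_assoc)
  also have "\<dots> = lt X Od Y \<star> lt (X @ [Up]) Od (Dn # Y) \<star> lt X g (Dn # Dn # Y)"
    using R_d[OF g, of X "Dn # Y"] by simp
  finally show ?thesis .
qed

text \<open>Bending both downward strands turns \<open>D_of g\<close> into \<open>g\<close> by
  \<open>d_d_D\<close>, so the claim reduces to \<open>g\<close> and \<open>h\<close> being inverse.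
  The bending is done one strand at a time, with the first in the intermediate equation.\<close>

lemma D_inv_aux:
  assumes "g = OXp \<and> h = OXm \<or> g = OXm \<and> h = OXp"
  shows "lt X (D_of g) Y \<star> lt X (D_of h) Y = E (X @ Dn # Dn # Y)"
proof -
  have g: "os_dom g = [Up, Up]" "os_cod g = [Up, Up]" "os_dom h = [Up, Up]" "os_cod h = [Up, Up]" using assms by auto
  have gh: "g = OXp \<or> g = OXm" "h = OXp \<or> h = OXm" using assms by auto
  have inv: "lt X h Y \<star> lt X g Y = E (X @ Up # Up # Y)" for X Y
    using assms x_inv by auto
  have 1: "lt X ((OId [Dn] \<otimes>\<^sub>O Od) \<cdot>\<^sub>O (R_of g \<otimes>\<^sub>O OId [Dn]) \<cdot>\<^sub>O (OId [Up] \<otimes>\<^sub>O D_of h)) Y = lt X (Od \<otimes>\<^sub>O OId [Dn]) Y" for X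
  proof (rule bend_d[where V = "[]" and W = "[Up, Dn, Dn]"])
    fix X
    let ?d = "lt X Od Y \<star> lt (X @ [Up]) Od (Dn # Y)"
    have "lt X Od Y \<star> lt (X @ [Up, Dn]) Od Y \<star> lt (X @ [Up]) (R_of g) (Dn # Y) \<star> lt (X @ [Up, Up]) (D_of h) Y
      = (?d \<star> lt (X @ [Up, Up]) (D_of g) Y) \<star> lt (X @ [Up, Up]) (D_of h) Y"
      using D_d[of "X @ [Up]" Y g, THEN d_re] by (simp add: d_assoc)
    also have "\<dots> = ?d \<star> lt X g (Dn # Dn # Y) \<star> lt (X @ [Up, Up]) (D_of h) Y"
      using d_d_D[OF gh(1), of X Y, THEN d_re] by (simp add: d_assoc)
    also have "\<dots> = (?d \<star> lt (X @ [Up, Up]) (D_of h) Y) \<star> lt X g (Dn # Dn # Y)"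
      using lt_interchange[of X g "[]" "D_of h" Y] g by (simp add: d_assoc)
    also have "\<dots> = ?d"
      using d_d_D[OF gh(2), of X Y, THEN d_re] inv[of X "Dn # Dn # Y"] by (simp add: d_assoc d_id)
    finally show "lt X Od ([] @ Y) \<star> lt (X @ [Up]) ((OId [Dn] \<otimes>\<^sub>O Od) \<cdot>\<^sub>O (R_of g \<otimes>\<^sub>O OId [Dn]) \<cdot>\<^sub>O (OId [Up] \<otimes>\<^sub>O D_of h)) Y
      = lt X Od ([] @ Y) \<star> lt (X @ [Up]) (Od \<otimes>\<^sub>O OId [Dn]) Y"
      by (simp add: lts d_assoc)
  qed simp_all
  have "lt X (D_of g \<cdot>\<^sub>O D_of h) Y = lt X (OId [Dn, Dn]) Y"
  proof (rule bend_d[where V = "[Dn]" and W = "[Dn, Dn]"])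
    fix X
    show "lt X Od ([Dn] @ Y) \<star> lt (X @ [Up]) (D_of g \<cdot>\<^sub>O D_of h) Y = lt X Od ([Dn] @ Y) \<star> lt (X @ [Up]) (OId [Dn, Dn]) Y"
      using 1[of X] D_d[of X Y g, symmetric, THEN d_re] by (simp add: lts d_assoc d_id)
  qed simp_all
  then show ?thesis by (simp add: lts)
qed

lemma D_inv:
  "lt X (D_of OXp) Y \<star> lt X (D_of OXm) Y = E (X @ Dn # Dn # Y)"
  "lt X (D_of OXm) Y \<star> lt X (D_of OXp) Y = E (X @ Dn # Dn # Y)"
  by (rule D_inv_aux; simp)+

abbreviation D where "D \<equiv> D_of OXp"
abbreviation D' where "D' \<equiv> D_of OXm"

text \<open>The braid relation with two strands reversed. Bending the first target arrow up turns
  \<open>D\<close> into \<open>R\<close> and the adjacent \<open>R\<close> into a crossing; the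
  claim then follows from \<open>RRx\<close>.\<close>

lemma RRD:
  "lt (X @ [Dn]) R Y \<star> lt X R (Dn # Y) \<star> lt (X @ [Up]) D Y = lt X D (Up # Y) \<star> lt (X @ [Dn]) R Y \<star> lt X R (Dn # Y)"
proof -
  let ?f = "(OId [Dn] \<otimes>\<^sub>O R) \<cdot>\<^sub>O (R \<otimes>\<^sub>O OId [Dn]) \<cdot>\<^sub>O (OId [Up] \<otimes>\<^sub>O D)"
  let ?g = "(D \<otimes>\<^sub>O OId [Up]) \<cdot>\<^sub>O (OId [Dn] \<otimes>\<^sub>O R) \<cdot>\<^sub>O (R \<otimes>\<^sub>O OId [Dn])"
  have "lt X ?f Y = lt X ?g Y"
  proof (rule bend_d[where V = "[Dn, Up]" and W = "[Up, Dn, Dn]"])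
    fix X
    let ?h = "lt X R Y \<star> lt (X @ [Up, Dn]) Od Y \<star> lt (X @ [Up]) R (Dn # Y) \<star> lt X OXp (Dn # Dn # Y)"
    have 1: "lt X Od (Dn # Up # Y) \<star> lt (X @ [Up, Dn]) R Y = lt X R Y \<star> lt X Od (Up # Dn # Y)"
      using lt_interchange[of X Od "[]" R Y] by simp
    have 2: "lt X Od (Up # Dn # Y) \<star> lt (X @ [Up]) R (Dn # Y) = lt (X @ [Up]) Od (Dn # Y) \<star> lt X OXp (Dn # Dn # Y)"
      using R_d[of OXp X "Dn # Y"] by simp
    have 3: "lt X OXp (Dn # Dn # Y) \<star> lt (X @ [Up, Up]) D Y = lt (X @ [Up, Up]) D Y \<star> lt X OXp (Dn # Dn # Y)"
      using lt_interchange[of X OXp "[]" D Y] by simp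
    have 4: "lt (X @ [Up]) Od (Dn # Y) \<star> lt (X @ [Up, Up]) D Y = lt (X @ [Up, Dn]) Od Y \<star> lt (X @ [Up]) R (Dn # Y)"
      using D_d[of "X @ [Up]" Y OXp] by simp
    have "lt X Od (Dn # Up # Y) \<star> lt (X @ [Up, Dn]) R Y \<star> lt (X @ [Up]) R (Dn # Y) \<star> lt (X @ [Up, Up]) D Y = ?h"
      by (simp add: 1[THEN d_re] 2[THEN d_re] 3 4[THEN d_re] d_assoc)
    moreover
    have 5: "lt X Od (Dn # Up # Y) \<star> lt (X @ [Up]) D (Up # Y) = lt (X @ [Dn]) Od (Up # Y) \<star> lt X R (Dn # Up # Y)"
      using D_d[of X "Up # Y" OXp] by simp
    have 6: "lt X R (Dn # Up # Y) \<star> lt (X @ [Up, Dn]) R Y = lt (X @ [Dn, Up]) R Y \<star> lt X R (Up # Dn # Y)"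
      using lt_interchange[of X R "[]" R Y] by simp
    have 7: "lt (X @ [Dn]) Od (Up # Y) \<star> lt (X @ [Dn, Up]) R Y = lt (X @ [Dn, Up]) Od Y \<star> lt (X @ [Dn]) OXp (Dn # Y)"
      using R_d[of OXp "X @ [Dn]" Y] by simp
    have 8: "lt (X @ [Dn]) OXp (Dn # Y) \<star> lt X R (Up # Dn # Y) \<star> lt (X @ [Up]) R (Dn # Y)
      = lt X R (Up # Dn # Y) \<star> lt (X @ [Up]) R (Dn # Y) \<star> lt X OXp (Dn # Dn # Y)"
      using RRx[of X "Dn # Y"] by simp
    have 9: "lt (X @ [Dn, Up]) Od Y \<star> lt X R (Up # Dn # Y) = lt X R Y \<star> lt (X @ [Up, Dn]) Od Y"
      using lt_interchange[of X R "[]" Od Y] by simp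
    have "lt X Od (Dn # Up # Y) \<star> lt (X @ [Up]) D (Up # Y) \<star> lt (X @ [Up, Dn]) R Y \<star> lt (X @ [Up]) R (Dn # Y) = ?h"
      by (simp add: 5[THEN d_re] 6[THEN d_re] 7[THEN d_re] 8 9[THEN d_re] d_assoc)
    ultimately show "lt X Od ([Dn, Up] @ Y) \<star> lt (X @ [Up]) ?f Y = lt X Od ([Dn, Up] @ Y) \<star> lt (X @ [Up]) ?g Y"
      by (simp add: lts d_assoc)
  qed simp_all
  then show ?thesis by (simp add: lts)
qed

text \<open>As in \<open>d'_slide\<close>, for a downward strand: \<open>RRD\<close> replaces
  \<open>RRx\<close> and \<open>D_d\<close> replaces \<open>R_d\<close>.\<close>

lemma d'_slide_down: "lt (X @ [Dn]) Od' Y \<star> lt X D' (Up # Y) \<star> lt (X @ [Dn]) R Y = lt X Od' (Dn # Y)"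
proof -
  have "lt X D' (Up # Y) \<star> lt (X @ [Dn]) R Y
    = lt X D' (Up # Y) \<star> (lt (X @ [Dn]) R Y \<star> lt X R (Dn # Y) \<star> lt (X @ [Up]) D Y) \<star> lt (X @ [Up]) D' Y \<star> lt X L (Dn # Y)"
    using D_inv(1)[of "X @ [Up]" Y, THEN d_re] by (simp add: d_cancel)
  also have "\<dots> = lt (X @ [Dn]) R Y \<star> lt X R (Dn # Y) \<star> lt (X @ [Up]) D' Y \<star> lt X L (Dn # Y)"
    unfolding RRD using D_inv(2)[of X "Up # Y", THEN d_re] by (simp add: d_cancel)
  finally have 1: "lt X D' (Up # Y) \<star> lt (X @ [Dn]) R Y = \<dots>" .
  have "lt (X @ [Dn]) Od' Y \<star> lt X D' (Up # Y) \<star> lt (X @ [Dn]) R Y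
    = t \<bullet> (lt (X @ [Dn]) Od Y \<star> lt X R (Dn # Y)) \<star> lt (X @ [Up]) D' Y \<star> lt X L (Dn # Y)"
    unfolding 1 d'_eq by (simp add: d_cancel d_scl)
  also have "\<dots> = lt X Od' (Dn # Y)"
    unfolding D_d using D_inv(1)[of "X @ [Up]" Y, THEN d_re] by (simp add: d'_eq d_cancel d_scl)
  finally show ?thesis .
qed

end

section \<open>Toggles\<close>

text \<open>Arrows are appended on the right, where \<open>theta\<close> grows as well. The
  simplifier moves loose upward arrows to the right of \<open>ups n\<close>, so that equal words get
  equal forms.\<close>

primrec ups :: "nat \<Rightarrow> ori list" where
  "ups 0 = []"
| "ups (Suc n) = ups n @ [Up]"

lemma ups_Cons [simp]: "Up # ups n = ups n @ [Up]" "Up # ups n @ X = ups n @ Up # X"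
proof -
  show 1: "Up # ups n = ups n @ [Up]" by (induction n) (simp_all flip: append_Cons)
  show "Up # ups n @ X = ups n @ Up # X" by (simp add: 1 flip: append_Cons)
qed

lemma ups_plus [simp]: "ups (n + 1) = ups n @ [Up]" "ups (n + 2) = ups n @ [Up, Up]" "ups 1 = [Up]" "ups 2 = [Up, Up]"
  using ups.simps(2)[of "n"] ups.simps(2)[of "Suc n"] ups.simps(2)[of 0] ups.simps(2)[of "Suc 0"]
  by (simp_all add: numeral_2_eq_2 One_nat_def del: ups.simps(2))

lemma ups_add: "ups (i + j) = ups i @ ups j"
  by (induction j) auto

lemma length_ups [simp]: "length (ups n) = n"
  by (induction n) auto

text \<open>\<open>theta n\<close> toggles the arrow in position \<open>n + 1\<close>, by pulling it to the left of n upward strands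
  and back.\<close>

primrec theta :: "nat \<Rightarrow> 'k ds" where
  "theta 0 = DTau"
| "theta (Suc n) = DOs (OId (ups n) \<otimes>\<^sub>O OXm \<otimes>\<^sub>O OId []) \<cdot>\<^sub>D (theta n \<otimes>\<^sub>D OId [Up]) \<cdot>\<^sub>D
    DOs (OId (ups n) \<otimes>\<^sub>O R_of OXp \<otimes>\<^sub>O OId [])"

primrec theta' :: "nat \<Rightarrow> 'k ds" where
  "theta' 0 = DTau'"
| "theta' (Suc n) = DOs (OId (ups n) \<otimes>\<^sub>O L_of OXm \<otimes>\<^sub>O OId []) \<cdot>\<^sub>D (theta' n \<otimes>\<^sub>D OId [Up]) \<cdot>\<^sub>D
    DOs (OId (ups n) \<otimes>\<^sub>O OXp \<otimes>\<^sub>O OId [])"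

context skein_parameters begin

lemma rt_interchange:
  "rt (X @ os_cod g @ Y) (dc f) \<star> lt (ds_dom f @ X) g Y = lt (ds_cod f @ X) g Y \<star> rt (X @ os_dom g @ Y) (dc f)"
  using dc_split_act[of "OId X \<otimes>\<^sub>O g \<otimes>\<^sub>O OId Y" _ f] dc_split_act'[of "OId X \<otimes>\<^sub>O g \<otimes>\<^sub>O OId Y" _ f]
  by (simp add: dc_push DOs_act_lt rt_cls)

lemma rt_rt: "rt Y (rt Z (dc f)) = rt (Z @ Y) (dc f)"
  unfolding rt_cls dc_act_act by (intro dc_Act refl oc_ten_id)

lemma ds_rel_cls: "ds_rel q f g \<Longrightarrow> dc f = dc g"
  by (rule D.cls_eq) (rule ds_eq.ds_rel)

lemma tg_Nil: "dc DTau = tg []" "dc DTau' = tg' []"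
  by (simp_all add: tg_def tg'_def dc_act_unit)

lemma tg_fold: "dc (DTau \<otimes>\<^sub>D OId Y) = tg Y" "dc (DTau' \<otimes>\<^sub>D OId Y) = tg' Y"
  by (simp_all add: tg_def tg'_def)

lemma tg_inv: "tg Y \<star> tg' Y = E (Up # Y)" "tg' Y \<star> tg Y = E (Dn # Y)"
proof -
  have "tg [] \<star> tg' [] = E [Up]" "tg' [] \<star> tg [] = E [Dn]"
    using ds_rel_cls[OF ds_rel.intros(1)] ds_rel_cls[OF ds_rel.intros(2)] by (simp_all add: dc_push tg_Nil)
  from this[THEN arg_cong, of "rt Y"] show "tg Y \<star> tg' Y = E (Up # Y)" "tg' Y \<star> tg Y = E (Dn # Y)"
    by (simp_all add: rts)
qed

lemmas d_cancel' = d_cancel tg_inv tg_inv[THEN d_re]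

section \<open>The images of the cup and the cap\<close>

definition cupc where "cupc Y = tg (Up # Y) \<star> lt [] Oc Y"
definition capc where "capc Y = lt [] Od' Y \<star> tg' (Up # Y)"

lemma rt_cupc: "rt Z (cupc Y) = cupc (Y @ Z)" and rt_capc: "rt Z (capc Y) = capc (Y @ Z)"
  by (simp_all add: cupc_def capc_def rts)

lemmas rts' = rts rt_cupc rt_capc

lemma cupc_interchange: "lt (Up # Up # X) g Y \<star> cupc (X @ os_dom g @ Y) = cupc (X @ os_cod g @ Y) \<star> lt X g Y"
proof -
  have "lt (Up # Up # X) g Y \<star> cupc (X @ os_dom g @ Y)
     = (lt (Up # Up # X) g Y \<star> tg ((Up # X) @ os_dom g @ Y)) \<star> lt [] Oc (X @ os_dom g @ Y)"
    by (simp add: cupc_def d_assoc)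
  also have "\<dots> = tg (Up # X @ os_cod g @ Y) \<star> lt ([] @ [Dn, Up] @ X) g Y \<star> lt [] Oc (X @ os_dom g @ Y)"
    using tg_interchange(1)[of "Up # X" g Y, symmetric, THEN d_re] by (simp add: d_assoc)
  also have "\<dots> = cupc (X @ os_cod g @ Y) \<star> lt X g Y"
    using lt_interchange[of "[]" Oc X g Y, symmetric] by (simp add: cupc_def d_assoc)
  finally show ?thesis .
qed

lemma capc_interchange: "capc (X @ os_cod g @ Y) \<star> lt (Up # Up # X) g Y = lt X g Y \<star> capc (X @ os_dom g @ Y)"
proof -
  have "capc (X @ os_cod g @ Y) \<star> lt (Up # Up # X) g Y
     = lt [] Od' (X @ os_cod g @ Y) \<star> tg' ((Up # X) @ os_cod g @ Y) \<star> lt (Up # Up # X) g Y"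
    by (simp add: capc_def d_assoc)
  also have "\<dots> = lt [] Od' (X @ os_cod g @ Y) \<star> lt ([] @ [Dn, Up] @ X) g Y \<star> tg' (Up # X @ os_dom g @ Y)"
    using tg_interchange(2)[of "Up # X" g Y] by (simp add: d_assoc)
  also have "\<dots> = lt X g Y \<star> capc (X @ os_dom g @ Y)"
    using lt_interchange[of "[]" Od' X g Y, THEN d_re] by (simp add: capc_def d_assoc)
  finally show ?thesis .
qed

lemma capc_x: "capc Y \<star> lt [] OXp Y = q \<bullet> capc Y"
proof -
  have "capc [] \<star> lt [] OXp [] = q \<bullet> capc []"
    using ds_rel_cls[OF ds_rel.intros(4)[of q]] by (simp add: dc_push DOs_lt tg_fold capc_def d_assoc)
  from this[THEN arg_cong, of "rt Y"] show ?thesis by (simp add: rts')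
qed

lemma x_cupc: "lt [] OXp Y \<star> cupc Y = q \<bullet> cupc Y"
proof -
  have "lt [] OXp [] \<star> cupc [] = q \<bullet> cupc []"
    using ds_rel_cls[OF ds_rel.intros(5)[of q]] by (simp add: dc_push DOs_lt tg_fold cupc_def d_assoc)
  from this[THEN arg_cong, of "rt Y"] show ?thesis by (simp add: rts')
qed

lemma capc_xm: "capc Y \<star> lt [] OXm Y = uinv q \<bullet> capc Y"
proof -
  have c: "capc Y \<star> E (Up # Up # Y) = capc Y" by (simp add: capc_def d_cancel)
  have "uinv q \<bullet> capc Y = uinv q \<bullet> capc Y \<star> E (Up # Up # Y)"
    by (simp only: c d_scl)
  also have "\<dots> = uinv q \<bullet> (capc Y \<star> lt [] OXp Y) \<star> lt [] OXm Y"
    by (simp add: d_cancel d_scl)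
  also have "\<dots> = capc Y \<star> lt [] OXm Y"
    unfolding capc_x by (simp add: d_scl)
  finally show ?thesis ..
qed

lemma x_skein': "lt X OXm Y = lt X OXp Y \<oplus> (- z) \<bullet> E (X @ Up # Up # Y)"
proof -
  have "lt X OXp Y \<oplus> (- z) \<bullet> E (X @ Up # Up # Y) = lt X OXp Y \<oplus> (- 1) \<bullet> (lt X OXp Y \<oplus> (- 1) \<bullet> lt X OXm Y)"
    unfolding x_skein by (simp add: d_scl)
  also have "\<dots> = (1 \<bullet> lt X OXp Y \<oplus> (- 1) \<bullet> lt X OXp Y) \<oplus> lt X OXm Y"
    by (simp add: D.Scl_Pls_cls D.is_cls_intros d_scl D.Pls_assoc_cls) (simp add: lt_def d_scl)
  also have "\<dots> = lt X OXm Y"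
    unfolding D.Pls_Scl_Scl_cls[OF is_cls_lt(1)]
    by (simp add: lt_def D.Scl_zero_cls D.Pls_commute_cls D.is_cls_intros D.Pls_zero_cls)
  finally show ?thesis ..
qed

text \<open>Replacing the crossing inside \<open>R_of\<close> by the identity leaves a cap and a cup
  on disjoint strands, and these interchange to \<open>c d\<close>.\<close>

lemma R_skein: "lt X (R_of OXm) Y = lt X R Y \<oplus> (- z) \<bullet> lt X Oc Y \<star> lt X Od Y"
proof -
  let ?d = "lt (X @ [Dn, Up]) Od Y" and ?c = "lt X Oc (Up # Dn # Y)"
  have e: "lt X (R_of g) Y = ?d \<star> lt (X @ [Dn]) g (Dn # Y) \<star> ?c" for g
    by (simp add: R_of_def lts d_assoc)
  have "lt X (R_of OXm) Y = ?d \<star> lt (X @ [Dn]) OXp (Dn # Y) \<star> ?c \<oplus> (- z) \<bullet> ?d \<star> ?c"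
    unfolding e x_skein' by (simp add: D.Cmp_Pls_cls D.Pls_Cmp_cls D.is_cls_intros d_scl d_id)
  then show ?thesis
    using lt_interchange[of X Oc "[]" Od Y] by (simp add: e[symmetric] d_scl)
qed

text \<open>The map \<open>d(\<tau> \<otimes> 1)\<close> is the transpose of \<open>(\<tau> \<otimes> 1)c\<close>, and D that of the crossing.\<close>

lemma d_tg_D: "lt [] Od Y \<star> tg (Dn # Y) \<star> lt [] D Y = q \<bullet> lt [] Od Y \<star> tg (Dn # Y)"
proof -
  let ?d = "lt [] Od Y \<star> lt [Up] Od (Dn # Y)"
  have v: "lt [] Od Y \<star> tg (Dn # Y) = ?d \<star> cupc (Dn # Dn # Y)"
  proof -
    have "?d \<star> cupc (Dn # Dn # Y) = lt [] Od Y \<star> (lt [Up] Od (Dn # Y) \<star> tg (Up # Dn # Dn # Y)) \<star> lt [] Oc (Dn # Dn # Y)"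
      by (simp add: cupc_def d_assoc)
    also have "\<dots> = lt [] Od Y \<star> tg (Dn # Y) \<star> lt [Dn] Od (Dn # Y) \<star> lt [] Oc (Dn # Dn # Y)"
      using tg_interchange(1)[of "[]" Od "Dn # Y", symmetric, THEN d_re] by (simp add: d_assoc)
    finally show ?thesis using zigzag'[of "[]" "Dn # Y"] by (simp add: d_id)
  qed
  have "(lt [] Od Y \<star> tg (Dn # Y)) \<star> lt [] D Y = ?d \<star> lt [Up, Up] D Y \<star> cupc (Dn # Dn # Y)"
    unfolding v using cupc_interchange[of "[]" D Y] by (simp add: d_assoc)
  also have "\<dots> = ?d \<star> lt [] OXp (Dn # Dn # Y) \<star> cupc (Dn # Dn # Y)"
    using d_d_D[of OXp "[]" Y, THEN d_re] by (simp add: d_assoc)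
  also have "\<dots> = q \<bullet> ?d \<star> cupc (Dn # Dn # Y)"
    using x_cupc[of "Dn # Dn # Y"] by (simp add: d_assoc d_scl)
  finally show ?thesis
    using v v[THEN d_re] by (simp add: d_assoc d_scl)
qed

lemma R_wf [simp]: "os_wf (R_of OXp)" "os_wf (L_of OXm)" "os_wf (D_of OXp)"
  by (simp_all add: R_of_def L_of_def D_of_def)

text \<open>The toggle relation has \<open>R_-\<close> between the toggles; this is the version with
  \<open>R_+\<close>, which occurs when strands are pulled.\<close>

definition T where "T Y = tg (Up # Y) \<star> lt [] R Y \<star> tg (Dn # Y)"

lemma is_cls_T: "D.is_cls (T Y)"
  by (simp add: T_def D.is_cls_intros)

text \<open>By \<open>R_skein\<close> the defining version differs from \<open>T\<close> by a
  multiple of \<open>cupc\<close> after a toggled \<open>d\<close>. That term acquires the factor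
  \<open>q\<close> from the crossing by \<open>x_cupc\<close> and from \<open>D\<close> by
  \<open>d_tg_D\<close>. Hence the same summand \<open>?w\<close> occurs on both sides and
  cancels.\<close>

lemma T_D: "T Y \<star> lt [] D Y = lt [] OXp Y \<star> T Y"
proof -
  let ?v = "lt [] Od Y \<star> tg (Dn # Y)" and ?w = "(- z * q) \<bullet> cupc Y \<star> lt [] Od Y \<star> tg (Dn # Y)"
  have "tg [Up] \<star> lt [] (R_of OXm) [] \<star> tg [Dn] \<star> lt [] D [] = lt [] OXp [] \<star> tg [Up] \<star> lt [] (R_of OXm) [] \<star> tg [Dn]"
    using ds_rel_cls[OF ds_rel.intros(3)[of q]] by (simp add: dc_push DOs_lt tg_fold d_assoc)
  from this[THEN arg_cong, of "rt Y"]
  have 1: "(tg (Up # Y) \<star> lt [] (R_of OXm) Y \<star> tg (Dn # Y)) \<star> lt [] D Y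
      = lt [] OXp Y \<star> (tg (Up # Y) \<star> lt [] (R_of OXm) Y \<star> tg (Dn # Y))"
    by (simp add: rts d_assoc)
  have 2: "tg (Up # Y) \<star> lt [] (R_of OXm) Y \<star> tg (Dn # Y) = T Y \<oplus> (- z) \<bullet> cupc Y \<star> ?v"
    by (simp add: R_skein T_def cupc_def D.Cmp_Pls_cls D.Pls_Cmp_cls D.is_cls_intros d_scl d_assoc)
  have "T Y \<star> lt [] D Y \<oplus> ?w = (T Y \<oplus> (- z) \<bullet> cupc Y \<star> ?v) \<star> lt [] D Y"
    using d_tg_D[of Y]
    by (simp add: D.Cmp_Pls_cls D.Pls_Cmp_cls D.is_cls_intros is_cls_T cupc_def d_scl d_assoc)
  also have "\<dots> = lt [] OXp Y \<star> T Y \<oplus> ?w"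
    unfolding 1[unfolded 2] using x_cupc[of Y, THEN d_re]
    by (simp add: D.Cmp_Pls_cls D.Pls_Cmp_cls D.is_cls_intros is_cls_T cupc_def d_scl d_assoc)
  finally have 3: "T Y \<star> lt [] D Y \<oplus> ?w = lt [] OXp Y \<star> T Y \<oplus> ?w" .
  show ?thesis
    unfolding T_def tg_def lt_def D.ops_cls
    by (rule D.Pls_cancel_cls[OF 3[unfolded T_def cupc_def tg_def lt_def D.ops_cls]]) simp_all
qed

section \<open>Toggles in arbitrary position\<close>

lemma theta_typing [simp]:
  "ds_dom (theta n :: 'k ds) = ups n @ [Dn]" "ds_cod (theta n :: 'k ds) = ups n @ [Up]" "ds_wf (theta n :: 'k ds)"
  "ds_dom (theta' n :: 'k ds) = ups n @ [Up]" "ds_cod (theta' n :: 'k ds) = ups n @ [Dn]" "ds_wf (theta' n :: 'k ds)"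
  by (induction n) simp_all

definition th where "th n Z = dc (theta n \<otimes>\<^sub>D OId Z)"
definition th' where "th' n Z = dc (theta' n \<otimes>\<^sub>D OId Z)"

lemma lt_fold: "dc (DOs (OId X \<otimes>\<^sub>O g \<otimes>\<^sub>O OId Y)) = lt X g Y"
  by (simp add: lt_def)

lemma th_0: "th 0 Z = tg Z" "th' 0 Z = tg' Z"
  by (simp_all add: th_def th'_def tg_def tg'_def)

lemma th_rt: "th n Z = rt Z (dc (theta n))" "th' n Z = rt Z (dc (theta' n))"
  by (simp_all add: th_def th'_def rt_cls)

lemma rt_th: "rt Y (th n Z) = th n (Z @ Y)" "rt Y (th' n Z) = th' n (Z @ Y)"
  by (simp_all add: th_rt rt_rt)

lemma th_Suc:
  "th (n + 1) Z = lt (ups n) OXm Z \<star> th n (Up # Z) \<star> lt (ups n) R Z"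
  "th' (n + 1) Z = lt (ups n) L Z \<star> th' n (Up # Z) \<star> lt (ups n) OXp Z"
  unfolding Suc_eq_plus1[symmetric] th_rt theta.simps theta'.simps dc_push rt_cmp lt_fold rt_lt
  by (simp_all add: rt_cls[symmetric] rt_rt)

lemma E_th:
  "W = ups n @ Up # Z \<Longrightarrow> E W \<star> th n Z = th n Z" "W = ups n @ Dn # Z \<Longrightarrow> th n Z \<star> E W = th n Z"
  "W = ups n @ Dn # Z \<Longrightarrow> E W \<star> th' n Z = th' n Z" "W = ups n @ Up # Z \<Longrightarrow> th' n Z \<star> E W = th' n Z"
  by (simp_all add: th_def th'_def D.Id_left_cls D.Id_right_cls)

lemma th_inv: "th n Z \<star> th' n Z = E (ups n @ Up # Z)" "th' n Z \<star> th n Z = E (ups n @ Dn # Z)"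
proof (induction n arbitrary: Z rule: nat_induct_plus_1)
  case 0
  case 1 show ?case by (simp add: th_0 tg_inv)
  case 2 show ?case by (simp add: th_0 tg_inv)
next
  case (Suc n)
  case 1 show ?case
    using Suc(1)[of "Up # Z", THEN d_re] by (simp add: th_Suc d_cancel E_th E_th[THEN d_re] del: ups_Cons)
  case 2 show ?case
    using Suc(2)[of "Up # Z", THEN d_re] by (simp add: th_Suc d_cancel E_th E_th[THEN d_re] del: ups_Cons)
qed

lemma th_interchange:
  "th n (X @ os_cod g @ Y) \<star> lt (ups n @ Dn # X) g Y = lt (ups n @ Up # X) g Y \<star> th n (X @ os_dom g @ Y)"
  using rt_interchange[of X g Y "theta n"] by (simp add: th_rt)

lemma xm_xm_x:
  "lt (X @ [Up]) OXm Y \<star> lt X OXm (Up # Y) \<star> lt (X @ [Up]) OXp Y = lt X OXp (Up # Y) \<star> lt (X @ [Up]) OXm Y \<star> lt X OXm (Up # Y)"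
proof -
  let ?x = "lt X OXp (Up # Y)" and ?y = "lt (X @ [Up]) OXp Y" and ?x' = "lt X OXm (Up # Y)" and ?y' = "lt (X @ [Up]) OXm Y"
  have "?y' \<star> ?x' \<star> ?y = ?y' \<star> ?x' \<star> (?y \<star> ?x \<star> ?y) \<star> ?y' \<star> ?x'"
    by (simp add: d_cancel)
  also have "\<dots> = ?x \<star> ?y' \<star> ?x'"
    unfolding x_braid[symmetric] by (simp add: d_cancel)
  finally show ?thesis .
qed

text \<open>For \<open>j = 0\<close> the crossing sits on the two strands next to the toggled arrow.
  \<open>RRx\<close> carries it across the downward strand, where it commutes with the toggle, and
  \<open>xm_xm_x\<close> carries it back. For larger \<open>j\<close> one more strand is peeled off,
  away from the crossing.\<close>

lemma th_x:
  "th (i + 2 + j) Z \<star> lt (ups i) OXp (ups j @ Dn # Z) = lt (ups i) OXp (ups j @ Up # Z) \<star> th (i + 2 + j) Z"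
proof (induction j arbitrary: Z rule: nat_induct_plus_1)
  case 0
  let ?u = "ups i"
  have e: "th (i + 2) Z = lt (?u @ [Up]) OXm Z \<star> lt ?u OXm (Up # Z) \<star> th i (Up # Up # Z) \<star> lt ?u R (Up # Z) \<star> lt (?u @ [Up]) R Z"
    using th_Suc(1)[of "i + 1" Z] by (simp add: th_Suc d_assoc nums)
  have "th (i + 2) Z \<star> lt ?u OXp (Dn # Z)
    = lt (?u @ [Up]) OXm Z \<star> lt ?u OXm (Up # Z) \<star> (th i (Up # Up # Z) \<star> lt (?u @ [Dn]) OXp Z) \<star> lt ?u R (Up # Z) \<star> lt (?u @ [Up]) R Z"
    unfolding e using RRx[of ?u Z] by (simp add: d_assoc)
  also have "\<dots> = (lt (?u @ [Up]) OXm Z \<star> lt ?u OXm (Up # Z) \<star> lt (?u @ [Up]) OXp Z) \<star> th i (Up # Up # Z) \<star> lt ?u R (Up # Z) \<star> lt (?u @ [Up]) R Z"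
    using th_interchange[of i "[]" OXp Z] by (simp add: d_assoc)
  also have "\<dots> = lt ?u OXp (Up # Z) \<star> th (i + 2) Z"
    unfolding xm_xm_x e by (simp add: d_assoc)
  finally show ?case by simp
next
  case (Suc j)
  let ?n = "i + 2 + j"
  have u: "ups ?n = ups i @ ups j @ [Up, Up]" by (simp add: ups_add)
  have R: "lt (ups ?n) R Z \<star> lt (ups i) OXp (ups j @ Up # Dn # Z) = lt (ups i) OXp (ups j @ Dn # Up # Z) \<star> lt (ups ?n) R Z"
    using lt_interchange[of "ups i" OXp "ups j" R Z] unfolding u by simp
  have X: "lt (ups ?n) OXm Z \<star> lt (ups i) OXp (ups j @ Up # Up # Z) = lt (ups i) OXp (ups j @ Up # Up # Z) \<star> lt (ups ?n) OXm Z"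
    using lt_interchange[of "ups i" OXp "ups j" OXm Z] unfolding u by simp
  have "th (?n + 1) Z \<star> lt (ups i) OXp (ups j @ Up # Dn # Z) = lt (ups ?n) OXm Z \<star> th ?n (Up # Z) \<star> lt (ups i) OXp (ups j @ Dn # Up # Z) \<star> lt (ups ?n) R Z"
    unfolding th_Suc by (simp only: d_assoc R)
  also have "\<dots> = lt (ups ?n) OXm Z \<star> lt (ups i) OXp (ups j @ Up # Up # Z) \<star> th ?n (Up # Z) \<star> lt (ups ?n) R Z"
    using Suc[of "Up # Z", THEN d_re] by (simp only: d_assoc)
  also have "\<dots> = lt (ups i) OXp (ups j @ Up # Up # Z) \<star> th (?n + 1) Z"
    unfolding th_Suc by (simp only: d_assoc X[THEN d_re])
  finally show ?case by (simp add: add.assoc)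
qed

lemma th_xm:
  "th (i + 2 + j) Z \<star> lt (ups i) OXm (ups j @ Dn # Z) = lt (ups i) OXm (ups j @ Up # Z) \<star> th (i + 2 + j) Z"
proof -
  let ?n = "i + 2 + j"
  have u: "ups ?n = ups i @ ups j @ [Up, Up]" by (simp add: ups_add)
  have "th ?n Z \<star> lt (ups i) OXm (ups j @ Dn # Z)
    = lt (ups i) OXm (ups j @ Up # Z) \<star> (lt (ups i) OXp (ups j @ Up # Z) \<star> th ?n Z) \<star> lt (ups i) OXm (ups j @ Dn # Z)"
    by (simp add: d_cancel E_th[THEN d_re] u)
  also have "\<dots> = lt (ups i) OXm (ups j @ Up # Z) \<star> th ?n Z"
    unfolding th_x[symmetric] by (simp add: d_cancel E_th u)
  finally show ?thesis .
qed

lemma th_2: "th 1 Z = lt [] OXm Z \<star> tg (Up # Z) \<star> lt [] R Z"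
  "th 2 Z = lt [Up] OXm Z \<star> th 1 (Up # Z) \<star> lt [Up] R Z"
  "th 3 Z = lt [Up, Up] OXm Z \<star> th 2 (Up # Z) \<star> lt [Up, Up] R Z"
  using th_Suc(1)[of 0 Z] th_Suc(1)[of 1 Z] th_Suc(1)[of 2 Z] by (simp_all add: th_0)

lemma tg_R: "tg (Up # Z) \<star> lt [] R Z = lt [] OXp Z \<star> th 1 Z"
  by (simp add: th_2 d_cancel)

lemma th_R: "th 1 (Up # Z) \<star> lt [Up] R Z = lt [Up] OXp Z \<star> th 2 Z"
  "th 2 (Up # Z) \<star> lt [Up, Up] R Z = lt [Up, Up] OXp Z \<star> th 3 Z"
  by (simp_all add: th_2(2,3) d_cancel E_th[THEN d_re])

lemma T_tg': "T Y \<star> tg' (Dn # Y) = tg (Up # Y) \<star> lt [] R Y"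
  by (simp add: T_def d_cancel')

lemma xm_T: "lt [] OXm Y \<star> T Y = T Y \<star> lt [] D' Y"
proof -
  have E: "T Y \<star> E (Dn # Dn # Y) = T Y" "E (Up # Up # Y) \<star> T Y = T Y"
    by (simp_all add: T_def d_cancel)
  have "lt [] OXm Y \<star> T Y = lt [] OXm Y \<star> (T Y \<star> lt [] D Y) \<star> lt [] D' Y"
    using D_inv(1)[of "[]" Y] by (simp add: d_assoc E)
  also have "\<dots> = T Y \<star> lt [] D' Y"
    unfolding T_D by (simp add: d_assoc x_inv[THEN d_re] E[THEN d_re] E)
  finally show ?thesis .
qed

text \<open>In the base case two toggles with an \<open>R\<close> between them form
  \<open>T\<close>. \<open>D_c\<close> produces a \<open>D\<close>, which \<open>T_D\<close> turns
  into a crossing cancelling one \<open>OXm\<close> of \<open>theta\<close>; \<open>R_c\<close>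
  produces the crossing that cancels the other. The step is the interchange law.\<close>

lemma th_cupc: "th (n + 2) Z \<star> cupc (ups n @ Dn # Z) = cupc (ups n @ Up # Z) \<star> th n Z"
proof (induction n arbitrary: Z rule: nat_induct_plus_1)
  case 0
  have "th 2 Z \<star> cupc (Dn # Z) = lt [Up] OXm Z \<star> lt [] OXm (Up # Z) \<star> tg (Up # Up # Z) \<star> lt [] R (Up # Z) \<star>
      (lt [Up] R Z \<star> tg (Up # Dn # Z)) \<star> lt [] Oc (Dn # Z)"
    by (simp add: th_2 cupc_def d_assoc)
  also have "\<dots> = lt [Up] OXm Z \<star> lt [] OXm (Up # Z) \<star> T (Up # Z) \<star> (lt [Dn] R Z \<star> lt [] Oc (Dn # Z))"
    using tg_interchange(1)[of "[]" R Z, symmetric] by (simp add: T_def d_assoc)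
  also have "lt [Dn] R Z \<star> lt [] Oc (Dn # Z) = lt [] D (Up # Z) \<star> lt [Dn] Oc Z"
    using D_c[of "[]" OXp Z] by simp
  also have "lt [Up] OXm Z \<star> lt [] OXm (Up # Z) \<star> T (Up # Z) \<star> lt [] D (Up # Z) \<star> lt [Dn] Oc Z
    = lt [Up] OXm Z \<star> T (Up # Z) \<star> lt [Dn] Oc Z"
    using T_D[of "Up # Z", THEN d_re] by (simp add: d_assoc x_inv[THEN d_re] T_def d_id)
  also have "\<dots> = lt [Up] OXm Z \<star> tg (Up # Up # Z) \<star> (lt [] R (Up # Z) \<star> lt [Up] Oc Z) \<star> tg Z"
    using tg_interchange(1)[of "[]" Oc Z] by (simp add: T_def d_assoc)
  also have "lt [] R (Up # Z) \<star> lt [Up] Oc Z = lt [Dn] OXp Z \<star> lt [] Oc (Up # Z)"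
    using R_c[of OXp "[]" Z] by simp
  also have "lt [Up] OXm Z \<star> tg (Up # Up # Z) \<star> (lt [Dn] OXp Z \<star> lt [] Oc (Up # Z)) \<star> tg Z = cupc (Up # Z) \<star> tg Z"
    using tg_interchange(1)[of "[]" OXp Z, THEN d_re] by (simp add: cupc_def d_cancel)
  finally show ?case by (simp add: th_0)
next
  case (Suc n)
  have "th (n + 2 + 1) Z \<star> cupc (ups n @ Up # Dn # Z)
    = lt (ups n @ [Up, Up]) OXm Z \<star> th (n + 2) (Up # Z) \<star> cupc (ups n @ Dn # Up # Z) \<star> lt (ups n) R Z"
    using cupc_interchange[of "ups n" R Z] unfolding th_Suc by (simp add: d_assoc)
  also have "\<dots> = lt (ups n @ [Up, Up]) OXm Z \<star> cupc (ups n @ Up # Up # Z) \<star> th n (Up # Z) \<star> lt (ups n) R Z"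
    using Suc[of "Up # Z", THEN d_re] by (simp add: d_assoc)
  also have "\<dots> = cupc (ups n @ Up # Up # Z) \<star> th (n + 1) Z"
    using cupc_interchange[of "ups n" OXm Z, THEN d_re] unfolding th_Suc by (simp add: d_assoc)
  finally show ?case by (simp add: nums)
qed

text \<open>In the base case \<open>xm_T\<close> moves a crossing through \<open>T\<close>, where it
  becomes \<open>D'\<close>. The strand then passes \<open>d'\<close> twice, upward by
  \<open>d'_slide\<close> and downward by \<open>d'_slide_down\<close>, with the toggle of the
  strand in between.\<close>

lemma capc_th: "capc (ups n @ Up # Z) \<star> th (n + 2) Z = th n Z \<star> capc (ups n @ Dn # Z)"
proof (induction n arbitrary: Z rule: nat_induct_plus_1)
  case 0
  have "capc (Up # Z) \<star> th 2 Z = lt [] Od' (Up # Z) \<star> tg' (Up # Up # Z) \<star> lt [Up] OXm Z \<star> lt [] OXm (Up # Z)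
      \<star> (tg (Up # Up # Z) \<star> lt [] R (Up # Z)) \<star> lt [Up] R Z"
    by (simp add: th_2 capc_def d_assoc)
  also have "\<dots> = lt [] Od' (Up # Z) \<star> tg' (Up # Up # Z) \<star> lt [Up] OXm Z \<star> (lt [] OXm (Up # Z) \<star> T (Up # Z))
      \<star> tg' (Dn # Up # Z) \<star> lt [Up] R Z"
    unfolding T_tg'[symmetric] by (simp add: d_assoc)
  also have "\<dots> = lt [] Od' (Up # Z) \<star> (tg' (Up # Up # Z) \<star> lt [Up] OXm Z) \<star> T (Up # Z) \<star> lt [] D' (Up # Z)
      \<star> tg' (Dn # Up # Z) \<star> lt [Up] R Z"
    unfolding xm_T by (simp add: d_assoc)
  also have "\<dots> = lt [] Od' (Up # Z) \<star> lt [Dn] OXm Z \<star> tg' (Up # Up # Z) \<star> T (Up # Z) \<star> lt [] D' (Up # Z)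
      \<star> (tg' (Dn # Up # Z) \<star> lt [Up] R Z)"
    using tg_interchange(2)[of "[]" OXm Z] by (simp add: d_assoc)
  also have "\<dots> = (lt [] Od' (Up # Z) \<star> lt [Dn] OXm Z \<star> lt [] R (Up # Z)) \<star> tg (Dn # Up # Z) \<star> lt [] D' (Up # Z)
      \<star> lt [Dn] R Z \<star> tg' (Up # Dn # Z)"
    using tg_interchange(2)[of "[]" R Z] by (simp add: T_def d_cancel')
  also have "\<dots> = (lt [Up] Od' Z \<star> tg (Dn # Up # Z)) \<star> lt [] D' (Up # Z) \<star> lt [Dn] R Z \<star> tg' (Up # Dn # Z)"
    using d'_slide[of "[]" Z] by (simp add: d_assoc)
  also have "\<dots> = tg Z \<star> (lt [Dn] Od' Z \<star> lt [] D' (Up # Z) \<star> lt [Dn] R Z) \<star> tg' (Up # Dn # Z)"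
    using tg_interchange(1)[of "[]" Od' Z, symmetric, THEN d_re] by (simp add: d_assoc)
  also have "\<dots> = tg Z \<star> capc (Dn # Z)"
    using d'_slide_down[of "[]" Z] by (simp add: capc_def)
  finally show ?case by (simp add: th_0)
next
  case (Suc n)
  have "capc (ups n @ Up # Up # Z) \<star> th (n + 2 + 1) Z
    = lt (ups n) OXm Z \<star> capc (ups n @ Up # Up # Z) \<star> th (n + 2) (Up # Z) \<star> lt (ups n @ [Up, Up]) R Z"
    using capc_interchange[of "ups n" OXm Z, THEN d_re] unfolding th_Suc by (simp add: d_assoc)
  also have "\<dots> = lt (ups n) OXm Z \<star> th n (Up # Z) \<star> capc (ups n @ Dn # Up # Z) \<star> lt (ups n @ [Up, Up]) R Z"
    using Suc[of "Up # Z", THEN d_re] by (simp add: d_assoc)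
  also have "\<dots> = th (n + 1) Z \<star> capc (ups n @ Up # Dn # Z)"
    using capc_interchange[of "ups n" R Z] unfolding th_Suc by (simp add: d_assoc)
  finally show ?case by (simp add: nums)
qed

section \<open>Relations between two cups or caps\<close>

lemma d_capc_1: "lt [] Od Y = (q * uinv t) \<bullet> capc Y \<star> th 1 Y"
proof -
  have "capc Y \<star> th 1 Y = (capc Y \<star> lt [] OXm Y) \<star> tg (Up # Y) \<star> lt [] R Y"
    by (simp add: th_2 d_assoc)
  also have "\<dots> = uinv q \<bullet> (lt [] Od' Y \<star> lt [] R Y)"
    unfolding capc_xm by (simp add: capc_def d_scl d_cancel')
  also have "\<dots> = (uinv q * t) \<bullet> lt [] Od Y"
    unfolding d'_R by (simp add: d_scl)
  finally show ?thesis by (simp add: d_scl mult_ac) (simp add: lt_def d_scl)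
qed

text \<open>\<open>R_d\<close> shifts \<open>d\<close> one strand to the right at the cost of a
  crossing and an \<open>R\<close>, and the toggle absorbs the \<open>R\<close>. In this way
  \<open>d\<close> becomes a multiple of \<open>capc\<close> after crossings and a single
  toggle.\<close>

lemma d_capc_2: "lt [Up] Od Y = (q * uinv t) \<bullet> capc (Up # Y) \<star> lt [Up] OXp Y \<star> lt [] OXm (Up # Y) \<star> th 2 Y"
proof -
  have "lt [Up] Od Y = (lt [Up] Od Y \<star> lt [] OXp (Dn # Y)) \<star> lt [] OXm (Dn # Y)"
    by (simp add: d_cancel)
  also have "\<dots> = lt [] Od (Up # Y) \<star> lt [Up] R Y \<star> lt [] OXm (Dn # Y)"
    using R_d[of OXp "[]" Y] by (simp add: d_assoc)
  also have "\<dots> = (q * uinv t) \<bullet> capc (Up # Y) \<star> lt [Up] OXp Y \<star> (th 2 Y \<star> lt [] OXm (Dn # Y))"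
    unfolding d_capc_1 using th_R(1)[of Y, THEN d_re] by (simp add: d_assoc d_scl)
  also have "th 2 Y \<star> lt [] OXm (Dn # Y) = lt [] OXm (Up # Y) \<star> th 2 Y"
    using th_xm[of 0 0 Y] by simp
  finally show ?thesis .
qed

lemma d_capc_3: "lt [Up, Up] Od Y = (q * uinv t) \<bullet> capc (Up # Up # Y) \<star> lt [Up] OXp (Up # Y) \<star> lt [] OXm (Up # Up # Y)
  \<star> lt [Up, Up] OXp Y \<star> lt [Up] OXm (Up # Y) \<star> th 3 Y"
proof -
  have "lt [Up, Up] Od Y = (lt [Up, Up] Od Y \<star> lt [Up] OXp (Dn # Y)) \<star> lt [Up] OXm (Dn # Y)"
    by (simp add: d_cancel)
  also have "\<dots> = lt [Up] Od (Up # Y) \<star> lt [Up, Up] R Y \<star> lt [Up] OXm (Dn # Y)"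
    using R_d[of OXp "[Up]" Y] by (simp add: d_assoc)
  also have "\<dots> = (q * uinv t) \<bullet> capc (Up # Up # Y) \<star> lt [Up] OXp (Up # Y) \<star> lt [] OXm (Up # Up # Y) \<star>
     lt [Up, Up] OXp Y \<star> (th 3 Y \<star> lt [Up] OXm (Dn # Y))"
    unfolding d_capc_2 using th_R(2)[of Y, THEN d_re] by (simp add: d_assoc d_scl)
  also have "th 3 Y \<star> lt [Up] OXm (Dn # Y) = lt [Up] OXm (Up # Y) \<star> th 3 Y"
    using th_xm[of 1 0 Y] by simp
  finally show ?thesis .
qed

lemma th_cancel:
  assumes "dc f \<star> th n Z = dc g \<star> th n Z" "ds_dom f = ups n @ Up # Z" "ds_dom g = ups n @ Up # Z"
  shows "dc f = dc g"
proof -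
  have "dc h = (dc h \<star> th n Z) \<star> th' n Z" if "ds_dom h = ups n @ Up # Z" for h
    using that by (simp add: d_assoc th_inv D.Id_right_cls)
  from this[OF assms(2)] this[OF assms(3)] assms(1) show ?thesis by simp
qed

text \<open>The interchange of \<open>d\<close> with \<open>cupc\<close>, with \<open>d\<close>
  rewritten by \<open>d_capc_3\<close> on one side and by \<open>d_capc_1\<close> on the other.
  After \<open>th_cupc\<close> both sides end in the same toggle, which is invertible.\<close>

lemma capc_xxxx_cupc:
  "capc (Up # Up # Y) \<star> lt [Up] OXp (Up # Y) \<star> lt [Up, Up] OXp Y \<star> lt [] OXm (Up # Up # Y) \<star> lt [Up] OXm (Up # Y)
    \<star> cupc (Up # Up # Y) = cupc Y \<star> capc Y"
proof -
  have i: "lt [] OXm (Up # Up # Y) \<star> lt [Up, Up] OXp Y = lt [Up, Up] OXp Y \<star> lt [] OXm (Up # Up # Y)"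
    using lt_interchange[of "[]" OXm "[]" OXp Y] by simp
  let ?s = "q * uinv t" and ?C = "capc (Up # Up # Y) \<star> lt [Up] OXp (Up # Y) \<star> lt [Up, Up] OXp Y \<star> lt [] OXm (Up # Up # Y) \<star> lt [Up] OXm (Up # Y)
    \<star> cupc (Up # Up # Y)"
  have "?s \<bullet> ?C \<star> th 1 Y = lt [Up, Up] Od Y \<star> cupc (Up # Dn # Y)"
    using th_cupc[of 1 Y] i[THEN d_re] by (simp add: d_capc_3 d_assoc d_scl)
  also have "\<dots> = cupc Y \<star> lt [] Od Y"
    using cupc_interchange[of "[]" Od Y] by simp
  also have "\<dots> = ?s \<bullet> (cupc Y \<star> capc Y) \<star> th 1 Y"
    unfolding d_capc_1 by (simp add: d_assoc d_scl)
  \<comment> \<open>\<open>t * uinv q\<close> is the inverse of the scalar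
    \<open>?s\<close>.\<close>
  finally have "(t * uinv q) \<bullet> (?s \<bullet> ?C \<star> th 1 Y) = (t * uinv q) \<bullet> (?s \<bullet> (cupc Y \<star> capc Y) \<star> th 1 Y)"
    by simp
  then have "?C \<star> th 1 Y = (cupc Y \<star> capc Y) \<star> th 1 Y"
    by (simp add: d_scl d_assoc mult.assoc)
  then show ?thesis
    unfolding capc_def cupc_def lt_def tg_def tg'_def D.ops_cls by (rule th_cancel) simp_all
qed

lemma capc_tg: "capc Y \<star> tg (Up # Y) = lt [] Od' Y"
  by (simp add: capc_def d_cancel')

lemma d'_capc_2: "lt [Up] Od' Y = capc (Up # Y) \<star> lt [Up] OXm Y \<star> lt [] OXp (Up # Y) \<star> th 1 (Up # Y)"
proof -
  have "lt [Up] Od' Y = capc (Up # Y) \<star> (tg (Up # Up # Y) \<star> lt [Dn] OXm Y) \<star> lt [] R (Up # Y)"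
    using d'_slide[of "[]" Y] capc_tg[of "Up # Y", THEN d_re] by (simp add: d_assoc)
  also have "\<dots> = capc (Up # Y) \<star> lt [Up] OXm Y \<star> (tg (Up # Up # Y) \<star> lt [] R (Up # Y))"
    using tg_interchange(1)[of "[]" OXm Y, THEN d_re] by (simp add: d_assoc)
  finally show ?thesis unfolding tg_R .
qed

lemma d'_capc_3: "lt [Up, Up] Od' Y = capc (Up # Up # Y) \<star> lt [Up] OXm (Up # Y) \<star> lt [] OXp (Up # Up # Y) \<star>
  lt [Up, Up] OXm Y \<star> lt [Up] OXp (Up # Y) \<star> th 2 (Up # Y)"
proof -
  have "lt [Up, Up] Od' Y = lt [Up] Od' (Up # Y) \<star> lt [Up, Dn] OXm Y \<star> lt [Up] R (Up # Y)"
    using d'_slide[of "[Up]" Y] by simp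
  also have "\<dots> = capc (Up # Up # Y) \<star> lt [Up] OXm (Up # Y) \<star> lt [] OXp (Up # Up # Y) \<star>
    (th 1 (Up # Up # Y) \<star> lt [Up, Dn] OXm Y) \<star> lt [Up] R (Up # Y)"
    unfolding d'_capc_2 by (simp add: d_assoc)
  also have "th 1 (Up # Up # Y) \<star> lt [Up, Dn] OXm Y = lt [Up, Up] OXm Y \<star> th 1 (Up # Up # Y)"
    using th_interchange[of 1 "[]" OXm Y] by simp
  finally show ?thesis using th_R(1)[of "Up # Y"] by (simp add: d_assoc)
qed

text \<open>The interchange of \<open>d'\<close> with \<open>capc\<close>: \<open>d'_capc_3\<close>
  rewrites one side, \<open>capc_th\<close> moves the toggle to the end on the other, and the toggle
  is cancelled.\<close>

lemma capc_capc_xxxx: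
  "capc Y \<star> capc (Up # Up # Y) \<star> lt [Up] OXm (Up # Y) \<star> lt [Up, Up] OXm Y \<star> lt [] OXp (Up # Up # Y) \<star> lt [Up] OXp (Up # Y)
    = capc Y \<star> capc (Up # Up # Y)"
proof -
  have i: "lt [] OXp (Up # Up # Y) \<star> lt [Up, Up] OXm Y = lt [Up, Up] OXm Y \<star> lt [] OXp (Up # Up # Y)"
    using lt_interchange[of "[]" OXp "[]" OXm Y] by simp
  let ?C = "capc Y \<star> capc (Up # Up # Y) \<star> lt [Up] OXm (Up # Y) \<star> lt [Up, Up] OXm Y \<star> lt [] OXp (Up # Up # Y) \<star> lt [Up] OXp (Up # Y)"
  have "?C \<star> th 2 (Up # Y) = capc Y \<star> lt [Up, Up] Od' Y"
    using i[THEN d_re] by (simp add: d'_capc_3 d_assoc)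
  also have "\<dots> = lt [] Od' Y \<star> capc (Dn # Up # Y)"
    using capc_interchange[of "[]" Od' Y] by simp
  also have "\<dots> = capc Y \<star> (tg (Up # Y) \<star> capc (Dn # Up # Y))"
    unfolding capc_tg[symmetric] by (simp add: d_assoc)
  also have "\<dots> = (capc Y \<star> capc (Up # Up # Y)) \<star> th 2 (Up # Y)"
    using capc_th[of 0 "Up # Y"] by (simp add: th_0 d_assoc)
  finally have "?C \<star> th 2 (Up # Y) = (capc Y \<star> capc (Up # Up # Y)) \<star> th 2 (Up # Y)" .
  then show ?thesis
    unfolding capc_def lt_def tg'_def D.ops_cls by (rule th_cancel) simp_all
qed

lemma th_c_2: "th 1 (Up # Y) \<star> lt [Up] Oc Y = lt [] OXm (Up # Y) \<star> lt [Up] OXp Y \<star> cupc (Up # Y)"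
proof -
  have "th 1 (Up # Y) \<star> lt [Up] Oc Y = lt [] OXm (Up # Y) \<star> (tg (Up # Up # Y) \<star> lt [Dn] OXp Y) \<star> lt [] Oc (Up # Y)"
    using R_c[of OXp "[]" Y] by (simp add: th_2 d_assoc)
  then show ?thesis
    using tg_interchange(1)[of "[]" OXp Y, THEN d_re] by (simp add: cupc_def d_assoc)
qed

lemma th_c_3: "th 2 (Up # Y) \<star> lt [Up, Up] Oc Y = lt [Up] OXm (Up # Y) \<star> lt [Up, Up] OXp Y \<star> lt [] OXm (Up # Up # Y) \<star>
   lt [Up] OXp (Up # Y) \<star> cupc (Up # Up # Y)"
proof -
  have "th 2 (Up # Y) \<star> lt [Up, Up] Oc Y = lt [Up] OXm (Up # Y) \<star> (th 1 (Up # Up # Y) \<star> lt [Up, Dn] OXp Y) \<star> lt [Up] Oc (Up # Y)"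
    using R_c[of OXp "[Up]" Y] by (simp add: th_2(2) d_assoc)
  also have "th 1 (Up # Up # Y) \<star> lt [Up, Dn] OXp Y = lt [Up, Up] OXp Y \<star> th 1 (Up # Up # Y)"
    using th_interchange[of 1 "[]" OXp Y] by simp
  finally show ?thesis using th_c_2[of "Up # Y"] by (simp add: d_assoc)
qed

text \<open>The toggle \<open>th 2\<close> is applied to \<open>cupc\<close> followed by a
  \<open>c\<close> two strands to the right, and the result computed in two ways: by
  \<open>th_c_3\<close>, or by interchanging the cups and using \<open>th_cupc\<close>.\<close>

lemma xxxx_cupc_cupc:
  "lt [Up] OXm (Up # Y) \<star> lt [] OXm (Up # Up # Y) \<star> lt [Up, Up] OXp Y \<star> lt [Up] OXp (Up # Y) \<star> cupc (Up # Up # Y) \<star> cupc Y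
    = cupc (Up # Up # Y) \<star> cupc Y"
proof -
  have i: "lt [] OXm (Up # Up # Y) \<star> lt [Up, Up] OXp Y = lt [Up, Up] OXp Y \<star> lt [] OXm (Up # Up # Y)"
    using lt_interchange[of "[]" OXm "[]" OXp Y] by simp
  have "lt [Up] OXm (Up # Y) \<star> lt [] OXm (Up # Up # Y) \<star> lt [Up, Up] OXp Y \<star> lt [Up] OXp (Up # Y) \<star> cupc (Up # Up # Y) \<star> cupc Y
    = th 2 (Up # Y) \<star> lt [Up, Up] Oc Y \<star> cupc Y"
    using th_c_3[of Y, THEN d_re] i[THEN d_re] by (simp add: d_assoc)
  also have "\<dots> = (th 2 (Up # Y) \<star> cupc (Dn # Up # Y)) \<star> lt [] Oc Y"
    using cupc_interchange[of "[]" Oc Y] by (simp add: d_assoc)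
  also have "\<dots> = cupc (Up # Up # Y) \<star> cupc Y"
    using th_cupc[of 0 "Up # Y"] by (simp add: th_0 d_assoc cupc_def)
  finally show ?thesis .
qed

end

section \<open>The inverse equivalence\<close>

primrec Psi :: "'k::{comm_ring,comm_monoid_mult} br \<Rightarrow> 'k ds" where
  "Psi (BId n) = DOs (OId (ups n))"
| "Psi (BCup n) = (DTau \<otimes>\<^sub>D OId (Up # ups n)) \<cdot>\<^sub>D DOs (OId [] \<otimes>\<^sub>O Oc \<otimes>\<^sub>O OId (ups n))"
| "Psi (BCap n) = DOs (OId [] \<otimes>\<^sub>O Od' \<otimes>\<^sub>O OId (ups n)) \<cdot>\<^sub>D (DTau' \<otimes>\<^sub>D OId (Up # ups n))"
| "Psi (BSig n i) = DOs (OId (ups (i - 1)) \<otimes>\<^sub>O OXp \<otimes>\<^sub>O OId (ups (n - i - 1)))"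
| "Psi (BInv n i) = DOs (OId (ups (i - 1)) \<otimes>\<^sub>O OXm \<otimes>\<^sub>O OId (ups (n - i - 1)))"
| "Psi (f \<cdot>\<^sub>B g) = Psi f \<cdot>\<^sub>D Psi g"
| "Psi (BZer m n) = DZer (ups m) (ups n)"
| "Psi (BPls f g) = DPls (Psi f) (Psi g)"
| "Psi (BScl a f) = DScl a (Psi f)"

text \<open>Replaces the truncated subtractions in \<open>Psi\<close> by the numbers
  \<open>p\<close> and \<open>r\<close> of strands on either side of the crossing.\<close>

lemma crossing_position: "1 \<le> i \<Longrightarrow> i < n \<Longrightarrow> \<exists>p r. i = p + 1 \<and> n = p + 2 + r" for i n :: nat
  by (rule exI[of _ "i - 1"], rule exI[of _ "n - i - 1"]) simp

lemma Psi_typing_aux: "br_wf b \<Longrightarrow> ds_wf (Psi b) \<and> ds_dom (Psi b) = ups (br_dom b) \<and> ds_cod (Psi b) = ups (br_cod b)"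
proof (induction b)
  case (BSig n i)
  then obtain p r where "i = p + 1" "n = p + 2 + r" using crossing_position[of i n] by auto
  then show ?case by (simp add: ups_add)
next
  case (BInv n i)
  then obtain p r where "i = p + 1" "n = p + 2 + r" using crossing_position[of i n] by auto
  then show ?case by (simp add: ups_add)
qed auto

lemma Psi_typing [simp]:
  "br_wf b \<Longrightarrow> ds_wf (Psi b)" "br_wf b \<Longrightarrow> ds_dom (Psi b) = ups (br_dom b)" "br_wf b \<Longrightarrow> ds_cod (Psi b) = ups (br_cod b)"
  using Psi_typing_aux by auto

lemma lin_ax_Psi: "lin_ax B_terms f g \<Longrightarrow> lin_ax DS_terms (Psi f) (Psi g)"
  by (induction rule: lin_ax.induct) (simp, (rule lin_ax.intros[where C = DS_terms, unfolded DS_terms_simps]; force))+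

context skein_parameters begin

lemma Psi_X:
  "n = p + 2 + r \<Longrightarrow> i = p + 1 \<Longrightarrow> dc (Psi (BSig n i)) = lt (ups p) OXp (ups r)"
  "n = p + 2 + r \<Longrightarrow> i = p + 1 \<Longrightarrow> dc (Psi (BInv n i)) = lt (ups p) OXm (ups r)"
  by (simp_all add: lt_def)

lemma Psi_123:
  "dc (Psi (BSig (n + 4) 1)) = lt [] OXp (ups n @ [Up, Up])" "dc (Psi (BInv (n + 4) 1)) = lt [] OXm (ups n @ [Up, Up])"
  "dc (Psi (BSig (n + 4) 2)) = lt [Up] OXp (ups n @ [Up])" "dc (Psi (BInv (n + 4) 2)) = lt [Up] OXm (ups n @ [Up])"
  "dc (Psi (BSig (n + 4) 3)) = lt [Up, Up] OXp (ups n)" "dc (Psi (BInv (n + 4) 3)) = lt [Up, Up] OXm (ups n)"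
proof -
  show "dc (Psi (BSig (n + 4) 1)) = lt [] OXp (ups n @ [Up, Up])" "dc (Psi (BInv (n + 4) 1)) = lt [] OXm (ups n @ [Up, Up])"
    by (subst Psi_X[of _ 0 "n + 2"]; simp)+
  show "dc (Psi (BSig (n + 4) 2)) = lt [Up] OXp (ups n @ [Up])" "dc (Psi (BInv (n + 4) 2)) = lt [Up] OXm (ups n @ [Up])"
    by (subst Psi_X[of _ 1 "n + 1"]; simp)+
  show "dc (Psi (BSig (n + 4) 3)) = lt [Up, Up] OXp (ups n)" "dc (Psi (BInv (n + 4) 3)) = lt [Up, Up] OXm (ups n)"
    by (subst Psi_X[of _ 2 n]; simp)+
qed

lemma Psi_cup: "dc (Psi (BCup n)) = cupc (ups n)" and Psi_cap: "dc (Psi (BCap n)) = capc (ups n)"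
  by (simp_all add: dc_push lt_fold tg_fold cupc_def capc_def)

lemma capc_cupc: "capc Y \<star> cupc Y = \<delta> \<bullet> E Y"
  using d'_c[of "[]" Y] by (simp add: capc_def cupc_def d_cancel')

lemma capc_x_cupc: "capc (Up # Y) \<star> lt [Up] OXp Y \<star> cupc (Up # Y) = t \<bullet> E (Up # Y)"
proof -
  have "capc (Up # Y) \<star> lt [Up] OXp Y \<star> cupc (Up # Y)
    = lt [] Od' (Up # Y) \<star> (tg' (Up # Up # Y) \<star> lt [Up] OXp Y) \<star> tg (Up # Up # Y) \<star> lt [] Oc (Up # Y)"
    by (simp add: capc_def cupc_def d_assoc)
  also have "\<dots> = lt [] Od' (Up # Y) \<star> lt [Dn] OXp Y \<star> lt [] Oc (Up # Y)"
    using tg_interchange(2)[of "[]" OXp Y] by (simp add: d_cancel')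
  finally show ?thesis using twist[of "[]" Y] by simp
qed

lemma br_rel_Psi:
  assumes "br_rel q t \<delta> f g" "br_wf f" "br_wf g"
  shows "dc (Psi f) = dc (Psi g)"
  using assms
proof (cases rule: br_rel.cases)
  case (1 n i)
  then obtain p r where "i = p + 1" "n = p + 2 + r" using crossing_position[of i n] assms by auto
  then show ?thesis
    using x_inv(1)[of "ups p" "ups r"] by (simp add: 1 dc_push Psi_X[OF refl refl] ups_add del: Psi.simps(4,5))
next
  case (2 n i)
  then obtain p r where "i = p + 1" "n = p + 2 + r" using crossing_position[of i n] assms by auto
  then show ?thesis
    using x_inv(2)[of "ups p" "ups r"] by (simp add: 2 dc_push Psi_X[OF refl refl] ups_add del: Psi.simps(4,5))
next
  case (3 n i)
  then obtain p r' where i: "i = p + 1" "n = p + 2 + r'" using crossing_position[of i n] assms by auto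
  with 3 assms have "r' \<noteq> 0" by auto
  then obtain r where "r' = r + 1" by (metis Suc_eq_plus1 not0_implies_Suc)
  with i have "i = p + 1" "n = p + 3 + r" by simp_all
  then show ?thesis
    using x_braid[of "ups p" "ups r"] Psi_X(1)[of n p "r + 1" "p + 1"] Psi_X(1)[of n "p + 1" r "p + 2"]
    by (simp add: 3 dc_push d_assoc nums del: Psi.simps(4,5))
next
  case (4 i j n)
  have *: "dc (Psi (BSig n i \<cdot>\<^sub>B BSig n j)) = dc (Psi (BSig n j \<cdot>\<^sub>B BSig n i))" if "i + 1 < j" "1 \<le> i" "j < n" for i j
  proof -
    obtain p where p: "i = 1 + p" using le_iff_add[of 1 i] \<open>1 \<le> i\<close> by blast
    obtain s where s: "j = i + 2 + s" using le_iff_add[of "i + 2" j] \<open>i + 1 < j\<close> by auto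
    obtain r where r: "n = j + 1 + r" using le_iff_add[of "j + 1" n] \<open>j < n\<close> by auto
    have "i = p + 1" "j = p + 2 + s + 1" "n = p + 2 + s + 2 + r" using p s r by simp_all
    then show ?thesis
      using lt_interchange[of "ups p" OXp "ups s" OXp "ups r"] Psi_X(1)[of n p "s + 2 + r" i] Psi_X(1)[of n "p + 2 + s" r j]
      by (simp add: dc_push ups_add del: Psi.simps(4,5))
  qed
  show ?thesis using 4 *[of i j] *[of j i] assms by auto
next
  case (5 n i)
  then obtain p r where "i = p + 1" "n = p + 2 + r" using crossing_position[of i n] assms by auto
  then show ?thesis
    using x_skein[of "ups p" "ups r"] by (simp add: 5 dc_push Psi_X[OF refl refl] ups_add del: Psi.simps(4,5))
next
  case (6 n i)
  then obtain p r where "i = p + 1" "n = p + 2 + r" using crossing_position[of i n] assms by auto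
  then show ?thesis
    using cupc_interchange[of "ups p" OXp "ups r"] Psi_X(1)[of "n + 2" "p + 2" r "i + 2"]
    by (simp add: 6 dc_push Psi_X[OF refl refl] Psi_cup ups_add del: Psi.simps(2-5))
next
  case (7 n i)
  then obtain p r where "i = p + 1" "n = p + 2 + r" using crossing_position[of i n] assms by auto
  then show ?thesis
    using capc_interchange[of "ups p" OXp "ups r"] Psi_X(1)[of "n + 2" "p + 2" r "i + 2"]
    by (simp add: 7 dc_push Psi_X[OF refl refl] Psi_cap ups_add del: Psi.simps(2-5))
next
  case (8 n)
  then show ?thesis using capc_cupc[of "ups n"] by (simp add: dc_push Psi_cup Psi_cap del: Psi.simps(2-5))
next
  case (9 n)
  then show ?thesis
    using capc_x[of "ups n"] Psi_X(1)[of "n + 2" 0 n 1] by (simp add: dc_push Psi_cap del: Psi.simps(2-5))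
next
  case (10 n)
  then show ?thesis
    using x_cupc[of "ups n"] Psi_X(1)[of "n + 2" 0 n 1] by (simp add: dc_push Psi_cup del: Psi.simps(2-5))
next
  case (11 n)
  then obtain m where "n = 1 + m" using le_iff_add[of 1 n] by blast
  then have m: "n = m + 1" by simp
  have X: "dc (Psi (BSig (m + 1 + 2) 2)) = lt [Up] OXp (ups m)"
    by (subst Psi_X(1)[of _ 1 m]) simp_all
  have u: "ups n = Up # ups m" by (simp add: m)
  show ?thesis
    unfolding 11 Psi.simps(6,9) dc_push Psi_cup Psi_cap u using capc_x_cupc[of "ups m"] X by (simp add: m)
next
  case (12 n)
  then obtain m where "n = 2 + m" using le_iff_add[of 2 n] by blast
  then have m: "n = m + 2" "n - 2 = m" "n + 2 = m + 4" by simp_all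
  have u: "ups n = Up # Up # ups m" by (simp add: m(1))
  show ?thesis
    unfolding 12 Psi.simps(6) dc_push Psi_cup Psi_cap m(2,3) Psi_123 u using capc_xxxx_cupc[of "ups m"] by simp
next
  case (13 n)
  have u: "ups (n + 2) = Up # Up # ups n" by simp
  show ?thesis
    unfolding 13 Psi.simps(6) dc_push Psi_cup Psi_cap Psi_123 u using capc_capc_xxxx[of "ups n"] by simp
next
  case (14 n)
  have u: "ups (n + 2) = Up # Up # ups n" by simp
  show ?thesis
    unfolding 14 Psi.simps(6) dc_push Psi_cup Psi_cap Psi_123 u using xxxx_cupc_cupc[of "ups n"] by simp
qed

lemma br_eq_Psi: "br_eq q t \<delta> f g \<Longrightarrow> dc (Psi f) = dc (Psi g)"
proof (induction rule: br_eq.induct)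
  case (br_lin f g)
  then show ?case by (intro D.cls_eq ds_lin lin_ax_Psi)
next
  case (br_rel f g m n)
  then show ?case by (intro br_rel_Psi) auto
qed (simp_all add: dc_push)

lemma dc_Psi: "bc f = bc g \<Longrightarrow> br_wf f \<Longrightarrow> dc (Psi f) = dc (Psi g)"
  by (rule br_eq_Psi, rule B.cls_eqD)

text \<open>F sends the toggles to identities, and on no strands \<open>c\<close> and
  \<open>d'\<close> act by the plain cup and cap (\<open>at_0\<close>); the further strands enter
  only through the shift.\<close>

lemma F_Psi: "br_wf b \<Longrightarrow> bc (F (Psi b)) = bc b"
proof (induction b)
  case (BCup n)
  show ?case by (simp add: bc_push cup_eqs at_0 b_id nums del: br_act.simps(4-7))
next
  case (BCap n)
  show ?case by (simp add: bc_push cup_eqs at_0 b_id nums del: br_act.simps(4-7))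
next
  case (BSig n i)
  then obtain p r where "i = p + 1" "n = p + 2 + r" using crossing_position[of i n] by auto
  then show ?case by (simp add: bc_push b_id add_ac)
next
  case (BInv n i)
  then obtain p r where "i = p + 1" "n = p + 2 + r" using crossing_position[of i n] by auto
  then show ?case by (simp add: bc_push b_id add_ac)
qed (simp_all add: bc_push)

end

text \<open>\<open>eta X\<close> toggles all downward arrows of the word whose reverse is \<open>X\<close>, from left to right.\<close>

primrec eta :: "ori list \<Rightarrow> 'k ds" where
  "eta [] = DOs (OId [])"
| "eta (a # X) = (if a = Up then DOs (OId (ups (length X + 1))) else theta (length X)) \<cdot>\<^sub>D (eta X \<otimes>\<^sub>D OId [a])"

primrec eta' :: "ori list \<Rightarrow> 'k ds" where
  "eta' [] = DOs (OId [])"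
| "eta' (a # X) = (eta' X \<otimes>\<^sub>D OId [a]) \<cdot>\<^sub>D (if a = Up then DOs (OId (ups (length X + 1))) else theta' (length X))"

context skein_parameters begin

lemma eta_typing [simp]:
  "ds_dom (eta X :: 'k ds) = rev X" "ds_cod (eta X :: 'k ds) = ups (length X)" "ds_wf (eta X :: 'k ds)"
  "ds_dom (eta' X :: 'k ds) = ups (length X)" "ds_cod (eta' X :: 'k ds) = rev X" "ds_wf (eta' X :: 'k ds)"
  proof (induction X)
  case (Cons a X)
  then show "ds_dom (eta (a # X) :: 'k ds) = rev (a # X)" "ds_cod (eta (a # X) :: 'k ds) = ups (length (a # X))"
    "ds_wf (eta (a # X) :: 'k ds)" "ds_dom (eta' (a # X) :: 'k ds) = ups (length (a # X))"
    "ds_cod (eta' (a # X) :: 'k ds) = rev (a # X)" "ds_wf (eta' (a # X) :: 'k ds)"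
    by (cases a; simp)+
qed simp_all

definition et where "et X = dc (eta (rev X))"
definition et' where "et' X = dc (eta' (rev X))"

lemma et_simps:
  "et [] = E []" "et (X @ [Up]) = rt [Up] (et X)" "et (X @ [Dn]) = th (length X) [] \<star> rt [Dn] (et X)"
  "et' [] = E []" "et' (X @ [Up]) = rt [Up] (et' X)" "et' (X @ [Dn]) = rt [Dn] (et' X) \<star> th' (length X) []"
  by (simp_all add: et_def et'_def rt_cls dc_push D.Id_left_cls D.Id_right_cls th_def th'_def dc_act_unit)

lemma et_ups: "et (ups n) = E (ups n)"
  by (induction n) (simp_all add: et_simps rt_E)

lemma et_inv: "et X \<star> et' X = E (ups (length X))" "et' X \<star> et X = E X"
proof (induction X rule: rev_induct)
  case (snoc a X)
  have r: "rt Z (et X) \<star> rt Z (et' X) = E (ups (length X) @ Z)" "rt Z (et' X) \<star> rt Z (et X) = E (X @ Z)" for Z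
    using snoc by (simp_all add: rt_E flip: rt_cmp)
  {
    case 1 show ?case
      by (cases a) (simp_all add: et_simps r d_assoc r[THEN d_re] E_th[THEN d_re] E_th th_inv)
  next
    case 2 
    have e: "E (ups (length X) @ [Dn]) \<star> rt [Dn] (et X) = rt [Dn] (et X)"
      by (simp add: et_def rt_cls D.Id_left_cls)
    show ?case
      by (cases a) (simp_all add: et_simps r d_assoc r[THEN d_re] th_inv[THEN d_re] e)
  }
qed (simp_all add: et_simps E_E)

lemma rt_pls: "rt Z (dc f \<oplus> dc g) = rt Z (dc f) \<oplus> rt Z (dc g)"
  by (simp add: D.ops_cls rt_cls dc_pls_act)

lemma Zer_cls: "dc (DZer X Y) = 0 \<bullet> dc (DZer X Y)"
  using D.Scl_zero_cls[of "DZer X Y"] by simp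

lemma rt_zer: "rt Z (dc (DZer X Y)) = dc (DZer (X @ Z) (Y @ Z))"
proof -
  have "rt Z (dc (DZer X Y)) = 0 \<bullet> dc (DZer X Y \<otimes>\<^sub>D OId Z)"
    by (subst Zer_cls) (simp add: rt_scl rt_cls)
  also have "\<dots> = dc (DZer (X @ Z) (Y @ Z))"
    by (simp add: D.Scl_zero_cls)
  finally show ?thesis .
qed

lemma Psi_shift: "br_wf b \<Longrightarrow> dc (Psi (br_shift k b)) = rt (ups k) (dc (Psi b))"
proof (induction b)
  case (BCup n)
  show ?case unfolding br_shift.simps Psi_cup rt_cupc ups_add ..
next
  case (BCap n)
  show ?case unfolding br_shift.simps Psi_cap rt_capc ups_add ..
next
  case (BSig n i)
  then obtain p r where i: "i = p + 1" "n = p + 2 + r" using crossing_position[of i n] by auto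
  have e: "p + 2 + r + k = p + 2 + (r + k)" by simp
  show ?case unfolding br_shift.simps i e Psi_X[OF refl refl] rt_lt ups_add ..
next
  case (BInv n i)
  then obtain p r where i: "i = p + 1" "n = p + 2 + r" using crossing_position[of i n] by auto
  have e: "p + 2 + r + k = p + 2 + (r + k)" by simp
  show ?case unfolding br_shift.simps i e Psi_X[OF refl refl] rt_lt ups_add ..
next
  case (BPls f g)
  then show ?case by (simp add: dc_push rt_pls)
qed (simp_all add: dc_push rts rt_zer ups_add)

text \<open>On generators these are the sliding lemmas \<open>th_cupc\<close>,
  \<open>capc_th\<close>, \<open>th_x\<close> and \<open>th_xm\<close>. The statement is what
  naturality of \<open>et\<close> requires when a downward arrow is appended to a word.\<close>

lemma th_Psi: "br_wf b \<Longrightarrow> th (br_cod b) [] \<star> rt [Dn] (dc (Psi b)) = rt [Up] (dc (Psi b)) \<star> th (br_dom b) []"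
proof (induction b)
  case (BId n)
  show ?case by (simp add: rt_E E_th)
next
  case (BCup n)
  show ?case using th_cupc[of n "[]"] unfolding Psi_cup by (simp add: rt_cupc)
next
  case (BCap n)
  show ?case using capc_th[of n "[]"] unfolding Psi_cap by (simp add: rt_capc)
next
  case (BSig n i)
  then obtain p r where i: "i = p + 1" "n = p + 2 + r" using crossing_position[of i n] by auto
  show ?case using th_x[of p r "[]"] unfolding i Psi_X[OF refl refl] by (simp add: rt_lt)
next
  case (BInv n i)
  then obtain p r where i: "i = p + 1" "n = p + 2 + r" using crossing_position[of i n] by auto
  show ?case using th_xm[of p r "[]"] unfolding i Psi_X[OF refl refl] by (simp add: rt_lt)
next
  case (BCmp f g)
  then have f: "th (br_cod f) [] \<star> rt [Dn] (dc (Psi f)) = rt [Up] (dc (Psi f)) \<star> th (br_dom f) []"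
    and g: "th (br_cod g) [] \<star> rt [Dn] (dc (Psi g)) = rt [Up] (dc (Psi g)) \<star> th (br_dom g) []"
    by auto
  show ?case using f[THEN d_re] g BCmp.prems by (simp add: dc_push rts d_assoc)
next
  case (BZer m n)
  show ?case by (simp add: rt_zer th_def D.Cmp_Zer_cls D.Zer_Cmp_cls)
next
  case (BPls f g)
  then show ?case
    by (simp add: dc_push rt_pls D.Cmp_Pls_cls D.Pls_Cmp_cls D.is_cls_intros th_def rt_cls)
next
  case (BScl a f)
  then show ?case by (simp add: dc_push rts d_scl)
qed

text \<open>\<open>eta_nat M X Y\<close>: the morphism \<open>M : X \<rightarrow> Y\<close> is compatible with the comparison \<open>et\<close> between the
  identity and the composite of F with the functor given by \<open>Psi\<close>.\<close>

definition eta_nat :: "'k ds set \<Rightarrow> ori list \<Rightarrow> ori list \<Rightarrow> bool"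
  where "eta_nat M X Y \<longleftrightarrow> (\<exists>f. ds_wf f \<and> ds_dom f = X \<and> ds_cod f = Y \<and> M = dc f \<and>
    et Y \<star> dc f = dc (Psi (F f)) \<star> et X)"

section \<open>Naturality of the comparison \<open>et\<close>\<close>

lemma dc_Psi_F: "dc f = dc g \<Longrightarrow> ds_wf f \<Longrightarrow> dc (Psi (F f)) = dc (Psi (F g))"
  by (rule dc_Psi, rule ds_eq_F, rule D.cls_eqD) simp_all

lemma eta_nat_E: "eta_nat (E X) X X"
  unfolding eta_nat_def
  by (rule exI[of _ "DOs (OId X)"]) (simp add: et_def D.Id_left_cls D.Id_right_cls)

lemma eta_nat_cmp: "eta_nat M Y Z \<Longrightarrow> eta_nat N X Y \<Longrightarrow> eta_nat (M \<star> N) X Z"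
proof -
  assume "eta_nat M Y Z" "eta_nat N X Y"
  then obtain f g where f: "ds_wf f" "ds_dom f = Y" "ds_cod f = Z" "M = dc f" "et Z \<star> dc f = dc (Psi (F f)) \<star> et Y"
    and g: "ds_wf g" "ds_dom g = X" "ds_cod g = Y" "N = dc g" "et Y \<star> dc g = dc (Psi (F g)) \<star> et X"
    unfolding eta_nat_def by blast
  show ?thesis
    unfolding eta_nat_def
    by (rule exI[of _ "f \<cdot>\<^sub>D g"]) (use f g f(5)[THEN d_re] in \<open>simp add: dc_push d_assoc\<close>)
qed

lemma eta_nat_scl: "eta_nat M X Y \<Longrightarrow> eta_nat (a \<bullet> M) X Y"
proof -
  assume "eta_nat M X Y"
  then obtain f where f: "ds_wf f" "ds_dom f = X" "ds_cod f = Y" "M = dc f" "et Y \<star> dc f = dc (Psi (F f)) \<star> et X"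
    unfolding eta_nat_def by blast
  show ?thesis
    unfolding eta_nat_def
    by (rule exI[of _ "DScl a f"]) (use f in \<open>simp add: dc_push d_scl\<close>)
qed

lemma eta_nat_pls: "eta_nat M X Y \<Longrightarrow> eta_nat N X Y \<Longrightarrow> eta_nat (M \<oplus> N) X Y"
proof -
  assume "eta_nat M X Y" "eta_nat N X Y"
  then obtain f g where f: "ds_wf f" "ds_dom f = X" "ds_cod f = Y" "M = dc f" "et Y \<star> dc f = dc (Psi (F f)) \<star> et X"
    and g: "ds_wf g" "ds_dom g = X" "ds_cod g = Y" "N = dc g" "et Y \<star> dc g = dc (Psi (F g)) \<star> et X"
    unfolding eta_nat_def by blast
  show ?thesis
    unfolding eta_nat_def
    by (rule exI[of _ "DPls f g"])
      (use f g in \<open>simp add: dc_push D.Cmp_Pls_cls D.Pls_Cmp_cls D.is_cls_intros et_def\<close>)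
qed

lemma eta_nat_zer: "eta_nat (dc (DZer X Y)) X Y"
  unfolding eta_nat_def
  by (rule exI[of _ "DZer X Y"]) (simp add: et_def D.Cmp_Zer_cls D.Zer_Cmp_cls)

text \<open>Inverting a naturality square; it yields \<open>L\<close> from \<open>R\<close> and the
  toggle \<tau>' from \<tau>.\<close>

lemma eta_nat_inverse:
  assumes "eta_nat (dc f) X Y" "ds_wf g" "ds_dom g = Y" "ds_cod g = X" "ds_wf f" "ds_dom f = X" "ds_cod f = Y"
    "dc f \<star> dc g = E Y" "dc g \<star> dc f = E X"
  shows "eta_nat (dc g) Y X"
proof -
  obtain h where h: "ds_wf h" "dc h = dc f" "et Y \<star> dc h = dc (Psi (F h)) \<star> et X"
    using assms(1) unfolding eta_nat_def by metis
  have f: "et Y \<star> dc f = dc (Psi (F f)) \<star> et X"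
    using h dc_Psi_F[OF h(2)] by simp
  have "dc (Psi (F g)) \<star> dc (Psi (F f)) = dc (Psi (F (g \<cdot>\<^sub>D f)))"
    by (simp add: dc_push)
  also have "\<dots> = dc (Psi (F (DOs (OId X))))"
    by (rule dc_Psi_F) (use assms in \<open>simp_all add: D.ops_cls\<close>)
  finally have gf: "dc (Psi (F g)) \<star> dc (Psi (F f)) = E (ups (length X))"
    by simp
  have e: "E (ups (length X)) \<star> et X = et X" "et Y \<star> E Y = et Y"
    by (simp_all add: et_def D.Id_left_cls D.Id_right_cls)
  have "dc (Psi (F g)) \<star> et Y = dc (Psi (F g)) \<star> (et Y \<star> dc f) \<star> dc g"
    by (simp add: d_assoc assms(8) e)
  also have "\<dots> = et X \<star> dc g"
    unfolding f by (simp add: d_assoc gf[THEN d_re] e[THEN d_re])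
  finally show ?thesis
    unfolding eta_nat_def using assms by (intro exI[of _ g]) simp
qed

text \<open>For an upward arrow the square is merely whiskered. For a downward one \<open>et\<close>
  ends in an additional toggle, which passes the image of \<open>f\<close> by
  \<open>th_Psi\<close>.\<close>

lemma eta_nat_rt1: "eta_nat M X Y \<Longrightarrow> eta_nat (rt [a] M) (X @ [a]) (Y @ [a])"
proof -
  assume "eta_nat M X Y"
  then obtain f where f: "ds_wf f" "ds_dom f = X" "ds_cod f = Y" "M = dc f" "et Y \<star> dc f = dc (Psi (F f)) \<star> et X"
    unfolding eta_nat_def by blast
  have "dc (Psi (F (f \<otimes>\<^sub>D OId [a]))) = E (ups (length Y) @ [Up]) \<star> rt [Up] (dc (Psi (F f)))"
    using Psi_shift[of "F f" 1] f by (simp add: dc_push)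
  also have "\<dots> = rt [Up] (dc (Psi (F f)))"
    using f by (simp add: rt_cls D.Id_left_cls)
  finally have F: "dc (Psi (F (f \<otimes>\<^sub>D OId [a]))) = rt [Up] (dc (Psi (F f)))" .
  have r: "rt Z (et Y) \<star> rt Z (dc f) = rt Z (dc (Psi (F f))) \<star> rt Z (et X)" for Z
    using f(5) by (simp flip: rt_cmp)
  have "et (Y @ [a]) \<star> rt [a] (dc f) = rt [Up] (dc (Psi (F f))) \<star> et (X @ [a])"
  proof (cases a)
    case Up
    then show ?thesis using r[of "[Up]"] by (simp add: et_simps)
  next
    case Dn
    then show ?thesis
      using r[of "[Dn]"] th_Psi[of "F f", THEN d_re] f by (simp add: et_simps d_assoc)
  qed
  then show ?thesis
    unfolding eta_nat_def
    by (intro exI[of _ "f \<otimes>\<^sub>D OId [a]"]) (simp add: f F rt_cls del: F_term.simps)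
qed

lemma eta_nat_rt: "eta_nat M X Y \<Longrightarrow> eta_nat (rt Z M) (X @ Z) (Y @ Z)"
proof (induction Z rule: rev_induct)
  case Nil
  then show ?case by (auto simp: eta_nat_def rt_cls dc_act_unit)
next
  case (snoc a Z)
  then have "eta_nat (rt [a] (rt Z M)) ((X @ Z) @ [a]) ((Y @ Z) @ [a])"
    by (intro eta_nat_rt1)
  moreover obtain f where "M = dc f" using snoc.prems by (auto simp: eta_nat_def)
  ultimately show ?case by (simp add: rt_rt)
qed

text \<open>Toggling runs from left to right, so when the arrows of \<open>Y\<close> are toggled,
  those of \<open>X\<close> are already upward.\<close>

lemma et_append: "et (X @ Y) = et (ups (length X) @ Y) \<star> rt Y (et X)"
proof (induction Y rule: rev_induct)
  case Nil
  have "rt [] (et X) = et X" by (simp add: et_def rt_cls dc_act_unit)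
  then show ?case by (simp add: et_ups) (simp add: et_def D.Id_left_cls)
next
  case (snoc a Y)
  have r: "rt [a] (rt Y (et X)) = rt (Y @ [a]) (et X)" by (simp add: et_def rt_rt)
  have "et (X @ Y @ [a]) = et (ups (length X) @ Y @ [a]) \<star> rt [a] (rt Y (et X))"
  proof (cases a)
    case Up
    then show ?thesis
      using et_simps(2)[of "X @ Y"] et_simps(2)[of "ups (length X) @ Y"] snoc by (simp add: rt_cmp)
  next
    case Dn
    then show ?thesis
      using et_simps(3)[of "X @ Y"] et_simps(3)[of "ups (length X) @ Y"] snoc by (simp add: rt_cmp d_assoc)
  qed
  then show ?case unfolding r .
qed

text \<open>By \<open>dc_Psi_F\<close> the square does not depend on the representative hidden in
  \<open>eta_nat\<close>, and F takes the whiskered \<open>g\<close> to its action at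
  \<open>length X\<close>.\<close>

lemma eta_nat_lt_iff:
  assumes "os_wf g"
  shows "eta_nat (lt X g []) (X @ os_dom g) (X @ os_cod g) \<longleftrightarrow>
    et (X @ os_cod g) \<star> lt X g [] = dc (Psi (br_act q t (length X) g)) \<star> et (X @ os_dom g)"
proof -
  let ?f = "DOs (OId X \<otimes>\<^sub>O g \<otimes>\<^sub>O OId [])"
  have f: "dc ?f = lt X g []" by (simp add: lt_def)
  have "bc (F ?f) = bc (br_act q t (length X) g)"
    using assms by (simp add: bc_push b_id)
  then have F: "dc (Psi (F ?f)) = dc (Psi (br_act q t (length X) g))"
    by (rule dc_Psi) (use assms in simp)
  show ?thesis
  proof
    assume "eta_nat (lt X g []) (X @ os_dom g) (X @ os_cod g)"
    then obtain h where h: "ds_wf h" "dc h = lt X g []"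
      "et (X @ os_cod g) \<star> dc h = dc (Psi (F h)) \<star> et (X @ os_dom g)"
      unfolding eta_nat_def by metis
    have "dc (Psi (F h)) = dc (Psi (F ?f))"
      by (rule dc_Psi_F) (use h f in simp_all)
    with h F show "et (X @ os_cod g) \<star> lt X g [] = dc (Psi (br_act q t (length X) g)) \<star> et (X @ os_dom g)"
      by simp
  next
    assume "et (X @ os_cod g) \<star> lt X g [] = dc (Psi (br_act q t (length X) g)) \<star> et (X @ os_dom g)"
    with f F show "eta_nat (lt X g []) (X @ os_dom g) (X @ os_cod g)"
      unfolding eta_nat_def using assms by (intro exI[of _ ?f]) (simp del: F_term.simps)
  qed
qed

text \<open>The toggles of \<open>X\<close> act to the left of \<open>g\<close> and commute with it,
  so \<open>X\<close> may be straightened to upward arrows first.\<close>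

lemma eta_nat_left:
  assumes "os_wf g" "eta_nat (lt (ups (length X)) g []) (ups (length X) @ os_dom g) (ups (length X) @ os_cod g)"
  shows "eta_nat (lt X g []) (X @ os_dom g) (X @ os_cod g)"
proof -
  let ?u = "ups (length X)"
  have 1: "et (?u @ os_cod g) \<star> lt ?u g [] = dc (Psi (br_act q t (length X) g)) \<star> et (?u @ os_dom g)"
    using assms(2) eta_nat_lt_iff[OF assms(1), of ?u] by simp
  have 2: "rt (os_cod g) (et X) \<star> lt X g [] = lt ?u g [] \<star> rt (os_dom g) (et X)"
    using rt_interchange[of "[]" g "[]" "eta (rev X)"] by (simp add: et_def)
  show ?thesis
    unfolding eta_nat_lt_iff[OF assms(1)]
    using 1[THEN d_re] 2 by (simp add: et_append[of X] d_assoc)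
qed

lemma eta_nat_lt_ups:
  assumes "os_wf g" "\<And>n. eta_nat (lt (ups n) g []) (ups n @ os_dom g) (ups n @ os_cod g)"
  shows "eta_nat (lt X g Y) (X @ os_dom g @ Y) (X @ os_cod g @ Y)"
  using eta_nat_rt[OF eta_nat_left[OF assms(1) assms(2)], of Y X] by (simp add: rt_lt)

lemma et_ups_append:
  "et (ups n @ [Up]) = E (ups n @ [Up])" "et (ups n @ [Up, Up]) = E (ups n @ [Up, Up])"
  "et (ups n @ [Up, Dn]) = th (n + 1) []" "et (ups n @ [Dn, Up]) = th n [Up]"
  using et_ups[of "n + 1"] et_ups[of "n + 2"] et_simps(3)[of "ups (n + 1)"] et_simps(2)[of "ups n @ [Dn]"]
    et_simps(3)[of "ups n"]
  by (simp_all add: et_ups rt_E rts rt_th E_th)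

lemma eta_nat_X: "eta_nat (lt X OXp Y) (X @ [Up, Up] @ Y) (X @ [Up, Up] @ Y)"
  "eta_nat (lt X OXm Y) (X @ [Up, Up] @ Y) (X @ [Up, Up] @ Y)"
proof -
  have X: "dc (Psi (br_act q t n OXp)) = lt (ups n) OXp []" "dc (Psi (br_act q t n OXm)) = lt (ups n) OXm []" for n
    using Psi_X[of "n + 2" n 0 "n + 1"] by (simp_all del: Psi.simps(4,5))
  have "eta_nat (lt (ups n) g []) (ups n @ os_dom g) (ups n @ os_cod g)" if "g = OXp \<or> g = OXm" for n g
    by (subst eta_nat_lt_iff) (use that in \<open>auto simp: et_ups_append d_id X simp del: Psi.simps(4,5) br_act.simps\<close>)
  then have "eta_nat (lt X g Y) (X @ os_dom g @ Y) (X @ os_cod g @ Y)" if "g = OXp \<or> g = OXm" for g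
    by (intro eta_nat_lt_ups) (use that in auto)
  from this[of OXp] this[of OXm]
  show "eta_nat (lt X OXp Y) (X @ [Up, Up] @ Y) (X @ [Up, Up] @ Y)"
    "eta_nat (lt X OXm Y) (X @ [Up, Up] @ Y) (X @ [Up, Up] @ Y)"
    by simp_all
qed

text \<open>\<open>theta\<close> is built for this square: after \<open>n\<close> upward arrows,
  \<open>et\<close> is \<open>th (n + 1)\<close> at up-down and \<open>th n\<close> at down-up, and
  the recursion of \<open>theta\<close> is the equation required, as \<open>R\<close> acts by a
  crossing.\<close>

lemma eta_nat_R: "eta_nat (lt X R Y) (X @ [Up, Dn] @ Y) (X @ [Dn, Up] @ Y)"
proof -
  have "eta_nat (lt (ups n) R []) (ups n @ os_dom R) (ups n @ os_cod R)" for n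
  proof -
    have "dc (Psi (br_act q t n R)) = lt (ups n) OXp []"
      using dc_Psi[OF act_R_all[of n]] Psi_X(1)[of "n + 2" n 0 "n + 1"] by (simp del: Psi.simps(4,5))
    moreover have "th n [Up] \<star> lt (ups n) R [] = lt (ups n) OXp [] \<star> th (n + 1) []"
      by (simp add: th_Suc d_cancel E_th[THEN d_re] del: ups_Cons)
    ultimately show ?thesis
      using eta_nat_lt_iff[of R "ups n"] by (simp add: et_ups_append)
  qed
  then show ?thesis using eta_nat_lt_ups[of R X Y] by simp
qed

lemma eta_nat_L: "eta_nat (lt X L Y) (X @ [Dn, Up] @ Y) (X @ [Up, Dn] @ Y)"
  unfolding lt_def
  by (rule eta_nat_inverse[OF eta_nat_R[of X Y, unfolded lt_def]])
    (use R_inv[of X Y] in \<open>simp_all add: lt_def\<close>)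

text \<open>A cup with one more strand on its left is composed of \<open>c\<close>, a crossing and
  \<open>L\<close>, and natural morphisms are closed under composition. This reduces to the leftmost
  cup, where the square is the definition of \<open>cupc\<close>.\<close>

lemma eta_nat_c: "eta_nat (lt X Oc Y) (X @ Y) (X @ [Dn, Up] @ Y)"
proof -
  have "eta_nat (lt (ups n) Oc []) (ups n @ os_dom Oc) (ups n @ os_cod Oc)" for n
  proof (induction n rule: nat_induct_plus_1)
    case 0
    have "bc (br_act q t 0 Oc) = bc (BCup 0)"
      by (simp add: cup_eqs at_0 del: br_act.simps)
    from dc_Psi[OF this] have "dc (Psi (br_act q t 0 Oc)) = cupc []"
      unfolding Psi_cup by simp
    then show ?case
      using et_ups_append(4)[of 0] eta_nat_lt_iff[of Oc "[]"]
      by (simp add: et_simps th_0 cupc_def d_id d_assoc del: br_act.simps)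
  next
    case (Suc n)
    have e: "lt (ups n @ [Up]) Oc [] = lt (ups n) L [Up] \<star> lt (ups n @ [Dn]) OXp [] \<star> lt (ups n) Oc [Up]"
      using R_c[of OXp "ups n" "[]", symmetric] by (simp add: d_cancel)
    have "eta_nat (lt (ups n) L [Up] \<star> lt (ups n @ [Dn]) OXp [] \<star> lt (ups n) Oc [Up]) (ups n @ [Up]) (ups n @ [Up, Dn, Up])"
      using eta_nat_L[of "ups n" "[Up]"] eta_nat_X(1)[of "ups n @ [Dn]" "[]"] eta_nat_rt[OF Suc, of "[Up]"]
      by (auto intro!: eta_nat_cmp simp: rt_lt)
    then show ?case by (simp add: e)
  qed
  then show ?thesis using eta_nat_lt_ups[of Oc X Y] by simp
qed

text \<open>The induction of \<open>eta_nat_c\<close> with composition reversed and \<open>R\<close>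
  in place of \<open>L\<close>; the base case is \<open>d_capc_1\<close>.\<close>

lemma eta_nat_d: "eta_nat (lt X Od Y) (X @ [Up, Dn] @ Y) (X @ Y)"
proof -
  have "eta_nat (lt (ups n) Od []) (ups n @ os_dom Od) (ups n @ os_cod Od)" for n
  proof (induction n rule: nat_induct_plus_1)
    case 0
    have "bc (br_act q t 0 Od) = bc (BScl (q * uinv t) (BCap 0))"
      by (simp add: cup_eqs at_0 B.Scl_cls del: br_act.simps)
    from dc_Psi[OF this] have "dc (Psi (br_act q t 0 Od)) = (q * uinv t) \<bullet> capc []"
      unfolding Psi.simps(9) dc_push Psi_cap by simp
    then show ?case
      using et_ups_append(3)[of 0] eta_nat_lt_iff[of Od "[]"]
      by (simp add: et_simps d_capc_1 d_id d_scl capc_def d_assoc del: br_act.simps)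
  next
    case (Suc n)
    have e: "lt (ups n @ [Up]) Od [] = lt (ups n) Od [Up] \<star> lt (ups n @ [Up]) R [] \<star> lt (ups n) OXm [Dn]"
      using R_d[of OXp "ups n" "[]", THEN d_re] R_d[of OXp "ups n" "[]", symmetric, THEN d_re] by (simp add: d_cancel)
    have "eta_nat (lt (ups n) Od [Up] \<star> lt (ups n @ [Up]) R [] \<star> lt (ups n) OXm [Dn]) (ups n @ [Up, Up, Dn]) (ups n @ [Up])"
      using eta_nat_R[of "ups n @ [Up]" "[]"] eta_nat_X(2)[of "ups n" "[Dn]"] eta_nat_rt[OF Suc, of "[Up]"]
      by (auto intro!: eta_nat_cmp simp: rt_lt)
    then show ?case by (simp add: e)
  qed
  then show ?thesis using eta_nat_lt_ups[of Od X Y] by simp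
qed

lemma lt_zer: "lt X (OZer V W) Y = dc (DZer (X @ V @ Y) (X @ W @ Y))"
proof -
  have "lt X (OZer V W) Y = 0 \<bullet> lt X (OZer V W) Y"
    using O.Scl_zero_cls[of "OZer V W"] by (subst lt_scl[symmetric], intro lt_cong) (simp add: O.Scl_cls)
  also have "\<dots> = dc (DZer (X @ V @ Y) (X @ W @ Y))"
    unfolding lt_def by (subst D.Scl_zero_cls) simp_all
  finally show ?thesis .
qed

lemma eta_nat_lt: "os_wf g \<Longrightarrow> eta_nat (lt X g Y) (X @ os_dom g @ Y) (X @ os_cod g @ Y)"
proof (induction g arbitrary: X Y)
  case (OId Z)
  show ?case by (simp add: lt_id eta_nat_E)
next
  case Oc
  show ?case using eta_nat_c by simp
next
  case Od
  show ?case using eta_nat_d by simp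
next
  case Oc'
  show ?case using eta_nat_scl[OF eta_nat_cmp[OF eta_nat_L[of X Y] eta_nat_c[of X Y]], of t] by (simp add: c'_eq d_scl)
next
  case Od'
  show ?case using eta_nat_scl[OF eta_nat_cmp[OF eta_nat_d[of X Y] eta_nat_L[of X Y]], of t] by (simp add: d'_eq d_scl)
next
  case (OCmp g h)
  then have g: "eta_nat (lt X g Y) (X @ os_dom g @ Y) (X @ os_cod g @ Y)"
    and h: "eta_nat (lt X h Y) (X @ os_dom h @ Y) (X @ os_dom g @ Y)"
    by auto
  show ?case using eta_nat_cmp[OF g h] by (simp add: lt_cmp)
next
  case (OTen g h)
  then have g: "eta_nat (lt X g (os_cod h @ Y)) (X @ os_dom g @ os_cod h @ Y) (X @ os_cod g @ os_cod h @ Y)"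
    and h: "eta_nat (lt (X @ os_dom g) h Y) (X @ os_dom g @ os_dom h @ Y) (X @ os_dom g @ os_cod h @ Y)"
    using OTen.IH(2)[of "X @ os_dom g" Y] by auto
  show ?case using eta_nat_cmp[OF g h] by (simp add: lt_ten)
next
  case (OZer V W)
  show ?case by (simp add: lt_zer eta_nat_zer)
next
  case (OPls g h)
  then have "eta_nat (lt X g Y) (X @ os_dom g @ Y) (X @ os_cod g @ Y)"
    "eta_nat (lt X h Y) (X @ os_dom g @ Y) (X @ os_cod g @ Y)"
    by auto
  then show ?case using eta_nat_pls by (simp add: lt_pls)
next
  case (OScl a g)
  then show ?case by (simp add: lt_scl eta_nat_scl)
qed (use eta_nat_X in simp_all)

lemma eta_nat_tg: "eta_nat (tg []) [Dn] [Up]" "eta_nat (tg' []) [Up] [Dn]"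
proof -
  have e: "et [Up] = E [Up]" "et [Dn] = tg []"
    using et_simps(2)[of "[]"] et_simps(3)[of "[]"] by (simp_all add: et_simps rt_E th_0 d_id)
  show 1: "eta_nat (tg []) [Dn] [Up]"
    unfolding eta_nat_def by (rule exI[of _ DTau]) (simp add: tg_Nil e d_id)
  show "eta_nat (tg' []) [Up] [Dn]"
    unfolding tg_Nil[symmetric]
    by (rule eta_nat_inverse[OF 1[folded tg_Nil]]) (simp_all add: tg_Nil tg_inv)
qed

lemma eta_nat_all: "ds_wf f \<Longrightarrow> eta_nat (dc f) (ds_dom f) (ds_cod f)"
proof (induction f)
  case (DOs g)
  then show ?case using eta_nat_lt[of g "[]" "[]"] by (simp add: DOs_lt)
next
  case DTau
  show ?case using eta_nat_tg by (simp add: tg_Nil)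
next
  case DTau'
  show ?case using eta_nat_tg by (simp add: tg_Nil)
next
  case (DAct f g)
  have "dc (f \<otimes>\<^sub>D g) = dc (DOs (OId (ds_cod f)) \<otimes>\<^sub>D g) \<star> rt (os_dom g) (dc f)"
    unfolding rt_cls D.ops_cls by (rule dc_split_act) simp_all
  also have "dc (DOs (OId (ds_cod f)) \<otimes>\<^sub>D g) = lt (ds_cod f) g []"
    unfolding dc_DOs_act lt_def by (intro dc_DOs oc_ten refl oc_ten_unit_right[symmetric])
  finally show ?case
    using eta_nat_cmp[of "lt (ds_cod f) g []" "ds_cod f @ os_dom g" "ds_cod f @ os_cod g" "rt (os_dom g) (dc f)" "ds_dom f @ os_dom g"]
      eta_nat_lt[of g "ds_cod f" "[]"] eta_nat_rt DAct by simp
next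
  case (DCmp f g)
  then show ?case using eta_nat_cmp[of "dc f" "ds_dom f" "ds_cod f" "dc g" "ds_dom g"] by (simp add: dc_push)
next
  case (DZer X Y)
  show ?case by (simp add: eta_nat_zer)
next
  case (DPls f g)
  then show ?case using eta_nat_pls[of "dc f" "ds_dom f" "ds_cod f" "dc g"] by (simp add: dc_push)
next
  case (DScl a f)
  then show ?case using eta_nat_scl by (simp add: dc_push)
qed

lemma et_natural: "ds_wf f \<Longrightarrow> et (ds_cod f) \<star> dc f = dc (Psi (F f)) \<star> et (ds_dom f)"
proof -
  assume "ds_wf f"
  from eta_nat_all[OF this] obtain h where h: "ds_wf h" "dc h = dc f" "et (ds_cod f) \<star> dc h = dc (Psi (F h)) \<star> et (ds_dom f)"
    unfolding eta_nat_def by metis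
  then show ?thesis using dc_Psi_F[OF h(2)] by simp
qed

definition G_mor :: "'k br set \<Rightarrow> 'k ds set" where "G_mor = lift1 (ds_eq q t \<delta>) Psi"

lemma G_mor_cls: "br_wf b \<Longrightarrow> G_mor (bc b) = dc (Psi b)"
proof -
  assume b: "br_wf b"
  have "dc (Psi g) = dc (Psi b)" if "g \<in> bc b" for g
    using that by - (rule br_eq_Psi, rule B.E_sym, simp add: cls_def)
  then show ?thesis
    unfolding G_mor_def by (rule lift1_const[OF B.cls_self[OF b]])
qed

lemma equivalence_F: "equivalence_of_categories (DS q t \<delta>) (Brauer q t \<delta>) length F_mor"
proof -
  interpret linear_functor "DS q t \<delta>" "Brauer q t \<delta>" length F_mor by (rule linear_functor_F)
  have "cat_functor (Brauer q t \<delta>) (DS q t \<delta>) ups G_mor"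
    by unfold_locales
      ((elim Hom_Brauer_E)?; simp add: DS_simps(2-) Brauer_simps(2-) D.ops_cls B.ops_cls G_mor_cls dc_in_Hom)+
  moreover have "natural_iso (DS q t \<delta>) (DS q t \<delta>) id id (ups \<circ> length) (G_mor \<circ> F_mor) et"
    unfolding natural_iso_def
  proof (intro conjI allI ballI)
    fix X
    have "et X \<in> Hom (DS q t \<delta>) X (ups (length X))" "et' X \<in> Hom (DS q t \<delta>) (ups (length X)) X"
      by (simp_all add: et_def et'_def dc_in_Hom)
    then show "is_iso (DS q t \<delta>) (id X) ((ups \<circ> length) X) (et X)"
      unfolding is_iso_def using et_inv[of X] by (auto simp: DS_simps(2-) intro!: bexI[of _ "et' X"])
  next
    fix X Y M
    assume "M \<in> Hom (DS q t \<delta>) X Y"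
    then show "Cmp (DS q t \<delta>) (et Y) (id M) = Cmp (DS q t \<delta>) ((G_mor \<circ> F_mor) M) (et X)"
      by (elim Hom_DS_E) (use et_natural in \<open>auto simp: DS_simps(2-) F_mor_cls G_mor_cls\<close>)
  qed
  moreover have "natural_iso (Brauer q t \<delta>) (Brauer q t \<delta>) (length \<circ> ups) (F_mor \<circ> G_mor) id id (\<lambda>n. J n)"
    unfolding natural_iso_def
  proof (intro conjI allI ballI)
    fix n
    show "is_iso (Brauer q t \<delta>) ((length \<circ> ups) n) (id n) (J n)"
      unfolding is_iso_def
      by (auto simp: Brauer_simps(2-) bc_in_Hom b_id intro!: bexI[of _ "J n"])
  next
    fix m n M
    assume "M \<in> Hom (Brauer q t \<delta>) m n"
    then show "Cmp (Brauer q t \<delta>) (J n) ((F_mor \<circ> G_mor) M) = Cmp (Brauer q t \<delta>) (id M) (J m)"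
      by (elim Hom_Brauer_E) (simp add: Brauer_simps(2-) F_mor_cls G_mor_cls F_Psi b_id)
  qed
  ultimately show ?thesis
    unfolding equivalence_of_categories_def using cat_functor_axioms by blast
qed

end

theorem theorem4p5:
  fixes q t \<delta> :: "'k::{comm_ring,comm_monoid_mult}"
  assumes "q dvd 1" and "t dvd 1" and "t - uinv t = \<delta> * (q - uinv q)"
  shows "\<exists>FO FM. is_F q t \<delta> FO FM \<and>
    (\<forall>GO GM. is_F q t \<delta> GO GM \<longrightarrow>
      GO = FO \<and> (\<forall>X Y. \<forall>f \<in> Hom (DS q t \<delta>) X Y. GM f = FM f)) \<and>
    strict_module_equivalence (OS q t \<delta>) (DS q t \<delta>) (Brauer q t \<delta>) FO FM"
proof -
  interpret skein_parameters q t \<delta>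
    by unfold_locales fact+
  \<comment> \<open>Off the hom-sets \<open>GM\<close> is unconstrained, so two such functors are
    compared on morphisms.\<close>
  have "GM f = F_mor f" if "is_F q t \<delta> GO GM" "f \<in> Hom (DS q t \<delta>) X Y" for GO GM X Y f
    using that(2) by (elim Hom_DS_E) (simp add: is_F_unique(2)[OF that(1)] F_mor_cls)
  then show ?thesis
    using is_F_F is_F_unique(1) strict_module_morphism_F equivalence_F
    unfolding strict_module_equivalence_def by blast
qed

end
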